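(* The Veech group $\mathbf{V}_\Sigma$ of the Disco surface $\Sigma$ is exactly $\Gamma$, where $$\Gamma=\Big\langle \begin{pmatrix}1&6\\0&1\end{pmatrix},\ \begin{pmatrix}1&0\\ \frac32&1\end{pmatrix},\ \begin{pmatrix}-1&0\\0&-1\end{pmatrix}\Big\rangle\subset \mathrm{SL}(2,\mathbb{R}).$$
   Context: Disco surface. Let $\Sigma$ be the surface obtained from the rectangle $[0,6]\times[0,1]\subset\mathbb{R}^2\simeq\mathbb{C}$ by gluing the left side to the right side by translation, and gluing top sides to bottom sides as follows: $[0,1]\times\{1\}$ to $[1,3]\times\{0\}$, $[1,3]\times\{1\}$ to $[0,1]\times\{0\}$, $[3,5]\times\{1\}$ to $[5,6]\times\{0\}$, $[5,6]\times\{1\}$ to $[3,5]\times\{0\}$, each by the unique map $z\mapsto az+b$ with $a>0$, $b\in\mathbb{C}$, sending one side to the other. It is a closed genus $2$ surface, with a set $S$ of two singular points (the images of the points $(k,0),(k,1)$, $k\in\{0,1,3,5,6\}$), each of angle $4\pi$; on $\Sigma\setminus S$ there is an atlas (dilatation atlas) with transition maps locally of the form $z\mapsto az+b$, $a>0$, $b\in\mathbb{C}$. Veech group. $\mathrm{Affine}(\Sigma)$ is the group of orientation-preserving diffeomorphisms of $\Sigma$ (preserving $S$) which in charts of the dilatation atlas are of the form $v\mapsto Av+B$ with $A\in\mathrm{GL}^+(2,\mathbb{R})$, $B\in\mathbb{R}^2$. The linear part $A$ is well defined up to multiplication by a positive real; normalising it to have determinant $1$ gives a morphism $\rho:\mathrm{Affine}(\Sigma)\to\mathrm{SL}(2,\mathbb{R})$.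 The Veech group is $\mathbf{V}_\Sigma=\rho(\mathrm{Affine}(\Sigma))$. *)

theory Defs
  imports "HOL-Analysis.Analysis" "HOL-Algebra.Bij" "HOL-Algebra.Generated_Groups"
begin

section \<open>The Disco surface\<close>

definition disco_rect :: "(real ^ 2) set" where
  "disco_rect = cbox (vector [0, 0]) (vector [6, 1])"

abbreviation seg :: "real \<Rightarrow> real \<Rightarrow> real \<Rightarrow> real \<Rightarrow> (real ^ 2) set" where
  "seg x y x' y' \<equiv> closed_segment (vector [x, y]) (vector [x', y'])"

definition disco_sides :: "((real ^ 2) set \<times> (real ^ 2) set) set" where
  "disco_sides =
    {(seg 0 0 0 1, seg 6 0 6 1),
     (seg 0 1 1 1, seg 1 0 3 0),
     (seg 1 1 3 1, seg 0 0 1 0),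
     (seg 3 1 5 1, seg 5 0 6 0),
     (seg 5 1 6 1, seg 3 0 5 0)}"

text \<open>For each pair of sides \<open>(s, t)\<close> the map \<open>v \<mapsto> a v + b\<close> with \<open>a > 0\<close> carrying \<open>s\<close> onto \<open>t\<close>
  is unique; for the two vertical sides it is the translation by \<open>(6, 0)\<close>.\<close>

definition disco_glue :: "real ^ 2 \<Rightarrow> real ^ 2 \<Rightarrow> bool" where
  "disco_glue z w \<longleftrightarrow>
    (\<exists>(s, t) \<in> disco_sides. \<exists>a b. a > 0 \<and> (\<lambda>v. a *\<^sub>R v + b) ` s = t \<and> z \<in> s \<and> w = a *\<^sub>R z + b)"

definition disco_rel :: "((real ^ 2) \<times> (real ^ 2)) set" where
  "disco_rel = {(z, w). z \<in> disco_rect \<and> w \<in> disco_rect \<and> equivclp disco_glue z w}"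

definition disco_proj :: "real ^ 2 \<Rightarrow> (real ^ 2) set" where
  "disco_proj z = disco_rel `` {z}"

text \<open>The quotient topology on \<open>disco_rect // disco_rel\<close>.\<close>

definition disco :: "(real ^ 2) set topology" where
  "disco = topology (\<lambda>U. U \<subseteq> disco_rect // disco_rel \<and>
             openin (top_of_set disco_rect) {z \<in> disco_rect. disco_proj z \<in> U})"

lemma openin_disco:
  "openin disco U \<longleftrightarrow> U \<subseteq> disco_rect // disco_rel \<and>
     openin (top_of_set disco_rect) {z \<in> disco_rect. disco_proj z \<in> U}"
proof -
  let ?P = "\<lambda>U. U \<subseteq> disco_rect // disco_rel \<and>
     openin (top_of_set disco_rect) {z \<in> disco_rect. disco_proj z \<in> U}"
  have "istopology ?P"
    unfolding istopology_def
  proof (intro conjI allI impI)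
    fix S T assume "?P S" "?P T"
    moreover have "{z \<in> disco_rect. disco_proj z \<in> S \<inter> T} =
        {z \<in> disco_rect. disco_proj z \<in> S} \<inter> {z \<in> disco_rect. disco_proj z \<in> T}"
      by auto
    ultimately show "S \<inter> T \<subseteq> disco_rect // disco_rel"
      "openin (top_of_set disco_rect) {z \<in> disco_rect. disco_proj z \<in> S \<inter> T}"
      by (auto intro: openin_Int)
  next
    fix K assume *: "\<forall>S\<in>K. ?P S"
    have "{z \<in> disco_rect. disco_proj z \<in> \<Union>K} =
        \<Union> ((\<lambda>S. {z \<in> disco_rect. disco_proj z \<in> S}) ` K)"
      by auto
    moreover have "openin (top_of_set disco_rect) (\<Union> ((\<lambda>S. {z \<in> disco_rect. disco_proj z \<in> S}) ` K))"
      using * by (intro openin_Union) blast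
    ultimately show "openin (top_of_set disco_rect) {z \<in> disco_rect. disco_proj z \<in> \<Union>K}"
      by simp
    show "\<Union>K \<subseteq> disco_rect // disco_rel"
      using * by blast
  qed
  then show ?thesis
    by (simp add: disco_def)
qed

lemma topspace_disco: "topspace disco = disco_rect // disco_rel"
proof
  show "topspace disco \<subseteq> disco_rect // disco_rel"
    by (auto simp: topspace_def openin_disco)
  have "{z \<in> disco_rect. disco_proj z \<in> disco_rect // disco_rel} = disco_rect"
    by (auto simp: disco_proj_def intro: quotientI)
  then have "openin disco (disco_rect // disco_rel)"
    by (simp add: openin_disco)
  then show "disco_rect // disco_rel \<subseteq> topspace disco"
    by (rule openin_subset)
qed

definition disco_sing :: "(real ^ 2) set set" where
  "disco_sing = disco_proj ` {vector [k, y] | k y. k \<in> {0, 1, 3, 5, 6} \<and> y \<in> {0, 1}}"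


section \<open>The dilatation atlas\<close>

text \<open>The maximal atlas: charts of the surface minus the singular points which, read on the
  rectangle, are locally \<open>z \<mapsto> a z + b\<close> with \<open>a > 0\<close>. Near a point of a glued side the constants
  \<open>a, b\<close> on the two sides are separate, but since the chart is well defined on the quotient they
  must differ exactly by the gluing map; this is the chart obtained by developing one half-disc
  along the other.\<close>

definition disco_atlas :: "((real ^ 2) set set \<times> ((real ^ 2) set \<Rightarrow> real ^ 2)) set" where
  "disco_atlas = {(U, \<phi>).
     openin disco U \<and> U \<inter> disco_sing = {} \<and> open (\<phi> ` U) \<and>
     homeomorphic_map (subtopology disco U) (top_of_set (\<phi> ` U)) \<phi> \<and>
     (\<forall>z \<in> disco_rect. disco_proj z \<in> U \<longrightarrow>
        (\<exists>N a b. open N \<and> z \<in> N \<and> a > 0 \<and>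
           (\<forall>w \<in> N \<inter> disco_rect. disco_proj w \<in> U \<and> \<phi> (disco_proj w) = a *\<^sub>R w + b)))}"


section \<open>Affine group and Veech group\<close>

definition linear_at ::
  "((real ^ 2) set \<Rightarrow> (real ^ 2) set) \<Rightarrow>
   (real ^ 2) set set \<times> ((real ^ 2) set \<Rightarrow> real ^ 2) \<Rightarrow>
   (real ^ 2) set set \<times> ((real ^ 2) set \<Rightarrow> real ^ 2) \<Rightarrow>
   (real ^ 2) set \<Rightarrow> real ^ 2 ^ 2 \<Rightarrow> bool" where
  "linear_at f c c' p A \<longleftrightarrow>
     (\<exists>W B. openin disco W \<and> p \<in> W \<and> W \<subseteq> fst c \<and> f ` W \<subseteq> fst c' \<and>
        (\<forall>q \<in> W. snd c' (f q) = A *v snd c q + B))"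

text \<open>Diffeomorphisms are understood, as usual for cone singularities, as homeomorphisms of the
  closed surface that are smooth away from the singular points; smoothness there and preservation
  of the orientation follow from the affine form with \<open>det A > 0\<close>.\<close>

definition disco_affine :: "((real ^ 2) set \<Rightarrow> (real ^ 2) set) monoid" where
  "disco_affine = (BijGroup (topspace disco))
     \<lparr>carrier := {f \<in> Bij (topspace disco).
        homeomorphic_map disco disco f \<and> f ` disco_sing = disco_sing \<and>
        (\<forall>c \<in> disco_atlas. \<forall>c' \<in> disco_atlas. \<forall>p \<in> fst c.
           f p \<in> fst c' \<longrightarrow> (\<exists>A. det A > 0 \<and> linear_at f c c' p A))}\<rparr>"

definition normalise_det :: "real ^ 2 ^ 2 \<Rightarrow> real ^ 2 ^ 2" where
  "normalise_det A = (1 / sqrt (det A)) *\<^sub>R A"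

definition disco_rho :: "((real ^ 2) set \<Rightarrow> (real ^ 2) set) \<Rightarrow> real ^ 2 ^ 2" where
  "disco_rho f = (THE M. \<forall>c \<in> disco_atlas. \<forall>c' \<in> disco_atlas. \<forall>p \<in> fst c. \<forall>A.
     f p \<in> fst c' \<longrightarrow> linear_at f c c' p A \<longrightarrow> normalise_det A = M)"

definition disco_Veech :: "(real ^ 2 ^ 2) set" where
  "disco_Veech = disco_rho ` carrier disco_affine"


section \<open>The special linear group\<close>

definition SL2R :: "(real ^ 2 ^ 2) monoid" where
  "SL2R = \<lparr>carrier = {A. det A = 1}, mult = (**), one = mat 1\<rparr>"

lemma group_SL2R: "group SL2R"
proof (rule groupI)
  fix A assume "A \<in> carrier SL2R"
  then have A: "det A = 1" by (simp add: SL2R_def)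
  then obtain B where B: "A ** B = mat 1" "B ** A = mat 1"
    by (metis invertible_def invertible_det_nz zero_neq_one)
  have "det B = 1"
    using A det_mul[of A B] B by simp
  then show "\<exists>B\<in>carrier SL2R. B \<otimes>\<^bsub>SL2R\<^esub> A = \<one>\<^bsub>SL2R\<^esub>"
    using B by (auto simp: SL2R_def)
qed (auto simp: SL2R_def det_mul matrix_mul_assoc)

definition disco_Gamma :: "(real ^ 2 ^ 2) set" where
  "disco_Gamma = generate SL2R
     {vector [vector [1, 6], vector [0, 1]],
      vector [vector [1, 0], vector [3 / 2, 1]],
      vector [vector [-1, 0], vector [0, -1]]}"

end

(* The linear part of an affine automorphism is determined by the image of the horizontal direction.
   Horizontal leaves are closed with trivial holonomy, so their images are periodic lines of some
   direction (t, 1), and the first return map x |-> g(x + t mod 6) to the bottom of the rectangle has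
   a periodic orbit along which the product of the slopes of g is 1. That makes t rational, and it
   excludes t in [1, 4], where g contracts by 1/2 at every return to a suitable interval. Euclid's
   algorithm, run by the two parabolic generators, brings every rational direction to the
   horizontal one, the vertical one, or a direction with t in [1, 4]. The vertical direction is
   excluded because its two open cylinders would separate the dense connected image of the horizontal
   cylinder. So up to Gamma the automorphism preserves the horizontal cylinder; the four singular
   points on either boundary circle have no rotational symmetry, which leaves only powers of the
   horizontal twist, up to sign. *)

theory Submission
  imports Defs
begin

section \<open>The gluing relation\<close>

text \<open>The constants of \<open>disco_Gamma\<close> are moduli of cylinders: the horizontal one
  has circumference 6 and height 1, each of the two vertical ones has width 1 and circumference
  \<open>1 + 1/2\<close>. A full twist shears by 6, respectively by 3/2, and fixes the cylinder
  boundaries pointwise, which is why it passes to the glued surface. In coordinates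
  \<open>(2p, q)\<close> both parabolic generators shear by 3. The group they generate is thin:
  Euclid's algorithm leaves a gap \<open>1/2 \<le> p/q \<le> 2\<close>, that is
  \<open>1 \<le> t \<le> 4\<close>, which no group element closes. Dynamics closes it, because every
  gluing over \<open>[1, 5]\<close> has slope 1/2. A dilatation surface has no invariant length. The
  numerical trace of a closed leaf is its holonomy, the product of the slopes met; trivial for
  horizontal leaves and preserved by affine maps, it yields both the equation for \<open>t\<close>
  and the contradiction with contraction. A formal obstacle is that the charts of the maximal atlas
  are arbitrary. Six explicit patches, whose parametrisations are inverses of charts, cover the
  nonsingular points and replace it; maps are then compared by continuation of their germs.\<close>

abbreviation pt :: "real \<Rightarrow> real \<Rightarrow> real ^ 2" where
  "pt x y \<equiv> vector [x, y]"

lemma pt_nth [simp]: "pt x y $ 1 = x" "pt x y $ 2 = y"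
  by (simp_all add: vector_2)

lemma eq_2_iff: "(z::real^2) = w \<longleftrightarrow> z $ 1 = w $ 1 \<and> z $ 2 = w $ 2"
  by (auto simp: vec_eq_iff forall_2)

lemma pt_eta [simp]: "pt (z $ 1) (z $ 2) = z"
  by (simp add: eq_2_iff)

lemma mem_disco_rect: "z \<in> disco_rect \<longleftrightarrow> 0 \<le> z $ 1 \<and> z $ 1 \<le> 6 \<and> 0 \<le> z $ 2 \<and> z $ 2 \<le> 1"
  by (auto simp: disco_rect_def mem_box_cart forall_2)

lemma mem_horizontal_seg:
  assumes "x < x'"
  shows "z \<in> seg x y x' y \<longleftrightarrow> z $ 2 = y \<and> x \<le> z $ 1 \<and> z $ 1 \<le> x'"
proof
  assume "z \<in> seg x y x' y"
  then obtain u where "0 \<le> u" "u \<le> 1" "z = (1 - u) *\<^sub>R pt x y + u *\<^sub>R pt x' y"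
    by (auto simp: closed_segment_def)
  then have "z $ 2 = (1 - u) * y + u * y" "z $ 1 = (1 - u) * x + u * x'"
    by simp_all
  then have "z $ 2 = y" "z $ 1 = x + u * (x' - x)"
    by (simp_all add: algebra_simps)
  moreover have "u * (x' - x) \<le> 1 * (x' - x)"
    using assms \<open>u \<le> 1\<close> by (intro mult_right_mono) auto
  moreover have "0 \<le> u * (x' - x)"
    using assms \<open>0 \<le> u\<close> by simp
  ultimately show "z $ 2 = y \<and> x \<le> z $ 1 \<and> z $ 1 \<le> x'"
    unfolding mult_1 by (metis add_le_cancel_left add.commute diff_add_cancel le_add_same_cancel2)
next
  assume z: "z $ 2 = y \<and> x \<le> z $ 1 \<and> z $ 1 \<le> x'"
  define u where "u = (z $ 1 - x) / (x' - x)"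
  have "0 \<le> u" "u \<le> 1"
    using z assms by (auto simp: u_def)
  moreover have "u * (x' - x) = z $ 1 - x"
    using assms by (simp add: u_def)
  then have "z = (1 - u) *\<^sub>R pt x y + u *\<^sub>R pt x' y"
    using z by (simp add: eq_2_iff algebra_simps)
  ultimately show "z \<in> seg x y x' y"
    by (auto simp: closed_segment_def)
qed

lemma mem_vertical_seg:
  "z \<in> seg x 0 x 1 \<longleftrightarrow> z $ 1 = x \<and> 0 \<le> z $ 2 \<and> z $ 2 \<le> 1"
proof
  assume "z \<in> seg x 0 x 1"
  then obtain u where "0 \<le> u" "u \<le> 1" "z = (1 - u) *\<^sub>R pt x 0 + u *\<^sub>R pt x 1"
    by (auto simp: closed_segment_def)
  then have "0 \<le> u" "u \<le> 1" "z $ 1 = (1 - u) * x + u * x" "z $ 2 = (1 - u) * 0 + u * 1"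
    by simp_all
  then show "z $ 1 = x \<and> 0 \<le> z $ 2 \<and> z $ 2 \<le> 1"
    by (simp add: algebra_simps)
next
  assume z: "z $ 1 = x \<and> 0 \<le> z $ 2 \<and> z $ 2 \<le> 1"
  then have "z = (1 - z $ 2) *\<^sub>R pt x 0 + (z $ 2) *\<^sub>R pt x 1"
    by (simp add: eq_2_iff algebra_simps)
  with z show "z \<in> seg x 0 x 1"
    by (auto simp: closed_segment_def)
qed

text \<open>A homothety carries endpoints to endpoints. Exchanging their order would force
  \<open>a = - r\<close>, so positivity leaves one map; this removes the existential constants from
  \<open>disco_glue\<close>.\<close>

lemma homothety_segment_iff:
  fixes P Q P' Q' :: "'a :: euclidean_space"
  assumes "P \<noteq> Q" and Q': "Q' - P' = r *\<^sub>R (Q - P)" and "r > 0" and "a > 0"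
  shows "(\<lambda>v. a *\<^sub>R v + b) ` closed_segment P Q = closed_segment P' Q' \<longleftrightarrow> a = r \<and> b = P' - r *\<^sub>R P"
proof -
  have "(\<lambda>v. a *\<^sub>R v + b) = (\<lambda>v. b + v) \<circ> (\<lambda>v. a *\<^sub>R v)"
    by (auto simp: add.commute)
  then have "(\<lambda>v. a *\<^sub>R v + b) ` closed_segment P Q = (\<lambda>v. b + v) ` ((\<lambda>v. a *\<^sub>R v) ` closed_segment P Q)"
    by (simp only: image_comp)
  also have "\<dots> = closed_segment (b + a *\<^sub>R P) (b + a *\<^sub>R Q)"
    by (simp add: closed_segment_linear_image closed_segment_translation)
  finally have "(\<lambda>v. a *\<^sub>R v + b) ` closed_segment P Q = closed_segment P' Q' \<longleftrightarrow>
     {b + a *\<^sub>R P, b + a *\<^sub>R Q} = {P', Q'}"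
    by (simp add: closed_segment_eq)
  also have "\<dots> \<longleftrightarrow> a = r \<and> b = P' - r *\<^sub>R P"
  proof
    assume "{b + a *\<^sub>R P, b + a *\<^sub>R Q} = {P', Q'}"
    then consider "P' = b + a *\<^sub>R P" "Q' = b + a *\<^sub>R Q" | "P' = b + a *\<^sub>R Q" "Q' = b + a *\<^sub>R P"
      by (auto simp: doubleton_eq_iff)
    then show "a = r \<and> b = P' - r *\<^sub>R P"
    proof cases
      case 1
      then have "(a - r) *\<^sub>R (Q - P) = 0"
        using Q' by (simp add: algebra_simps)
      with 1 \<open>P \<noteq> Q\<close> show ?thesis by simp
    next
      case 2
      then have "(a + r) *\<^sub>R (Q - P) = 0"
        using Q' by (simp add: algebra_simps)
      with \<open>P \<noteq> Q\<close> \<open>r > 0\<close> \<open>a > 0\<close> show ?thesis by simp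
    qed
  next
    assume "a = r \<and> b = P' - r *\<^sub>R P"
    moreover have "Q' = P' + r *\<^sub>R (Q - P)"
      using Q' by (simp add: algebra_simps)
    ultimately show "{b + a *\<^sub>R P, b + a *\<^sub>R Q} = {P', Q'}"
      by (auto simp: algebra_simps)
  qed
  finally show ?thesis .
qed

lemma glue_side_iff:
  fixes P Q P' Q' :: "real ^ 2"
  assumes "P \<noteq> Q" "Q' - P' = r *\<^sub>R (Q - P)" "r > 0"
  shows "(\<exists>a b. a > 0 \<and> (\<lambda>v. a *\<^sub>R v + b) ` closed_segment P Q = closed_segment P' Q' \<and>
            z \<in> closed_segment P Q \<and> w = a *\<^sub>R z + b) \<longleftrightarrow>
         z \<in> closed_segment P Q \<and> w = P' + r *\<^sub>R (z - P)"
proof -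
  have "(\<exists>a b. a > 0 \<and> (\<lambda>v. a *\<^sub>R v + b) ` closed_segment P Q = closed_segment P' Q' \<and>
            z \<in> closed_segment P Q \<and> w = a *\<^sub>R z + b) \<longleftrightarrow>
        (\<exists>a b. a = r \<and> b = P' - r *\<^sub>R P \<and> z \<in> closed_segment P Q \<and> w = a *\<^sub>R z + b)"
    using homothety_segment_iff[OF assms] \<open>r > 0\<close> by (intro ex_cong1) blast
  also have "\<dots> \<longleftrightarrow> z \<in> closed_segment P Q \<and> w = P' + r *\<^sub>R (z - P)"
    by (auto simp: scaleR_diff_right)
  finally show ?thesis .
qed

lemma disco_glue_iff:
  "disco_glue z w \<longleftrightarrow>
     (z $ 1 = 0 \<and> 0 \<le> z $ 2 \<and> z $ 2 \<le> 1 \<and> w = pt 6 (z $ 2)) \<or>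
     (z $ 2 = 1 \<and> 0 \<le> z $ 1 \<and> z $ 1 \<le> 1 \<and> w = pt (2 * z $ 1 + 1) 0) \<or>
     (z $ 2 = 1 \<and> 1 \<le> z $ 1 \<and> z $ 1 \<le> 3 \<and> w = pt ((z $ 1 - 1) / 2) 0) \<or>
     (z $ 2 = 1 \<and> 3 \<le> z $ 1 \<and> z $ 1 \<le> 5 \<and> w = pt (z $ 1 / 2 + 7 / 2) 0) \<or>
     (z $ 2 = 1 \<and> 5 \<le> z $ 1 \<and> z $ 1 \<le> 6 \<and> w = pt (2 * z $ 1 - 7) 0)"
proof -
  \<comment> \<open>Unfolding the bounded quantifier over the explicit set leaves a final
    \<open>False\<close>; without it both sides have five disjuncts and can be matched one by
    one.\<close>
  have or_False: "(P \<or> False) = P" for P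
    by simp
  have *: "disco_glue z w \<longleftrightarrow>
     z \<in> seg 0 0 0 1 \<and> w = pt 6 0 + 1 *\<^sub>R (z - pt 0 0) \<or>
     z \<in> seg 0 1 1 1 \<and> w = pt 1 0 + 2 *\<^sub>R (z - pt 0 1) \<or>
     z \<in> seg 1 1 3 1 \<and> w = pt 0 0 + (1/2) *\<^sub>R (z - pt 1 1) \<or>
     z \<in> seg 3 1 5 1 \<and> w = pt 5 0 + (1/2) *\<^sub>R (z - pt 3 1) \<or>
     z \<in> seg 5 1 6 1 \<and> w = pt 3 0 + 2 *\<^sub>R (z - pt 5 1)"
    unfolding disco_glue_def disco_sides_def bex_simps case_prod_conv or_False
    by (intro arg_cong2[where f = "(\<or>)"] glue_side_iff)
      (simp_all add: eq_2_iff)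
  show ?thesis
    unfolding *
    by (intro arg_cong2[where f = "(\<or>)"])
      (simp_all add: mem_horizontal_seg mem_vertical_seg eq_2_iff, auto simp: field_simps)
qed

text \<open>A canonical representative of each class. The ten vertices form two classes, represented by
  \<open>(0, 0)\<close> and \<open>(1, 0)\<close>.\<close>

definition rep :: "real ^ 2 \<Rightarrow> real ^ 2" where
  "rep z = (let x = z $ 1; y = z $ 2 in
     if y = 1 then
       (if x = 1 \<or> x = 5 then pt 0 0 else if x = 0 \<or> x = 3 \<or> x = 6 then pt 1 0
        else if x < 1 then pt (2 * x + 1) 0 else if x < 3 then pt ((x - 1) / 2) 0
        else if x < 5 then pt (x / 2 + 7 / 2) 0 else pt (2 * x - 7) 0)
     else if y = 0 then
       (if x = 0 \<or> x = 3 \<or> x = 6 then pt 0 0 else if x = 1 \<or> x = 5 then pt 1 0 else z)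
     else if x = 6 then pt 0 y else z)"

lemma disco_glue_rep:
  assumes "disco_glue z w" shows "rep z = rep w"
  using assms unfolding disco_glue_iff
  by (elim disjE conjE; simp add: rep_def Let_def eq_2_iff; auto)

lemma equivclp_disco_glue_rep:
  assumes "z \<in> disco_rect" shows "equivclp disco_glue z (rep z)"
proof -
  have g: "equivclp disco_glue (pt x y) (pt x' y')" if "disco_glue (pt x y) (pt x' y')" for x y x' y'
    using that by (rule r_into_equivclp)
  note s = equivclp_sym and t = equivclp_trans
  have v: "equivclp disco_glue (pt 0 y) (pt 6 y)" if "0 \<le> y" "y \<le> 1" for y
    by (rule g) (use that in \<open>simp add: disco_glue_iff\<close>)
  \<comment> \<open>A top vertex between two adjacent sides is glued by both of them. These
    coincidences, such as \<open>(1, 1)\<close> with \<open>(0, 0)\<close> and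
    \<open>(3, 0)\<close>, link the vertices of one class.\<close>
  have 1: "equivclp disco_glue (pt 1 1) (pt 0 0)" by (rule g) (simp add: disco_glue_iff eq_2_iff)
  have 2: "equivclp disco_glue (pt 1 1) (pt 3 0)" by (rule g) (simp add: disco_glue_iff eq_2_iff)
  have 3: "equivclp disco_glue (pt 5 1) (pt 3 0)" by (rule g) (simp add: disco_glue_iff eq_2_iff)
  have 4: "equivclp disco_glue (pt 0 1) (pt 1 0)" by (rule g) (simp add: disco_glue_iff eq_2_iff)
  have 5: "equivclp disco_glue (pt 3 1) (pt 1 0)" by (rule g) (simp add: disco_glue_iff eq_2_iff)
  have 6: "equivclp disco_glue (pt 3 1) (pt 5 0)" by (rule g) (simp add: disco_glue_iff eq_2_iff)
  have a: "equivclp disco_glue (pt 3 0) (pt 0 0)" by (rule t[OF s[OF 2] 1])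
  have b: "equivclp disco_glue (pt 5 1) (pt 0 0)" by (rule t[OF 3 a])
  have c: "equivclp disco_glue (pt 5 0) (pt 1 0)" by (rule t[OF s[OF 6] 5])
  have d: "equivclp disco_glue (pt 6 1) (pt 1 0)" by (rule t[OF s[OF v] 4]) simp_all
  have e: "equivclp disco_glue (pt 6 0) (pt 0 0)" by (rule s[OF v]) simp_all
  obtain x y where xy: "z = pt x y" by (metis pt_eta)
  have "0 \<le> x" "x \<le> 6" "0 \<le> y" "y \<le> 1"
    using assms by (auto simp: mem_disco_rect xy)
  show ?thesis
  proof (cases "y = 1")
    case True
    consider "x = 1" | "x = 5" | "x = 0" | "x = 3" | "x = 6" | "x \<notin> {0, 1, 3, 5, 6}"
      by auto
    then show ?thesis
    proof cases
      case 6
      then show ?thesis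
        using \<open>0 \<le> x\<close> \<open>x \<le> 6\<close> True
        by (intro r_into_equivclp) (auto simp: xy rep_def disco_glue_iff)
    qed (use True 1 4 5 b d in \<open>simp_all add: xy rep_def\<close>)
  next
    case False
    consider "y = 0" "x \<in> {0, 1, 3, 5, 6}" | "y = 0" "x \<notin> {0, 1, 3, 5, 6}" | "y \<noteq> 0" "x = 6" | "y \<noteq> 0" "x \<noteq> 6"
      by blast
    then show ?thesis
    proof cases
      case 1
      then show ?thesis
        using a c e by (elim insertE) (simp_all add: xy rep_def)
    next
      case 3
      then show ?thesis
        using s[OF v[OF \<open>0 \<le> y\<close> \<open>y \<le> 1\<close>]] False by (simp add: xy rep_def)
    qed (use False in \<open>simp_all add: xy rep_def\<close>)
  qed
qed

text \<open>\<open>rep\<close> is constant along gluings, and each point is equivalent to its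
  representative. From here on the quotient is computed through \<open>rep\<close> alone.\<close>

lemma disco_proj_eq_iff:
  assumes "z \<in> disco_rect" "w \<in> disco_rect"
  shows "disco_proj z = disco_proj w \<longleftrightarrow> rep z = rep w"
proof -
  have "rep z = rep w" if "equivclp disco_glue z w" for z w
    using that by (induction rule: equivclp_induct) (auto dest: disco_glue_rep)
  then have *: "equivclp disco_glue z w \<longleftrightarrow> rep z = rep w" if "z \<in> disco_rect" "w \<in> disco_rect" for z w
  proof
    assume "rep z = rep w"
    then show "equivclp disco_glue z w"
      using that equivclp_disco_glue_rep[of z] equivclp_sym[OF equivclp_disco_glue_rep[of w]]
      by (auto intro: equivclp_trans)
  qed (use \<open>\<And>w z. equivclp disco_glue z w \<Longrightarrow> rep z = rep w\<close> in blast)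
  show ?thesis
  proof
    assume "disco_proj z = disco_proj w"
    moreover have "w \<in> disco_proj w"
      using assms by (simp add: disco_proj_def disco_rel_def)
    ultimately show "rep z = rep w"
      using * assms by (auto simp: disco_proj_def disco_rel_def)
  next
    assume "rep z = rep w"
    then show "disco_proj z = disco_proj w"
      using * assms by (auto simp: disco_proj_def disco_rel_def)
  qed
qed

lemma quotient_map_disco_proj: "quotient_map (top_of_set disco_rect) disco disco_proj"
  unfolding quotient_map_def
proof (intro conjI allI impI)
  show "disco_proj ` topspace (top_of_set disco_rect) = topspace disco"
    by (auto simp: topspace_disco disco_proj_def quotient_def)
qed (auto simp: openin_disco topspace_disco)

lemma continuous_map_disco_proj: "continuous_map (top_of_set disco_rect) disco disco_proj"
  using quotient_map_disco_proj by (rule quotient_imp_continuous_map)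

lemma topspace_disco_eq: "topspace disco = disco_proj ` disco_rect"
  using quotient_imp_surjective_map[OF quotient_map_disco_proj] by simp

section \<open>Singular points and the fibres of the projection\<close>

definition vertex :: "real ^ 2 \<Rightarrow> bool" where
  "vertex z \<longleftrightarrow> (z $ 1 = 0 \<or> z $ 1 = 1 \<or> z $ 1 = 3 \<or> z $ 1 = 5 \<or> z $ 1 = 6) \<and> (z $ 2 = 0 \<or> z $ 2 = 1)"

lemma vertex_imp_rect: "vertex z \<Longrightarrow> z \<in> disco_rect"
  by (auto simp: vertex_def mem_disco_rect)

lemma rect_abscissa_cases:
  assumes "z \<in> disco_rect"
  obtains "z $ 1 = 0" | "0 < z $ 1" "z $ 1 < 1" | "z $ 1 = 1" | "1 < z $ 1" "z $ 1 < 3" | "z $ 1 = 3"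
    | "3 < z $ 1" "z $ 1 < 5" | "z $ 1 = 5" | "5 < z $ 1" "z $ 1 < 6" | "z $ 1 = 6"
  using assms unfolding mem_disco_rect by linarith

lemma rep_vertex:
  assumes "z \<in> disco_rect"
  shows "vertex z \<longleftrightarrow> rep z = pt 0 0 \<or> rep z = pt 1 0"
proof
  show "vertex z \<Longrightarrow> rep z = pt 0 0 \<or> rep z = pt 1 0"
    by (auto simp: vertex_def rep_def)
  show "rep z = pt 0 0 \<or> rep z = pt 1 0 \<Longrightarrow> vertex z"
    using assms
    by (cases rule: rect_abscissa_cases[OF assms(1)]; cases "z $ 2 = 1"; cases "z $ 2 = 0")
      (simp_all add: vertex_def rep_def eq_2_iff mem_disco_rect)
qed

lemma disco_sing_eq: "disco_sing = disco_proj ` {z. vertex z}"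
proof -
  have "{pt k y |k y. k \<in> {0, 1, 3, 5, 6} \<and> y \<in> {0, 1}} = {z. vertex z}"
    by (force simp: vertex_def eq_2_iff)
  then show ?thesis
    by (simp add: disco_sing_def)
qed

lemma disco_proj_in_sing_iff:
  assumes "z \<in> disco_rect"
  shows "disco_proj z \<in> disco_sing \<longleftrightarrow> vertex z"
proof
  assume "disco_proj z \<in> disco_sing"
  then obtain w where w: "vertex w" "disco_proj z = disco_proj w"
    by (auto simp: disco_sing_eq)
  then have "rep z = rep w"
    using assms disco_proj_eq_iff vertex_imp_rect by blast
  then show "vertex z"
    using w rep_vertex assms vertex_imp_rect by metis
qed (auto simp: disco_sing_eq)

lemma rep_interior_iff:
  assumes "z \<in> disco_rect" "0 < v" "v < 1"
  shows "rep z = pt u v \<longleftrightarrow> z = pt u v \<and> u \<noteq> 6 \<or> u = 0 \<and> z = pt 6 v"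
  using assms by (auto simp: rep_def Let_def eq_2_iff mem_disco_rect split: if_splits)

text \<open>The piecewise expression inverts the four gluings: it is the abscissa at which a top
  side is glued to the bottom point \<open>u\<close>. Away from the vertices the fibre consists of
  these two points.\<close>

lemma rep_bottom_iff:
  assumes "z \<in> disco_rect" "u \<notin> {0, 1, 3, 5, 6}" "0 < u" "u < 6"
  shows "rep z = pt u 0 \<longleftrightarrow> z = pt u 0 \<or> 
    z $ 2 = 1 \<and> z $ 1 = (if u < 1 then 2 * u + 1 else if u < 3 then (u - 1) / 2
       else if u < 5 then (u + 7) / 2 else 2 * u - 7)"
proof
  assume "rep z = pt u 0"
  then show "z = pt u 0 \<or> z $ 2 = 1 \<and> z $ 1 = (if u < 1 then 2 * u + 1 else if u < 3 then (u - 1) / 2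
       else if u < 5 then (u + 7) / 2 else 2 * u - 7)"
    using assms
    by (cases rule: rect_abscissa_cases[OF assms(1)]; cases "z $ 2 = 1"; cases "z $ 2 = 0")
      (auto simp: rep_def eq_2_iff mem_disco_rect)
next
  assume "z = pt u 0 \<or> z $ 2 = 1 \<and> z $ 1 = (if u < 1 then 2 * u + 1 else if u < 3 then (u - 1) / 2
       else if u < 5 then (u + 7) / 2 else 2 * u - 7)"
  then show "rep z = pt u 0"
  proof
    assume "z = pt u 0"
    then show ?thesis
      using assms by (simp add: rep_def)
  next
    assume z: "z $ 2 = 1 \<and> z $ 1 = (if u < 1 then 2 * u + 1 else if u < 3 then (u - 1) / 2
       else if u < 5 then (u + 7) / 2 else 2 * u - 7)"
    have "u < 1 \<or> 1 < u \<and> u < 3 \<or> 3 < u \<and> u < 5 \<or> 5 < u"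
      using assms by (simp, linarith)
    then consider "u < 1" | "1 < u" "u < 3" | "3 < u" "u < 5" | "5 < u"
      by blast
    then show ?thesis
      using z assms by cases (auto simp: rep_def Let_def eq_2_iff field_simps)
  qed
qed

text \<open>A fibre without vertices has at most two points, so chains of the equivalence closure
  reduce to a single gluing. This finite description makes closedness of the relation
  checkable.\<close>

lemma rep_eq_cases:
  assumes "z \<in> disco_rect" "w \<in> disco_rect" "rep z = rep w"
  shows "z = w \<or> disco_glue z w \<or> disco_glue w z \<or> vertex z \<and> vertex w"
proof (cases "vertex z")
  case True
  then show ?thesis
    using assms rep_vertex by metis
next
  case False
  then have nw: "\<not> vertex w"
    using assms rep_vertex by metis
  obtain u v where uv: "rep w = pt u v"
    by (metis pt_eta)
  have rw: "rep w \<noteq> pt 0 0" "rep w \<noteq> pt 1 0"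
    using rep_vertex[OF assms(2)] nw by auto
  have "0 \<le> rep w $ 2 \<and> rep w $ 2 < 1 \<and> 0 \<le> rep w $ 1 \<and> rep w $ 1 < 6"
    using assms(2)
    by (cases rule: rect_abscissa_cases[OF assms(2)]; cases "w $ 2 = 1"; cases "w $ 2 = 0")
      (simp_all add: rep_def mem_disco_rect)
  moreover have "rep w $ 2 = 0 \<longrightarrow> rep w $ 1 \<notin> {0, 1, 3, 5, 6}"
    using assms(2) rw
    by (cases rule: rect_abscissa_cases[OF assms(2)]; cases "w $ 2 = 1"; cases "w $ 2 = 0")
      (simp_all add: rep_def mem_disco_rect)
  ultimately have *: "0 \<le> v" "v < 1" "0 \<le> u" "u < 6" "v = 0 \<Longrightarrow> u \<notin> {0, 1, 3, 5, 6}"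
    unfolding uv by auto
  show ?thesis
  proof (cases "v = 0")
    case True
    with * have u: "u \<notin> {0, 1, 3, 5, 6}" "0 < u" "u < 6"
      by (auto simp: le_less)
    define t where "t = (if u < 1 then 2 * u + 1 else if u < 3 then (u - 1) / 2
       else if u < 5 then (u + 7) / 2 else 2 * u - 7)"
    have "z = pt u 0 \<or> z = pt t 1" "w = pt u 0 \<or> w = pt t 1"
      using rep_bottom_iff[OF assms(1) u] rep_bottom_iff[OF assms(2) u] assms(3) uv True
      by (auto simp: t_def eq_2_iff)
    moreover have "disco_glue (pt t 1) (pt u 0)"
      using u by (auto simp: disco_glue_iff t_def eq_2_iff field_simps)
    ultimately show ?thesis
      by auto
  next
    case False
    with * have v: "0 < v" by simp
    have "z = pt u v \<or> u = 0 \<and> z = pt 6 v" "w = pt u v \<or> u = 0 \<and> w = pt 6 v"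
      using rep_interior_iff[OF assms(1) v \<open>v < 1\<close>] rep_interior_iff[OF assms(2) v \<open>v < 1\<close>] assms(3) uv
      by auto
    moreover have "disco_glue (pt 0 v) (pt 6 v)"
      using * by (simp add: disco_glue_iff)
    ultimately show ?thesis
      by auto
  qed
qed

section \<open>Separation properties of the quotient\<close>

lemma closed_disco_rel: "closed {(z, w). z \<in> disco_rect \<and> w \<in> disco_rect \<and> disco_proj z = disco_proj w}"
proof -
  let ?V = "{(z, w). vertex z \<and> vertex w \<and> rep z = rep w}"
  let ?G = "{p. disco_glue (fst p) (snd p)}"
  have rect: "z \<in> disco_rect \<and> w \<in> disco_rect" if "disco_glue z w" for z w
    using that by (auto simp: disco_glue_iff mem_disco_rect)
  have "{(z, w). z \<in> disco_rect \<and> w \<in> disco_rect \<and> disco_proj z = disco_proj w} =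
      {(z, w). z \<in> disco_rect \<and> w \<in> disco_rect \<and> rep z = rep w}"
    by (intro Collect_cong) (simp add: disco_proj_eq_iff cong: conj_cong split: prod.split)
  \<comment> \<open>The pieces are the diagonal, the graph of the gluing, its converse and the
    vertex pairs. The first three are cut out by equations and nonstrict inequalities, the last is
    finite.\<close>
  also have "\<dots> =
      {p. fst p \<in> disco_rect \<and> fst p = snd p} \<union> ?G \<union> {p. disco_glue (snd p) (fst p)} \<union> ?V"
    (is "?L = ?M")
  proof (intro equalityI subsetI)
    fix p assume "p \<in> ?L"
    then show "p \<in> ?M"
      using rep_eq_cases[of "fst p" "snd p"] by auto
  next
    fix p assume "p \<in> ?M"
    then consider "fst p \<in> disco_rect" "fst p = snd p" | "disco_glue (fst p) (snd p)"
      | "disco_glue (snd p) (fst p)" | "vertex (fst p)" "vertex (snd p)" "rep (fst p) = rep (snd p)"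
      by auto
    then have "fst p \<in> disco_rect \<and> snd p \<in> disco_rect \<and> rep (fst p) = rep (snd p)"
    proof cases
      case 2
      then show ?thesis using rect[OF 2] disco_glue_rep[OF 2] by simp
    next
      case 3
      then show ?thesis using rect[OF 3] disco_glue_rep[OF 3] by simp
    qed (auto intro: vertex_imp_rect)
    then show "p \<in> ?L"
      by auto
  qed
  finally have "{(z, w). z \<in> disco_rect \<and> w \<in> disco_rect \<and> disco_proj z = disco_proj w} =
      {p. fst p \<in> disco_rect \<and> fst p = snd p} \<union> ?G \<union> {p. disco_glue (snd p) (fst p)} \<union> ?V" .
  moreover have "closed {p. fst p \<in> disco_rect \<and> fst p = snd p}"
    unfolding mem_disco_rect
    by (intro closed_Collect_conj closed_Collect_le closed_Collect_eq continuous_intros)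
  moreover have "closed ?G" "closed {p. disco_glue (snd p) (fst p)}"
    unfolding disco_glue_iff eq_2_iff pt_nth
    by (intro closed_Collect_disj closed_Collect_conj closed_Collect_le closed_Collect_eq continuous_intros; simp)+
  moreover have "closed ?V"
  proof (rule finite_imp_closed, rule finite_subset)
    let ?P = "{pt 0 0, pt 1 0, pt 3 0, pt 5 0, pt 6 0, pt 0 1, pt 1 1, pt 3 1, pt 5 1, pt 6 1}"
    have "z \<in> ?P" if "vertex z" for z
      using that by (auto simp: vertex_def eq_2_iff)
    then show "?V \<subseteq> ?P \<times> ?P"
      by blast
  qed simp
  ultimately show ?thesis
    by (simp only: closed_Un)
qed

lemma compact_disco_rect: "compact disco_rect"
  by (simp add: disco_rect_def)

text \<open>The saturation of a compact set \<open>C\<close> is the first projection of the closed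
  relation cut down to \<open>disco_rect \<times> C\<close>, hence compact.\<close>

lemma closed_map_disco_proj: "closed_map (top_of_set disco_rect) disco disco_proj"
  unfolding closed_map_def
proof (intro allI impI)
  fix C assume C: "closedin (top_of_set disco_rect) C"
  then have "compact C" "C \<subseteq> disco_rect"
    using closedin_compact compact_disco_rect closedin_imp_subset by blast+
  let ?R = "{(z, w). z \<in> disco_rect \<and> w \<in> disco_rect \<and> disco_proj z = disco_proj w}"
  let ?K = "{z \<in> disco_rect. disco_proj z \<in> disco_proj ` C}"
  have "?K = fst ` (?R \<inter> (disco_rect \<times> C))"
  proof (intro equalityI subsetI)
    fix z assume "z \<in> ?K"
    then obtain w where "z \<in> disco_rect" "w \<in> C" "disco_proj z = disco_proj w"
      by blast
    then have "(z, w) \<in> ?R \<inter> (disco_rect \<times> C)"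
      using \<open>C \<subseteq> disco_rect\<close> by blast
    then show "z \<in> fst ` (?R \<inter> (disco_rect \<times> C))"
      by (rule image_eqI[rotated]) simp
  next
    fix z assume "z \<in> fst ` (?R \<inter> (disco_rect \<times> C))"
    then obtain w where "z \<in> disco_rect" "w \<in> C" "disco_proj z = disco_proj w"
      by force
    then show "z \<in> ?K"
      by (simp add: image_eqI)
  qed
  moreover have "compact (?R \<inter> (disco_rect \<times> C))"
    by (intro closed_Int_compact closed_disco_rel compact_Times compact_disco_rect \<open>compact C\<close>)
  ultimately have "compact ?K"
    using compact_continuous_image[OF continuous_on_fst[OF continuous_on_id]] by (simp only:)
  then have "closedin (top_of_set disco_rect) ?K"
    by (auto intro: closed_subset compact_imp_closed)
  moreover have "{z \<in> disco_rect. disco_proj z \<in> topspace disco - disco_proj ` C} = disco_rect - ?K"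
    by (auto simp: topspace_disco_eq)
  moreover have "openin (top_of_set disco_rect) (disco_rect - ?K)"
    using calculation by (intro openin_diff openin_subtopology_self) auto
  ultimately have "openin disco (topspace disco - disco_proj ` C)"
    unfolding openin_disco topspace_disco[symmetric] by auto
  then show "closedin disco (disco_proj ` C)"
    using \<open>C \<subseteq> disco_rect\<close> by (auto simp: closedin_def topspace_disco_eq)
qed

text \<open>Normality passes to images under continuous closed maps, and points are closed as images
  of points. Hausdorffness is needed later so that two continuous maps agree on a closed
  set.\<close>

lemma Hausdorff_space_disco: "Hausdorff_space disco"
proof (rule normal_t1_imp_Hausdorff_space)
  show "normal_space disco"
  proof (rule normal_space_continuous_closed_map_image[OF _ continuous_map_disco_proj closed_map_disco_proj])
    have "compact_space (top_of_set disco_rect)"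
      using compact_disco_rect by (simp add: compact_space_subtopology)
    moreover have "Hausdorff_space (top_of_set disco_rect)"
      by (simp add: Hausdorff_space_subtopology)
    ultimately show "normal_space (top_of_set disco_rect)"
      by (simp add: compact_Hausdorff_or_regular_imp_normal_space)
  qed (simp add: topspace_disco_eq)
  show "t1_space disco"
    unfolding t1_space_closedin_singleton topspace_disco_eq
  proof
    fix p assume "p \<in> disco_proj ` disco_rect"
    then obtain z where z: "z \<in> disco_rect" "p = disco_proj z" by auto
    then have "closedin (top_of_set disco_rect) {z}"
      by (intro closed_subset) auto
    then have "closedin disco (disco_proj ` {z})"
      using closed_map_disco_proj unfolding closed_map_def by blast
    then show "closedin disco {p}"
      using z by simp
  qed
qed

section \<open>Patches\<close>

lemma mem_box_pt: "z \<in> box (pt a b) (pt c d) \<longleftrightarrow> a < z $ 1 \<and> z $ 1 < c \<and> b < z $ 2 \<and> z $ 2 < d"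
  by (auto simp: mem_box_cart forall_2)

type_synonym patch = "(real ^ 2) set \<times> real \<times> (real ^ 2)"

text \<open>A patch \<open>(D, a, b)\<close> is an open rectangle \<open>D\<close> that meets the rectangle of the surface in one
  part, while \<open>w \<mapsto> a w + b\<close> carries the rest of \<open>D\<close> back into it: a neighbourhood of a glued side,
  developed across that side. In \<open>edges\<close>, \<open>(lo, hi, a, b)\<close> records that the top side over
  \<open>[lo, hi]\<close> is glued to the bottom by \<open>x \<mapsto> a x + b\<close>.\<close>

definition edges :: "(real \<times> real \<times> real \<times> real) set" where
  "edges = {(0, 1, 2, 1), (1, 3, 1/2, -1/2), (3, 5, 1/2, 7/2), (5, 6, 2, -7)}"

definition inner_patch :: patch where
  "inner_patch = (box (pt 0 0) (pt 6 1), 1, 0)"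

text \<open>With the bounds 3 and 9, the part kept in place has abscissae in \<open>(3, 6]\<close>
  and the part translated back lies to the left of 3, so the two do not overlap.\<close>

definition side_patch :: patch where
  "side_patch = (box (pt 3 0) (pt 9 1), 1, pt (-6) 0)"

text \<open>The gluing stretches by \<open>a\<close>, so the height \<open>1 / a\<close> above the
  side corresponds to the full height of the rectangle; the second coordinate \<open>y\<close> is
  sent to \<open>a (y - 1)\<close>.\<close>

definition edge_patch :: "real \<times> real \<times> real \<times> real \<Rightarrow> patch" where
  "edge_patch = (\<lambda>(lo, hi, a, b). (box (pt lo 0) (pt hi (1 + 1 / a)), a, pt b (- a)))"

definition patches :: "patch set" where
  "patches = insert inner_patch (insert side_patch (edge_patch ` edges))"

abbreviation pdom :: "patch \<Rightarrow> (real ^ 2) set" where "pdom \<equiv> fst"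
abbreviation pscale :: "patch \<Rightarrow> real" where "pscale c \<equiv> fst (snd c)"
definition pglue :: "patch \<Rightarrow> real ^ 2 \<Rightarrow> real ^ 2" where
  "pglue c w = pscale c *\<^sub>R w + snd (snd c)"

text \<open>The inverse of a chart, given by a formula. On the seam, where both readings lie in the
  rectangle, they give the same point of the surface.\<close>

definition psi :: "patch \<Rightarrow> real ^ 2 \<Rightarrow> (real ^ 2) set" where
  "psi c w = (if w \<in> disco_rect then disco_proj w else disco_proj (pglue c w))"

lemma patches_cases:
  assumes "c \<in> patches"
  obtains "c = inner_patch" | "c = side_patch" | lo hi a b where "(lo, hi, a, b) \<in> edges" "c = edge_patch (lo, hi, a, b)"
  using assms by (auto simp: patches_def)

lemma edges_cases:
  assumes "(lo, hi, a, b) \<in> edges"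
  obtains "lo = 0" "hi = 1" "a = 2" "b = 1" | "lo = 1" "hi = 3" "a = 1/2" "b = -1/2"
    | "lo = 3" "hi = 5" "a = 1/2" "b = 7/2" | "lo = 5" "hi = 6" "a = 2" "b = -7"
  using assms unfolding edges_def by blast

lemma edges_bounds:
  assumes "(lo, hi, a, b) \<in> edges"
  shows "0 < a" "0 \<le> lo" "lo < hi" "hi \<le> 6"
  by (rule edges_cases[OF assms]; simp)+

text \<open>The gluing exchanges \<open>(0, 1)\<close> with \<open>(1, 3)\<close> and
  \<open>(3, 5)\<close> with \<open>(5, 6)\<close>, so the bottom image of a side never lies under
  that side. Injectivity of \<open>psi\<close> on edge patches rests on this.\<close>

lemma edges_points:
  assumes "(lo, hi, a, b) \<in> edges" "lo < x" "x < hi"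
  shows "0 < a * x + b" "a * x + b < 6" "\<not> (lo < a * x + b \<and> a * x + b < hi)"
    and "x \<notin> {0, 1, 3, 5, 6}" "a * x + b \<notin> {0, 1, 3, 5, 6}"
proof -
  have "0 < a * x + b \<and> a * x + b < 6 \<and> \<not> (lo < a * x + b \<and> a * x + b < hi)"
    using assms(1) by (cases rule: edges_cases) (use assms(2,3) in \<open>hypsubst, simp\<close>)+
  moreover have "x \<notin> {0, 1, 3, 5, 6} \<and> a * x + b \<notin> {0, 1, 3, 5, 6}"
    using assms(1) by (cases rule: edges_cases) (use assms(2,3) in \<open>hypsubst, simp\<close>)+
  ultimately show "0 < a * x + b" "a * x + b < 6" "\<not> (lo < a * x + b \<and> a * x + b < hi)"
    "x \<notin> {0, 1, 3, 5, 6}" "a * x + b \<notin> {0, 1, 3, 5, 6}"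
    by blast+
qed

lemma rep_edge:
  assumes "(lo, hi, a, b) \<in> edges" "lo < x" "x < hi"
  shows "rep (pt x 1) = pt (a * x + b) 0"
  using assms(1) by (cases rule: edges_cases) (use assms(2,3) in \<open>hypsubst, simp add: rep_def eq_2_iff\<close>)+

lemma rep_edge_iff:
  assumes e: "(lo, hi, a, b) \<in> edges" and x: "lo < x" "x < hi" and z: "z \<in> disco_rect"
  shows "rep z = pt (a * x + b) 0 \<longleftrightarrow> z = pt x 1 \<or> z = pt (a * x + b) 0"
proof
  note b = edges_points[OF e x]
  assume "rep z = pt (a * x + b) 0"
  moreover have "(if a * x + b < 1 then 2 * (a * x + b) + 1 else if a * x + b < 3 then (a * x + b - 1) / 2
       else if a * x + b < 5 then (a * x + b + 7) / 2 else 2 * (a * x + b) - 7) = x"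
    using e by (cases rule: edges_cases) (use x in \<open>hypsubst, simp\<close>)+
  ultimately show "z = pt x 1 \<or> z = pt (a * x + b) 0"
    using rep_bottom_iff[OF z, of "a * x + b"] b by (auto simp: eq_2_iff)
next
  have "rep (pt (a * x + b) 0) = pt (a * x + b) 0"
    using edges_points[OF e x] by (simp add: rep_def)
  then show "z = pt x 1 \<or> z = pt (a * x + b) 0 \<Longrightarrow> rep z = pt (a * x + b) 0"
    using rep_edge[OF e x] by auto
qed

lemma edge_patch_simps:
  "pdom (edge_patch (lo, hi, a, b)) = box (pt lo 0) (pt hi (1 + 1 / a))"
  "pscale (edge_patch (lo, hi, a, b)) = a"
  "pglue (edge_patch (lo, hi, a, b)) w = pt (a * w $ 1 + b) (a * (w $ 2 - 1))"
  by (simp_all add: edge_patch_def pglue_def eq_2_iff algebra_simps)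

lemma inner_patch_simps:
  "pdom inner_patch = box (pt 0 0) (pt 6 1)" "pscale inner_patch = 1" "pglue inner_patch w = w"
  by (simp_all add: inner_patch_def pglue_def)

lemma side_patch_simps:
  "pdom side_patch = box (pt 3 0) (pt 9 1)" "pscale side_patch = 1" "pglue side_patch w = pt (w $ 1 - 6) (w $ 2)"
  by (simp_all add: side_patch_def pglue_def eq_2_iff)

lemma pscale_pos: "c \<in> patches \<Longrightarrow> 0 < pscale c"
  by (erule patches_cases) (simp_all add: inner_patch_simps side_patch_simps edge_patch_simps edges_bounds)

lemma open_pdom: "c \<in> patches \<Longrightarrow> open (pdom c)"
  by (erule patches_cases) (simp_all add: open_box inner_patch_simps side_patch_simps edge_patch_simps)

lemma convex_pdom: "c \<in> patches \<Longrightarrow> convex (pdom c)"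
  by (erule patches_cases) (simp_all add: convex_box inner_patch_simps side_patch_simps edge_patch_simps)

lemma edge_upper:
  assumes "0 < (a::real)" "1 < y" "y < 1 + 1 / a"
  shows "0 < a * (y - 1)" "a * (y - 1) < 1"
  using assms by (simp_all add: field_simps)

lemma edge_rect_iff:
  assumes e: "(lo, hi, a, b) \<in> edges" and w: "w \<in> pdom (edge_patch (lo, hi, a, b))"
  shows "w \<in> disco_rect \<longleftrightarrow> w $ 2 \<le> 1"
    and "pglue (edge_patch (lo, hi, a, b)) w \<in> disco_rect \<longleftrightarrow> 1 \<le> w $ 2"
proof -
  note eb = edges_bounds[OF e]
  from w have w: "lo < w $ 1" "w $ 1 < hi" "0 < w $ 2" "w $ 2 < 1 + 1 / a"
    by (auto simp: edge_patch_simps mem_box_pt)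
  then show "w \<in> disco_rect \<longleftrightarrow> w $ 2 \<le> 1"
    using eb by (auto simp: mem_disco_rect)
  have "a * (w $ 2 - 1) \<le> 1"
    using w eb by (simp add: field_simps)
  then show "pglue (edge_patch (lo, hi, a, b)) w \<in> disco_rect \<longleftrightarrow> 1 \<le> w $ 2"
    using w eb(1) edges_points[OF e w(1,2)] by (auto simp: mem_disco_rect edge_patch_simps zero_le_mult_iff)
qed

lemma side_rect_iff:
  assumes w: "w \<in> pdom side_patch"
  shows "w \<in> disco_rect \<longleftrightarrow> w $ 1 \<le> 6" and "pglue side_patch w \<in> disco_rect \<longleftrightarrow> 6 \<le> w $ 1"
  using w by (auto simp: mem_disco_rect side_patch_simps mem_box_pt)

lemma pglue_in_rect:
  assumes "c \<in> patches" "w \<in> pdom c" "w \<notin> disco_rect"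
  shows "pglue c w \<in> disco_rect"
  using assms(1)
proof (cases rule: patches_cases)
  case 1
  then show ?thesis using assms by (auto simp: inner_patch_simps mem_box_pt mem_disco_rect)
next
  case 2
  then show ?thesis using assms side_rect_iff by fastforce
next
  case (3 lo hi a b)
  then show ?thesis using assms edge_rect_iff by fastforce
qed

lemma rep_eqI_interior:
  assumes "0 < w $ 2" "w $ 2 < 1" "w $ 1 \<noteq> 6"
  shows "rep w = w"
  using assms by (simp add: rep_def)

lemma rep_seam:
  assumes "c \<in> patches" "w \<in> pdom c" "w \<in> disco_rect" "pglue c w \<in> disco_rect"
  shows "rep (pglue c w) = rep w"
  using assms(1)
proof (cases rule: patches_cases)
  case 1
  then show ?thesis by (simp add: inner_patch_simps)
next
  case 2
  then have w: "w = pt 6 (w $ 2)" "0 < w $ 2" "w $ 2 < 1" "pglue c w = pt 0 (w $ 2)"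
    using assms side_rect_iff[of w] by (auto simp: side_patch_simps mem_box_pt eq_2_iff)
  show ?thesis
    using w(2,3) unfolding w(4) arg_cong[OF w(1), of rep] by (simp add: rep_def)
next
  case (3 lo hi a b)
  then have "w $ 2 = 1" "lo < w $ 1" "w $ 1 < hi"
    using assms edge_rect_iff[of lo hi a b w] by (auto simp: edge_patch_simps mem_box_pt)
  then have w: "w = pt (w $ 1) 1" "pglue c w = pt (a * w $ 1 + b) 0" "lo < w $ 1" "w $ 1 < hi"
    using 3 by (auto simp: edge_patch_simps eq_2_iff)
  have "rep (pglue c w) = pt (a * w $ 1 + b) 0"
    using rep_edge_iff[OF 3(1) w(3,4) assms(4)] w(2) by blast
  also have "\<dots> = rep w"
    using rep_edge[OF 3(1) w(3,4)] arg_cong[OF w(1), of rep] by simp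
  finally show ?thesis .
qed

lemma proj_pglue:
  assumes "c \<in> patches" "w \<in> pdom c" "w \<in> disco_rect" "pglue c w \<in> disco_rect"
  shows "disco_proj (pglue c w) = disco_proj w"
  using rep_seam[OF assms] disco_proj_eq_iff assms by blast

text \<open>Here \<open>r\<close> is a reading of \<open>w\<close> that lies in the rectangle. A
  nonsingular fibre has at most two points, and on a patch these are related by the very gluing from
  which the patch is built.\<close>

lemma patch_point:
  assumes "c \<in> patches" "w \<in> pdom c" "z \<in> disco_rect"
    and "r = w \<or> r = pglue c w" "r \<in> disco_rect" "rep z = rep r"
  shows "z = w \<or> z = pglue c w" and "\<not> vertex r"
proof -
  have "(z = w \<or> z = pglue c w) \<and> \<not> vertex r"
    using assms(1)
  proof (cases rule: patches_cases)
    case 1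
    then have "r = w" "0 < w $ 2" "w $ 2 < 1" "0 < w $ 1" "w $ 1 < 6"
      using assms by (auto simp: inner_patch_simps mem_box_pt)
    moreover from this have "rep z = pt (w $ 1) (w $ 2)"
      using assms by (simp add: rep_eqI_interior)
    ultimately show ?thesis
      using rep_interior_iff[OF assms(3), of "w $ 2" "w $ 1"] by (auto simp: vertex_def)
  next
    case 2
    then have w: "0 < w $ 2" "w $ 2 < 1" "3 < w $ 1" "w $ 1 < 9" "pglue c w = pt (w $ 1 - 6) (w $ 2)"
      using assms by (auto simp: side_patch_simps mem_box_pt)
    consider "r = w" "w $ 1 < 6" | "r = w" "w $ 1 = 6" | "r = pt (w $ 1 - 6) (w $ 2)" "w $ 1 \<ge> 6"
      using assms(4,5) w(5) by (cases "w $ 1 < 6"; cases "w $ 1 = 6") (auto simp: mem_disco_rect)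
    then show ?thesis
    proof cases
      case 1
      then have "rep z = pt (w $ 1) (w $ 2)"
        using assms(6) w by (simp add: rep_eqI_interior)
      then show ?thesis
        using rep_interior_iff[OF assms(3) w(1,2), of "w $ 1"] w 1 by (auto simp: vertex_def)
    next
      case 2
      then have "rep z = pt 0 (w $ 2)"
        using assms(6) w by (simp add: rep_def)
      then show ?thesis
        using rep_interior_iff[OF assms(3) w(1,2), of 0] w 2 by (auto simp: vertex_def eq_2_iff)
    next
      case r: 3
      then have "rep z = pt (w $ 1 - 6) (w $ 2)"
        using assms(6) w by (simp add: rep_eqI_interior)
      then show ?thesis
        using rep_interior_iff[OF assms(3) w(1,2), of "w $ 1 - 6"] w r by (auto simp: vertex_def eq_2_iff)
    qed
  next
    case (3 lo hi a b)
    have w: "lo < w $ 1" "w $ 1 < hi" "0 < w $ 2" "w $ 2 < 1 + 1 / a"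
      using assms(2) by (auto simp: 3 edge_patch_simps mem_box_pt)
    note eb = edges_bounds[OF 3(1)] and eb' = edges_points[OF 3(1) w(1,2)]
    have g: "pglue c w = pt (a * w $ 1 + b) (a * (w $ 2 - 1))"
      by (simp add: 3 edge_patch_simps)
    note iffs = edge_rect_iff[OF 3(1), of w, folded 3(2), OF assms(2)]
    consider "w $ 2 < 1" | "w $ 2 = 1" | "1 < w $ 2"
      by linarith
    then show ?thesis
    proof cases
      case 1
      then have "r = w"
        using iffs assms(4,5) by auto
      moreover have "rep w = pt (w $ 1) (w $ 2)"
        using 1 w eb by (subst rep_eqI_interior) auto
      ultimately show ?thesis
        using rep_interior_iff[OF assms(3) w(3) 1, of "w $ 1"] assms(6) w eb 1 by (auto simp: vertex_def)
    next
      case 2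
      then have r: "r = pt (w $ 1) 1 \<or> r = pt (a * w $ 1 + b) 0"
        using assms(4) g by (auto simp: eq_2_iff)
      then have "rep z = pt (a * w $ 1 + b) 0"
        using rep_edge_iff[OF 3(1) w(1,2) assms(5)] assms(6) by simp
      then have "z = pt (w $ 1) 1 \<or> z = pt (a * w $ 1 + b) 0"
        using rep_edge_iff[OF 3(1) w(1,2) assms(3)] by blast
      moreover have "pt (w $ 1) 1 = w" "pt (a * w $ 1 + b) 0 = pglue c w"
        using 2 g by (simp_all add: eq_2_iff)
      moreover have "\<not> vertex (pt (w $ 1) 1)" "\<not> vertex (pt (a * w $ 1 + b) 0)"
        using eb'(4,5) by (simp_all add: vertex_def)
      ultimately show ?thesis
        using r by metis
    next
      case h: 3
      then have "r = pglue c w"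
        using iffs assms(4,5) by auto
      moreover have ab: "0 < a * (w $ 2 - 1)" "a * (w $ 2 - 1) < 1"
        using edge_upper[OF eb(1) h w(4)] by auto
      then have "rep (pglue c w) = pt (a * w $ 1 + b) (a * (w $ 2 - 1))"
        using eb' by (subst rep_eqI_interior) (auto simp: g)
      ultimately show ?thesis
        using rep_interior_iff[OF assms(3) ab, of "a * w $ 1 + b"] assms(6) eb'(1) ab
        unfolding g by (auto simp: vertex_def)
    qed
  qed
  then show "z = w \<or> z = pglue c w" "\<not> vertex r" by auto
qed

lemma pglue_in_pdom:
  assumes "c \<in> patches" "w \<in> pdom c" "pglue c w \<in> pdom c"
  shows "pglue c w = w"
  using assms(1)
proof (cases rule: patches_cases)
  case (3 lo hi a b)
  then show ?thesis
    using assms edges_points(3)[of lo hi a b "w $ 1"] by (auto simp: edge_patch_simps mem_box_pt)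
qed (use assms in \<open>auto simp: inner_patch_simps side_patch_simps mem_box_pt\<close>)

text \<open>The seam of a patch contains a segment, which forces the scaling factors of an affine chart on
  its two sides to match.\<close>

lemma seam_direction:
  assumes "c \<in> patches" "w \<in> pdom c" "w \<in> disco_rect" "pglue c w \<in> disco_rect"
  obtains u where "u \<noteq> 0" "\<And>t. 0 \<le> t \<Longrightarrow> t \<le> (1::real) \<Longrightarrow>
    w + t *\<^sub>R u \<in> pdom c \<and> w + t *\<^sub>R u \<in> disco_rect \<and> pglue c (w + t *\<^sub>R u) \<in> disco_rect"
proof -
  have shrink: "0 \<le> t * s \<and> x + t * s < h" if "0 \<le> t" "t \<le> 1" "0 < s" "x + s < h" for t s x h :: real
    using that mult_right_mono[of t 1 s] mult_nonneg_nonneg[of t s] unfolding mult_1 by linarith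
  have "\<exists>u. u \<noteq> 0 \<and> (\<forall>t. 0 \<le> t \<and> t \<le> (1::real) \<longrightarrow>
    w + t *\<^sub>R u \<in> pdom c \<and> w + t *\<^sub>R u \<in> disco_rect \<and> pglue c (w + t *\<^sub>R u) \<in> disco_rect)"
    using assms(1)
  proof (cases rule: patches_cases)
    case 1
    then have w: "0 < w $ 1" "w $ 1 < 6" "0 < w $ 2" "w $ 2 < 1"
      using assms by (auto simp: inner_patch_simps mem_box_pt)
    obtain s where s: "0 < s" "w $ 2 + s < 1"
      using dense[of 0 "1 - w $ 2"] w by (auto simp: algebra_simps)
    have "w + t *\<^sub>R pt 0 s \<in> pdom c" if "0 \<le> t" "t \<le> 1" for t
      using shrink[OF that s] s w by (auto simp: 1 inner_patch_simps mem_box_pt)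
    moreover have "v \<in> disco_rect \<and> pglue c v \<in> disco_rect" if "v \<in> pdom c" for v
      using that by (simp add: 1 inner_patch_simps mem_box_pt mem_disco_rect)
    moreover have "pt 0 s \<noteq> 0"
      using s by (simp add: eq_2_iff)
    ultimately show ?thesis
      by blast
  next
    case 2
    then have w: "w $ 1 = 6" "0 < w $ 2" "w $ 2 < 1"
      using assms side_rect_iff[of w] by (auto simp: side_patch_simps mem_box_pt)
    obtain s where s: "0 < s" "w $ 2 + s < 1"
      using dense[of 0 "1 - w $ 2"] w by (auto simp: algebra_simps)
    have "w + t *\<^sub>R pt 0 s \<in> pdom c" if "0 \<le> t" "t \<le> 1" for t
      using shrink[OF that s] s w by (auto simp: 2 side_patch_simps mem_box_pt)
    moreover have "v \<in> disco_rect \<and> pglue c v \<in> disco_rect" if "v \<in> pdom c" "v $ 1 = 6" for v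
      using that side_rect_iff[of v] by (simp add: 2)
    moreover have "pt 0 s \<noteq> 0"
      using s by (simp add: eq_2_iff)
    moreover have "(w + t *\<^sub>R pt 0 s) $ 1 = 6" for t
      using w by simp
    ultimately show ?thesis
      by blast
  next
    case (3 lo hi a b)
    then have w: "w $ 2 = 1" "lo < w $ 1" "w $ 1 < hi"
      using assms edge_rect_iff[of lo hi a b w] by (auto simp: edge_patch_simps mem_box_pt)
    obtain s where s: "0 < s" "w $ 1 + s < hi"
      using dense[of 0 "hi - w $ 1"] w by (auto simp: algebra_simps)
    have "w + t *\<^sub>R pt s 0 \<in> pdom c" if "0 \<le> t" "t \<le> 1" for t
      using shrink[OF that s] s w edges_bounds[OF 3(1)] by (auto simp: 3 edge_patch_simps mem_box_pt)
    moreover have "v \<in> disco_rect \<and> pglue c v \<in> disco_rect" if "v \<in> pdom c" "v $ 2 = 1" for v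
      using that edge_rect_iff[OF 3(1), of v] by (simp add: 3)
    moreover have "pt s 0 \<noteq> 0"
      using s by (simp add: eq_2_iff)
    moreover have "(w + t *\<^sub>R pt s 0) $ 2 = 1" for t
      using w by simp
    ultimately show ?thesis
      by blast
  qed
  then show thesis
    using that by blast
qed

lemma psi_eq_iff:
  assumes "c \<in> patches" "w \<in> pdom c" "z \<in> disco_rect"
  shows "disco_proj z = psi c w \<longleftrightarrow> z = w \<or> z = pglue c w"
proof
  define r where "r = (if w \<in> disco_rect then w else pglue c w)"
  have r: "r \<in> disco_rect" "psi c w = disco_proj r"
    using pglue_in_rect[OF assms(1,2)] by (auto simp: r_def psi_def)
  assume "disco_proj z = psi c w"
  then have "rep z = rep r"
    using r assms(3) disco_proj_eq_iff by metis
  then show "z = w \<or> z = pglue c w"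
    using patch_point(1)[OF assms _ r(1)] by (auto simp: r_def)
next
  assume "z = w \<or> z = pglue c w"
  then show "disco_proj z = psi c w"
    using proj_pglue[OF assms(1,2)] assms(3) by (auto simp: psi_def)
qed

lemma psi_in_topspace:
  assumes "c \<in> patches" "w \<in> pdom c"
  shows "psi c w \<in> topspace disco"
  using pglue_in_rect[OF assms] by (auto simp: psi_def topspace_disco_eq)

lemma psi_notin_sing:
  assumes "c \<in> patches" "w \<in> pdom c"
  shows "psi c w \<notin> disco_sing"
proof -
  define r where "r = (if w \<in> disco_rect then w else pglue c w)"
  have r: "r \<in> disco_rect" "psi c w = disco_proj r" "r = w \<or> r = pglue c w"
    using pglue_in_rect[OF assms] by (auto simp: r_def psi_def)
  then show ?thesis
    using patch_point(2)[OF assms r(1,3,1)] disco_proj_in_sing_iff by auto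
qed

text \<open>Points with the same image differ at most by \<open>pglue\<close>, and
  \<open>pglue\<close> takes no point of the domain to another point of it.\<close>

lemma inj_on_psi:
  assumes c: "c \<in> patches"
  shows "inj_on (psi c) (pdom c)"
proof (rule inj_onI)
  have inj: "w = w'" if "pglue c w = pglue c w'" for w w'
    using that pscale_pos[OF c] by (simp add: pglue_def)
  fix w w' assume w: "w \<in> pdom c" "w' \<in> pdom c" and eq: "psi c w = psi c w'"
  show "w = w'"
  proof (cases "w \<in> disco_rect")
    case True
    then have "w = w' \<or> w = pglue c w'"
      using psi_eq_iff[OF c w(2) True] eq by (simp add: psi_def)
    then show ?thesis
      using pglue_in_pdom[OF c w(2)] w by auto
  next
    case False
    then have "pglue c w = w' \<or> pglue c w = pglue c w'"
      using psi_eq_iff[OF c w(2) pglue_in_rect[OF c w(1) False]] eq by (simp add: psi_def)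
    then show ?thesis
      using pglue_in_pdom[OF c w(1)] w inj by auto
  qed
qed

text \<open>The preimage in the rectangle is the trace of \<open>N\<close> together with its copy
  under the similarity \<open>pglue\<close>, and both are open.\<close>

lemma open_psi_image:
  assumes c: "c \<in> patches" and "N \<subseteq> pdom c" "open N"
  shows "openin disco (psi c ` N)"
proof -
  have "{z \<in> disco_rect. disco_proj z \<in> psi c ` N} = disco_rect \<inter> (N \<union> pglue c ` N)"
    using psi_eq_iff[OF c] assms(2) by (auto simp: image_iff)
  moreover have "open (pglue c ` N)"
  proof -
    have "pglue c ` N = (\<lambda>v. (1 / pscale c) *\<^sub>R (v - snd (snd c))) -` N"
    proof (intro equalityI subsetI)
      fix v assume "v \<in> (\<lambda>v. (1 / pscale c) *\<^sub>R (v - snd (snd c))) -` N"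
      then show "v \<in> pglue c ` N"
        using pscale_pos[OF c] by (intro image_eqI[of _ _ "(1 / pscale c) *\<^sub>R (v - snd (snd c))"]) (auto simp: pglue_def)
    qed (use pscale_pos[OF c] in \<open>auto simp: pglue_def\<close>)
    then show ?thesis
      using assms(3) by (auto intro!: open_vimage continuous_intros)
  qed
  ultimately show ?thesis
    using assms psi_in_topspace[OF c]
    unfolding openin_disco topspace_disco[symmetric] by (auto intro!: openin_open_Int open_Un)
qed

text \<open>The complement of the preimage is handled instead: the bad set \<open>?K\<close> is
  closed in the plane, and so is its pullback by \<open>pglue\<close>. Removing both treats the two
  sides of the seam at once.\<close>

lemma continuous_map_psi:
  assumes c: "c \<in> patches"
  shows "continuous_map (top_of_set (pdom c)) disco (psi c)"
  unfolding continuous_map_def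
proof (intro conjI allI impI)
  show "psi c \<in> topspace (top_of_set (pdom c)) \<rightarrow> topspace disco"
    using psi_in_topspace[OF c] by auto
  fix U assume U: "openin disco U"
  let ?K = "{z \<in> disco_rect. disco_proj z \<notin> U}"
  have "openin (top_of_set disco_rect) {z \<in> disco_rect. disco_proj z \<in> U}"
    using U by (simp add: openin_disco)
  then have "closedin (top_of_set disco_rect) (disco_rect - {z \<in> disco_rect. disco_proj z \<in> U})"
    by (intro closedin_diff) auto
  moreover have "disco_rect - {z \<in> disco_rect. disco_proj z \<in> U} = ?K"
    by auto
  ultimately have "closedin (top_of_set disco_rect) ?K"
    by (simp only:)
  then have "closed ?K"
    by (rule compact_imp_closed[OF closedin_compact[OF compact_disco_rect]])
  moreover from this have "closed (pglue c -` ?K)"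
    unfolding pglue_def by (intro closed_vimage continuous_intros)
  ultimately have "open (pdom c - ?K - pglue c -` ?K)"
    by (intro open_Diff open_pdom c)
  moreover have "{w \<in> pdom c. psi c w \<in> U} = pdom c - ?K - pglue c -` ?K"
    using pglue_in_rect[OF c] proj_pglue[OF c] by (auto simp: psi_def split: if_splits)
  ultimately show "openin (top_of_set (pdom c)) {x \<in> topspace (top_of_set (pdom c)). psi c x \<in> U}"
    by (auto intro: open_subset)
qed

section \<open>Patches as charts of the dilatation atlas\<close>

definition pchart :: "patch \<Rightarrow> (real ^ 2) set set \<times> ((real ^ 2) set \<Rightarrow> real ^ 2)" where
  "pchart c = (psi c ` pdom c, inv_into (pdom c) (psi c))"

lemma pchart_psi: "c \<in> patches \<Longrightarrow> w \<in> pdom c \<Longrightarrow> snd (pchart c) (psi c w) = w"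
  by (simp add: pchart_def inj_on_psi)

text \<open>Read on the rectangle, the chart is the identity on one part of the patch and the
  inverse of \<open>pglue\<close> on the other, a similarity of positive ratio in both
  cases.\<close>

lemma pchart_in_atlas:
  assumes c: "c \<in> patches"
  shows "pchart c \<in> disco_atlas"
proof -
  let ?U = "psi c ` pdom c" and ?f = "inv_into (pdom c) (psi c)"
  have f: "?f (psi c w) = w" if "w \<in> pdom c" for w
    using that inj_on_psi[OF c] by simp
  have fU: "?f ` ?U = pdom c"
    using f by (force simp: image_image)
  have "homeomorphic_maps (subtopology disco ?U) (top_of_set (pdom c)) ?f (psi c)"
    unfolding homeomorphic_maps_def
  proof (intro conjI)
    show "continuous_map (subtopology disco ?U) (top_of_set (pdom c)) ?f"
      unfolding continuous_map_def
    proof (intro conjI allI impI)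
      fix V assume "openin (top_of_set (pdom c)) V"
      then have V: "open V" "V \<subseteq> pdom c"
        using open_pdom[OF c] openin_open_eq by auto
      have eq: "{x \<in> topspace (subtopology disco ?U). ?f x \<in> V} = psi c ` V"
        using V f psi_in_topspace[OF c] by (auto simp: image_iff)
      have eq': "psi c ` V = psi c ` V \<inter> ?U"
        using V(2) by blast
      show "openin (subtopology disco ?U) {x \<in> topspace (subtopology disco ?U). ?f x \<in> V}"
        unfolding eq by (subst eq', rule openin_subtopology_Int[OF open_psi_image[OF c V(2,1)]])
    qed (use f in auto)
    show "continuous_map (top_of_set (pdom c)) (subtopology disco ?U) (psi c)"
      using continuous_map_psi[OF c] by (auto intro: continuous_map_into_subtopology)
  qed (use f in auto)
  then have "homeomorphic_map (subtopology disco ?U) (top_of_set (?f ` ?U)) ?f"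
    unfolding fU by (rule homeomorphic_maps_map[THEN iffD1, THEN conjunct1])
  moreover have "\<exists>N a b. open N \<and> z \<in> N \<and> a > 0 \<and>
           (\<forall>w \<in> N \<inter> disco_rect. disco_proj w \<in> ?U \<and> ?f (disco_proj w) = a *\<^sub>R w + b)"
    if z: "z \<in> disco_rect" "disco_proj z \<in> ?U" for z
  proof -
    obtain d where d: "d \<in> pdom c" "disco_proj z = psi c d"
      using z by auto
    then consider "z = d" | "z = pglue c d"
      using psi_eq_iff[OF c d(1) z(1)] by blast
    then show ?thesis
    proof cases
      case 1
      have "disco_proj w \<in> ?U \<and> ?f (disco_proj w) = 1 *\<^sub>R w + 0" if "w \<in> pdom c \<inter> disco_rect" for w
        using that f[of w] by (auto simp: psi_def)
      then show ?thesis
        using open_pdom[OF c] d 1 by (intro exI[of _ "pdom c"] exI[of _ 1] exI[of _ 0]) auto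
    next
      case 2
      let ?g = "\<lambda>v. (1 / pscale c) *\<^sub>R v + (- (1 / pscale c) *\<^sub>R snd (snd c))"
      have g: "pglue c (?g v) = v" "?g (pglue c v) = v" for v
        using pscale_pos[OF c] by (auto simp: pglue_def algebra_simps)
      have "open (?g -` pdom c)"
        by (intro open_vimage open_pdom[OF c] continuous_intros)
      moreover have "z \<in> ?g -` pdom c"
        using 2 d g by simp
      moreover have "disco_proj w \<in> ?U \<and> ?f (disco_proj w) = ?g w" if w: "w \<in> ?g -` pdom c \<inter> disco_rect" for w
      proof -
        have "disco_proj w = psi c (?g w)"
          using psi_eq_iff[OF c, of "?g w" w] w g by auto
        then show ?thesis
          using f w by auto
      qed
      ultimately show ?thesis
        using pscale_pos[OF c]
        by (intro exI[of _ "?g -` pdom c"] exI[of _ "1 / pscale c"] exI[of _ "- (1 / pscale c) *\<^sub>R snd (snd c)"]) auto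
    qed
  qed
  moreover have "?U \<inter> disco_sing = {}"
    using psi_notin_sing[OF c] by auto
  ultimately show ?thesis
    unfolding disco_atlas_def pchart_def using open_psi_image[OF c order_refl] open_pdom[OF c] fU by auto
qed

lemma patches_cover:
  assumes "p \<in> topspace disco" "p \<notin> disco_sing"
  obtains c d where "c \<in> patches" "d \<in> pdom c" "p = psi c d"
proof -
  obtain z where z: "z \<in> disco_rect" "p = disco_proj z"
    using assms by (auto simp: topspace_disco_eq)
  then have nv: "\<not> vertex z"
    using assms disco_proj_in_sing_iff by auto
  have "\<exists>c\<in>patches. \<exists>d\<in>pdom c. z = d \<or> z = pglue c d"
  proof -
    have e: "\<exists>c\<in>patches. \<exists>d\<in>pdom c. z = d \<or> z = pglue c d"
      if "(lo, hi, a, b) \<in> edges" "lo < x" "x < hi" "z = pt x 1 \<or> z = pt (a * x + b) 0" for lo hi a b x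
      using that edges_bounds(1)[OF that(1)]
      by (intro bexI[of _ "edge_patch (lo, hi, a, b)"] bexI[of _ "pt x 1"])
        (auto simp: edge_patch_simps mem_box_pt patches_def)
    have m: "(0, 1, 2, 1) \<in> edges" "(1, 3, 1/2, -1/2) \<in> edges" "(3, 5, 1/2, 7/2) \<in> edges" "(5, 6, 2, -7) \<in> edges"
      by (auto simp: edges_def)
    have zb: "0 \<le> z $ 1" "z $ 1 \<le> 6" "0 \<le> z $ 2" "z $ 2 \<le> 1"
      using z by (auto simp: mem_disco_rect)
    consider "0 < z $ 2" "z $ 2 < 1" "0 < z $ 1" "z $ 1 < 6" | "0 < z $ 2" "z $ 2 < 1" "z $ 1 = 0 \<or> z $ 1 = 6"
      | "z $ 2 = 1" | "z $ 2 = 0"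
      using zb by linarith
    then show ?thesis
    proof cases
      case 1
      then show ?thesis
        by (intro bexI[of _ inner_patch] bexI[of _ z]) (auto simp: inner_patch_simps mem_box_pt patches_def)
    next
      case 2
      then show ?thesis
        by (intro bexI[of _ side_patch] bexI[of _ "pt 6 (z $ 2)"])
          (auto simp: side_patch_simps mem_box_pt patches_def eq_2_iff)
    next
      case 3
      then have "z = pt (z $ 1) 1" by (simp add: eq_2_iff)
      then show ?thesis
        using e[OF m(1), of "z $ 1"] e[OF m(2), of "z $ 1"] e[OF m(3), of "z $ 1"] e[OF m(4), of "z $ 1"] nv 3 z(1)
        by (cases rule: rect_abscissa_cases[OF z(1)]) (simp_all add: vertex_def)
    next
      case 4
      then have z0: "z = pt (z $ 1) 0" by (simp add: eq_2_iff)
      \<comment> \<open>A bottom point is seen from the top side glued to it; the witnesses below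
        are its preimages under the four gluings.\<close>
      have e0: ?thesis if "(lo, hi, a, b) \<in> edges" "lo < x" "x < hi" "a * x + b = z $ 1" for lo hi a b x
        using e[OF that(1-3)] z0 that(4) by simp
      show ?thesis
      proof (cases rule: rect_abscissa_cases[OF z(1)])
        case 2
        then show ?thesis by (intro e0[OF m(2), of "2 * z $ 1 + 1"]) (auto simp: field_simps)
      next
        case 4
        then show ?thesis by (intro e0[OF m(1), of "(z $ 1 - 1) / 2"]) (auto simp: field_simps)
      next
        case 6
        then show ?thesis by (intro e0[OF m(4), of "(z $ 1 + 7) / 2"]) (auto simp: field_simps)
      next
        case 8
        then show ?thesis by (intro e0[OF m(3), of "2 * z $ 1 - 7"]) (auto simp: field_simps)
      qed (use nv 4 in \<open>simp_all add: vertex_def\<close>)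
    qed
  qed
  then obtain c d where "c \<in> patches" "d \<in> pdom c" "z = d \<or> z = pglue c d"
    by blast
  then show thesis
    using that psi_eq_iff[of c d z] z by blast
qed

text \<open>The atlas constrains a chart on the two sides of a seam separately. In a patch the two
  expressions become one: both are values of the chart at seam points, hence agree along a segment,
  so ratios and constants coincide.\<close>

lemma atlas_psi:
  assumes U: "(U, \<phi>) \<in> disco_atlas" and c: "c \<in> patches" and d: "d \<in> pdom c" "psi c d \<in> U"
  obtains N \<mu> b where "open N" "d \<in> N" "N \<subseteq> pdom c" "\<mu> > 0"
    "\<And>w. w \<in> N \<Longrightarrow> psi c w \<in> U \<and> \<phi> (psi c w) = \<mu> *\<^sub>R w + b"
proof -
  have loc: "\<exists>N a b. open N \<and> z \<in> N \<and> a > 0 \<and>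
           (\<forall>w \<in> N \<inter> disco_rect. disco_proj w \<in> U \<and> \<phi> (disco_proj w) = a *\<^sub>R w + b)"
    if "z \<in> disco_rect" "disco_proj z \<in> U" for z
    using U that unfolding disco_atlas_def by blast
  have cont: "continuous_on S (pglue c)" for S
    unfolding pglue_def by (intro continuous_intros)
  have closed: "closed disco_rect"
    using compact_disco_rect by (rule compact_imp_closed)
  define a where "a = pscale c"
  define b where "b = snd (snd c)"
  have gl: "pglue c w = a *\<^sub>R w + b" for w
    by (simp add: pglue_def a_def b_def)
  have "a > 0"
    using pscale_pos[OF c] by (simp add: a_def)
  have first: "\<exists>N \<mu> b'. open N \<and> d \<in> N \<and> \<mu> > 0 \<and>
           (\<forall>w \<in> N \<inter> disco_rect. disco_proj w \<in> U \<and> \<phi> (disco_proj w) = \<mu> *\<^sub>R w + b')"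
    if "d \<in> disco_rect"
    using loc[OF that] d that by (simp add: psi_def)
  have second: "\<exists>N \<mu> b'. open N \<and> d \<in> N \<and> \<mu> > 0 \<and>
           (\<forall>w \<in> N. pglue c w \<in> disco_rect \<longrightarrow> disco_proj (pglue c w) \<in> U \<and> \<phi> (disco_proj (pglue c w)) = \<mu> *\<^sub>R w + b')"
    if "pglue c d \<in> disco_rect"
  proof -
    have "disco_proj (pglue c d) \<in> U"
      using psi_eq_iff[OF c d(1) that] d(2) by simp
    from loc[OF that this] obtain N m b' where N: "open N" "pglue c d \<in> N" "m > 0"
      "\<And>w. w \<in> N \<inter> disco_rect \<Longrightarrow> disco_proj w \<in> U \<and> \<phi> (disco_proj w) = m *\<^sub>R w + b'"
      by blast
    have "open (pglue c -` N)"
      using N(1) cont by (rule open_vimage)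
    moreover have "disco_proj (pglue c w) \<in> U \<and> \<phi> (disco_proj (pglue c w)) = (m * a) *\<^sub>R w + (m *\<^sub>R b + b')"
      if "w \<in> pglue c -` N" "pglue c w \<in> disco_rect" for w
      using N(4)[of "pglue c w"] that by (simp add: gl algebra_simps)
    ultimately show ?thesis
      using N(2,3) \<open>a > 0\<close>
      by (intro exI[of _ "pglue c -` N"] exI[of _ "m * a"] exI[of _ "m *\<^sub>R b + b'"]) auto
  qed
  have open_r: "open (- disco_rect)" "open (pglue c -` (- disco_rect))"
    using closed cont by (auto intro!: open_vimage)
  have psi2: "psi c w = disco_proj (pglue c w)" if "w \<in> pdom c" "pglue c w \<in> disco_rect" for w
    using psi_eq_iff[OF c that(1,2)] by simp
  have psi1: "psi c w = disco_proj w" if "w \<in> disco_rect" for w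
    using that by (simp add: psi_def)
  consider "d \<in> disco_rect" "pglue c d \<notin> disco_rect" | "d \<notin> disco_rect"
    | "d \<in> disco_rect" "pglue c d \<in> disco_rect" by blast
  then show thesis
  proof cases
    case 1
    from first[OF 1(1)] obtain N \<mu> b' where N: "open N" "d \<in> N" "\<mu> > 0"
      "\<And>w. w \<in> N \<inter> disco_rect \<Longrightarrow> disco_proj w \<in> U \<and> \<phi> (disco_proj w) = \<mu> *\<^sub>R w + b'"
      by blast
    show thesis
    proof (rule that[of "N \<inter> pdom c \<inter> (pglue c -` (- disco_rect))"])
      fix w assume w: "w \<in> N \<inter> pdom c \<inter> (pglue c -` (- disco_rect))"
      then have "w \<in> disco_rect"
        using pglue_in_rect[OF c] by blast
      then show "psi c w \<in> U \<and> \<phi> (psi c w) = \<mu> *\<^sub>R w + b'"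
        using N(4) w by (simp add: psi1)
    qed (use N 1 d open_r open_pdom[OF c] in auto)
  next
    case 2
    from second[OF pglue_in_rect[OF c d(1) 2]] obtain N \<mu> b' where N: "open N" "d \<in> N" "\<mu> > 0"
      "\<And>w. w \<in> N \<Longrightarrow> pglue c w \<in> disco_rect \<Longrightarrow> disco_proj (pglue c w) \<in> U \<and> \<phi> (disco_proj (pglue c w)) = \<mu> *\<^sub>R w + b'"
      by blast
    show thesis
    proof (rule that[of "N \<inter> pdom c \<inter> (- disco_rect)"])
      fix w assume w: "w \<in> N \<inter> pdom c \<inter> (- disco_rect)"
      then have "pglue c w \<in> disco_rect"
        using pglue_in_rect[OF c] by blast
      then show "psi c w \<in> U \<and> \<phi> (psi c w) = \<mu> *\<^sub>R w + b'"
        using N(4) w psi2 by simp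
    qed (use N 2 d open_r open_pdom[OF c] in auto)
  next
    case 3
    from first[OF 3(1)] obtain N \<mu> b1 where N: "open N" "d \<in> N" "\<mu> > 0"
      "\<And>w. w \<in> N \<inter> disco_rect \<Longrightarrow> disco_proj w \<in> U \<and> \<phi> (disco_proj w) = \<mu> *\<^sub>R w + b1"
      by blast
    from second[OF 3(2)] obtain N' \<nu> b2 where N': "open N'" "d \<in> N'" "\<nu> > 0"
      "\<And>w. w \<in> N' \<Longrightarrow> pglue c w \<in> disco_rect \<Longrightarrow> disco_proj (pglue c w) \<in> U \<and> \<phi> (disco_proj (pglue c w)) = \<nu> *\<^sub>R w + b2"
      by blast
    obtain u where u: "u \<noteq> 0" "\<And>t. 0 \<le> t \<Longrightarrow> t \<le> (1::real) \<Longrightarrow>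
      d + t *\<^sub>R u \<in> pdom c \<and> d + t *\<^sub>R u \<in> disco_rect \<and> pglue c (d + t *\<^sub>R u) \<in> disco_rect"
      using seam_direction[OF c d(1) 3] by blast
    have eq: "\<mu> *\<^sub>R w + b1 = \<nu> *\<^sub>R w + b2"
      if "w \<in> N" "w \<in> N'" "w \<in> pdom c" "w \<in> disco_rect" "pglue c w \<in> disco_rect" for w
      using N(4)[of w] N'(4)[of w] psi1[of w] psi2[of w] that by auto
    \<comment> \<open>A small positive \<open>t\<close> moves \<open>d\<close> along the seam within
      both neighbourhoods; the two expressions are then compared at two distinct points.\<close>
    have "((\<lambda>t. d + t *\<^sub>R u) \<longlongrightarrow> d + 0 *\<^sub>R u) (at_right 0)"
      by (intro tendsto_intros)
    then have "\<forall>\<^sub>F t in at_right 0. d + t *\<^sub>R u \<in> N \<inter> N'"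
      using N N' by (intro topological_tendstoD) auto
    moreover have "\<forall>\<^sub>F t in at_right (0::real). t < 1"
      by (intro eventually_at_rightI[of 0 1]) auto
    ultimately have "\<forall>\<^sub>F t in at_right 0. d + t *\<^sub>R u \<in> N \<inter> N' \<and> t < 1 \<and> 0 < t"
      by (auto simp: eventually_conj_iff eventually_at_right_less)
    then obtain t where t: "d + t *\<^sub>R u \<in> N \<inter> N'" "t < 1" "0 < t"
      using eventually_happens[of _ "at_right (0::real)"] trivial_limit_at_right_real by blast
    have 1: "\<mu> *\<^sub>R (d + t *\<^sub>R u) + b1 = \<nu> *\<^sub>R (d + t *\<^sub>R u) + b2"
      using t u(2)[of t] by (intro eq) auto
    have 2: "\<mu> *\<^sub>R d + b1 = \<nu> *\<^sub>R d + b2"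
      using N(2) N'(2) d(1) 3 by (intro eq) auto
    have "\<mu> *\<^sub>R (t *\<^sub>R u) = (\<mu> *\<^sub>R (d + t *\<^sub>R u) + b1) - (\<mu> *\<^sub>R d + b1)"
      by (simp add: algebra_simps)
    also have "\<dots> = \<nu> *\<^sub>R (t *\<^sub>R u)"
      unfolding 1 2 by (simp add: algebra_simps)
    finally have "\<mu> = \<nu>"
      using t(3) u(1) by simp
    with \<open>\<mu> *\<^sub>R d + b1 = \<nu> *\<^sub>R d + b2\<close> have "b1 = b2" by simp
    show thesis
    proof (rule that[of "N \<inter> N' \<inter> pdom c"])
      fix w assume w: "w \<in> N \<inter> N' \<inter> pdom c"
      show "psi c w \<in> U \<and> \<phi> (psi c w) = \<mu> *\<^sub>R w + b1"
        using N(4)[of w] N'(4)[of w] psi1[of w] psi2[of w] w pglue_in_rect[OF c, of w] \<open>\<mu> = \<nu>\<close> \<open>b1 = b2\<close>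
        by (cases "w \<in> disco_rect") auto
    qed (use N N' d open_pdom[OF c] in auto)
  qed
qed

text \<open>The chart of the second patch belongs to the atlas, so its reading in the first one is a
  homothety; evaluation at \<open>d\<close> determines the translation from
  \<open>d'\<close>.\<close>

lemma psi_transition:
  assumes c: "c \<in> patches" "c' \<in> patches" and d: "d \<in> pdom c" "d' \<in> pdom c'" and eq: "psi c d = psi c' d'"
  obtains N \<mu> where "open N" "d \<in> N" "N \<subseteq> pdom c" "\<mu> > 0"
    "\<And>w. w \<in> N \<Longrightarrow> d' + \<mu> *\<^sub>R (w - d) \<in> pdom c' \<and> psi c w = psi c' (d' + \<mu> *\<^sub>R (w - d))"
proof -
  have "psi c d \<in> fst (pchart c')"
    using d eq by (simp add: pchart_def)
  then obtain N \<mu> b where N: "open N" "d \<in> N" "N \<subseteq> pdom c" "\<mu> > 0"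
    "\<And>w. w \<in> N \<Longrightarrow> psi c w \<in> fst (pchart c') \<and> snd (pchart c') (psi c w) = \<mu> *\<^sub>R w + b"
    using atlas_psi[of "fst (pchart c')" "snd (pchart c')" c d] pchart_in_atlas[OF c(2)] c d by auto
  have "d' = \<mu> *\<^sub>R d + b"
    using N(5)[OF N(2)] pchart_psi[OF c(2) d(2)] eq by simp
  then have *: "d' + \<mu> *\<^sub>R (w - d) = \<mu> *\<^sub>R w + b" for w
    by (simp add: algebra_simps)
  have "\<mu> *\<^sub>R w + b \<in> pdom c' \<and> psi c w = psi c' (\<mu> *\<^sub>R w + b)" if w: "w \<in> N" for w
  proof -
    obtain v where v: "v \<in> pdom c'" "psi c w = psi c' v"
      using N(5)[OF w] by (auto simp: pchart_def)
    then have "\<mu> *\<^sub>R w + b = v"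
      using N(5)[OF w] pchart_psi[OF c(2) v(1)] by simp
    with v show ?thesis by simp
  qed
  then show thesis
    using that[OF N(1-4)] unfolding * by blast
qed

section \<open>Germs of affine maps into the surface\<close>

text \<open>Near \<open>z\<close> the map is affine in patches with linear part a positive multiple of \<open>L\<close>. The
  source is an arbitrary normed space so as to cover both straight lines and developed strips.\<close>

definition aff_at :: "('a::real_normed_vector \<Rightarrow> real ^ 2) \<Rightarrow> ('a \<Rightarrow> (real ^ 2) set) \<Rightarrow> 'a \<Rightarrow> bool" where
  "aff_at L G z \<longleftrightarrow> (\<exists>c\<in>patches. \<exists>N \<mu> B. open N \<and> z \<in> N \<and> \<mu> > 0 \<and>
     (\<forall>w\<in>N. \<mu> *\<^sub>R L w + B \<in> pdom c \<and> G w = psi c (\<mu> *\<^sub>R L w + B)))"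

lemma aff_atI:
  assumes "c \<in> patches" "open N" "z \<in> N" "\<mu> > 0"
    and "\<And>w. w \<in> N \<Longrightarrow> \<mu> *\<^sub>R L w + B \<in> pdom c \<and> G w = psi c (\<mu> *\<^sub>R L w + B)"
  shows "aff_at L G z"
  using assms unfolding aff_at_def by blast

lemma aff_at_psi:
  assumes "c \<in> patches" "d \<in> pdom c"
  shows "aff_at (\<lambda>w. w) (psi c) d"
  using assms by (intro aff_atI[where c = c and N = "pdom c" and \<mu> = 1 and B = 0]) (auto simp: open_pdom)

lemma aff_at_cong:
  assumes "aff_at L H z" "open N" "z \<in> N" "\<And>w. w \<in> N \<Longrightarrow> G w = H w"
  shows "aff_at L G z"
proof -
  obtain c N' \<mu> B where "c \<in> patches" "open N'" "z \<in> N'" "\<mu> > 0"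
    "\<And>w. w \<in> N' \<Longrightarrow> \<mu> *\<^sub>R L w + B \<in> pdom c \<and> H w = psi c (\<mu> *\<^sub>R L w + B)"
    using assms(1) unfolding aff_at_def by blast
  then show ?thesis
    using assms(2-4) by (intro aff_atI[of c "N' \<inter> N" z \<mu> L B]) auto
qed

lemma aff_at_nearby:
  assumes "aff_at L G z"
  obtains N where "open N" "z \<in> N" "\<And>w. w \<in> N \<Longrightarrow> aff_at L G w"
  using assms unfolding aff_at_def by blast

lemma aff_at_image:
  assumes "aff_at L G z"
  shows "G z \<in> topspace disco" "G z \<notin> disco_sing"
  using assms psi_in_topspace psi_notin_sing unfolding aff_at_def by fastforce+

text \<open>The patch provided by the definition may be exchanged for any patch around the image
  point, since transitions are homotheties and change only the factor and the translation.\<close>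

lemma aff_atE:
  assumes G: "aff_at L G z" and L: "bounded_linear L"
    and c: "c \<in> patches" "d \<in> pdom c" "G z = psi c d"
  obtains N \<mu> where "open N" "z \<in> N" "\<mu> > 0"
    "\<And>w. w \<in> N \<Longrightarrow> d + \<mu> *\<^sub>R L (w - z) \<in> pdom c \<and> G w = psi c (d + \<mu> *\<^sub>R L (w - z))"
proof -
  obtain c' N \<mu> B where N: "c' \<in> patches" "open N" "z \<in> N" "\<mu> > 0"
    "\<And>w. w \<in> N \<Longrightarrow> \<mu> *\<^sub>R L w + B \<in> pdom c' \<and> G w = psi c' (\<mu> *\<^sub>R L w + B)"
    using G unfolding aff_at_def by blast
  let ?h = "\<lambda>w. \<mu> *\<^sub>R L w + B"
  have "psi c' (?h z) = psi c d" "?h z \<in> pdom c'"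
    using N(5)[OF N(3)] c(3) by auto
  then obtain N' \<nu> where N': "open N'" "?h z \<in> N'" "N' \<subseteq> pdom c'" "\<nu> > 0"
    "\<And>w. w \<in> N' \<Longrightarrow> d + \<nu> *\<^sub>R (w - ?h z) \<in> pdom c \<and> psi c' w = psi c (d + \<nu> *\<^sub>R (w - ?h z))"
    using psi_transition[OF N(1) c(1) _ c(2)] by metis
  have cont: "continuous_on UNIV ?h"
    by (intro continuous_intros bounded_linear.continuous_on[OF L])
  show thesis
  proof (rule that[of "N \<inter> ?h -` N'" "\<nu> * \<mu>"])
    show "open (N \<inter> ?h -` N')"
      using open_vimage[OF N'(1) cont] N(2) by blast
    fix w assume w: "w \<in> N \<inter> ?h -` N'"
    have "\<nu> *\<^sub>R (?h w - ?h z) = (\<nu> * \<mu>) *\<^sub>R L (w - z)"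
      by (simp add: linear_diff[OF bounded_linear.linear[OF L]] scaleR_diff_right)
    then show "d + (\<nu> * \<mu>) *\<^sub>R L (w - z) \<in> pdom c \<and> G w = psi c (d + (\<nu> * \<mu>) *\<^sub>R L (w - z))"
      using N(5)[of w] N'(5)[of "?h w"] w by auto
  qed (use N N' in auto)
qed

lemma aff_at_affine:
  assumes G: "aff_at L G (A z + b)" and A: "bounded_linear A" and L: "bounded_linear L"
  shows "aff_at (\<lambda>w. L (A w)) (\<lambda>w. G (A w + b)) z"
proof -
  obtain c N \<mu> B where N: "c \<in> patches" "open N" "A z + b \<in> N" "\<mu> > 0"
    "\<And>w. w \<in> N \<Longrightarrow> \<mu> *\<^sub>R L w + B \<in> pdom c \<and> G w = psi c (\<mu> *\<^sub>R L w + B)"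
    using G unfolding aff_at_def by blast
  have "continuous_on UNIV (\<lambda>w. A w + b)"
    by (intro continuous_intros bounded_linear.continuous_on[OF A])
  then have op: "open ((\<lambda>w. A w + b) -` N)"
    by (rule open_vimage[OF N(2)])
  have eq: "\<mu> *\<^sub>R L (A w) + (\<mu> *\<^sub>R L b + B) = \<mu> *\<^sub>R L (A w + b) + B" for w
    by (simp add: linear_add[OF bounded_linear.linear[OF L]] scaleR_add_right)
  show ?thesis
  proof (rule aff_atI[OF N(1) op _ N(4)])
    show "\<mu> *\<^sub>R L (A w) + (\<mu> *\<^sub>R L b + B) \<in> pdom c \<and> G (A w + b) = psi c (\<mu> *\<^sub>R L (A w) + (\<mu> *\<^sub>R L b + B))"
      if "w \<in> (\<lambda>w. A w + b) -` N" for w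
      using N(5)[of "A w + b"] that unfolding eq by blast
  qed (use N in simp)
qed

lemma aff_at_scale:
  assumes "aff_at (\<lambda>w. k *\<^sub>R L w) G z" "k > 0"
  shows "aff_at L G z"
proof -
  obtain c N \<mu> B where N: "c \<in> patches" "open N" "z \<in> N" "\<mu> > 0"
    "\<And>w. w \<in> N \<Longrightarrow> \<mu> *\<^sub>R k *\<^sub>R L w + B \<in> pdom c \<and> G w = psi c (\<mu> *\<^sub>R k *\<^sub>R L w + B)"
    using assms(1) unfolding aff_at_def by blast
  then show ?thesis
    using assms(2) by (intro aff_atI[of c N z "\<mu> * k" L B]) auto
qed

lemma continuous_map_aff_at:
  assumes D: "open D" and L: "bounded_linear L" and G: "\<And>z. z \<in> D \<Longrightarrow> aff_at L G z"
  shows "continuous_map (top_of_set D) disco G"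
  unfolding continuous_map_def
proof (intro conjI allI impI)
  show "G \<in> topspace (top_of_set D) \<rightarrow> topspace disco"
    using aff_at_image(1)[OF G] by auto
  fix U assume U: "openin disco U"
  have "open {z \<in> D. G z \<in> U}"
  proof (subst open_subopen, intro ballI)
    fix z assume "z \<in> {z \<in> D. G z \<in> U}"
    then have z: "z \<in> D" "G z \<in> U" by auto
    obtain c N \<mu> B where N: "c \<in> patches" "open N" "z \<in> N" "\<mu> > 0"
      "\<And>w. w \<in> N \<Longrightarrow> \<mu> *\<^sub>R L w + B \<in> pdom c \<and> G w = psi c (\<mu> *\<^sub>R L w + B)"
      using G[OF z(1)] unfolding aff_at_def by blast
    let ?h = "\<lambda>w. \<mu> *\<^sub>R L w + B"
    have "openin (top_of_set (pdom c)) {w \<in> pdom c. psi c w \<in> U}"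
      using continuous_map_psi[OF N(1)] U unfolding continuous_map_def by simp
    then have V: "open {w \<in> pdom c. psi c w \<in> U}"
      using open_pdom[OF N(1)] openin_open_eq by blast
    have "open (?h -` {w \<in> pdom c. psi c w \<in> U})"
      by (intro open_vimage V continuous_intros bounded_linear.continuous_on[OF L])
    then have "open (N \<inter> D \<inter> ?h -` {w \<in> pdom c. psi c w \<in> U})"
      using N(2) D by (intro open_Int)
    moreover have "z \<in> N \<inter> D \<inter> ?h -` {w \<in> pdom c. psi c w \<in> U}"
      using N(3) N(5)[OF N(3)] z by auto
    moreover have "N \<inter> D \<inter> ?h -` {w \<in> pdom c. psi c w \<in> U} \<subseteq> {z \<in> D. G z \<in> U}"
      using N(5) by auto
    ultimately show "\<exists>T. open T \<and> z \<in> T \<and> T \<subseteq> {z \<in> D. G z \<in> U}"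
      by blast
  qed
  then show "openin (top_of_set D) {x \<in> topspace (top_of_set D). G x \<in> U}"
    by (auto intro: open_subset)
qed

text \<open>The difference of the values at \<open>w0 + t *\<^sub>R v\<close> and at
  \<open>w0\<close> eliminates the base point \<open>z\<close> and leaves
  \<open>t *\<^sub>R F v\<close>.\<close>

lemma linear_zero_on_open:
  fixes F :: "'a::real_normed_vector \<Rightarrow> 'b::real_normed_vector"
  assumes "linear F" "open N" "w0 \<in> N" "\<And>w. w \<in> N \<Longrightarrow> F (w - z) = 0"
  shows "F v = 0"
proof (cases "v = 0")
  case True
  then show ?thesis using linear_0[OF assms(1)] by simp
next
  case False
  obtain e where e: "e > 0" "ball w0 e \<subseteq> N"
    using assms(2,3) open_contains_ball by blast
  define t where "t = e / (2 * norm v)"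
  have t: "t > 0" "norm (t *\<^sub>R v) < e"
    using e False by (auto simp: t_def)
  then have "w0 + t *\<^sub>R v \<in> N"
    using e by (auto simp: dist_norm subset_iff)
  then have "F ((w0 + t *\<^sub>R v) - z) = 0" "F (w0 - z) = 0"
    using assms(3,4) by blast+
  moreover have "(w0 + t *\<^sub>R v) - z = (w0 - z) + t *\<^sub>R v"
    by simp
  ultimately have "t *\<^sub>R F v = 0"
    by (simp add: linear_add[OF assms(1)] linear_scale[OF assms(1)])
  with t show ?thesis by simp
qed

text \<open>Analytic continuation: where two such maps agree at a limit of agreement, both are affine in
  one patch with linear parts proportional to \<open>L\<close>; agreement on an open set forces equal factors.\<close>

lemma aff_at_identity:
  assumes D: "open D" "connected D" and L: "bounded_linear L"
    and G: "\<And>z. z \<in> D \<Longrightarrow> aff_at L G z" and H: "\<And>z. z \<in> D \<Longrightarrow> aff_at L H z"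
    and N0: "open N0" "z0 \<in> N0" "z0 \<in> D" "\<And>w. w \<in> N0 \<Longrightarrow> G w = H w" and z: "z \<in> D"
  shows "G z = H z"
proof -
  define E where "E = {z \<in> D. \<exists>N. open N \<and> z \<in> N \<and> (\<forall>w\<in>N. G w = H w)}"
  have E: "open E"
    unfolding E_def
  proof (subst open_subopen, intro ballI)
    fix z assume "z \<in> {z \<in> D. \<exists>N. open N \<and> z \<in> N \<and> (\<forall>w\<in>N. G w = H w)}"
    then obtain N where N: "z \<in> D" "open N" "z \<in> N" "\<forall>w\<in>N. G w = H w" by blast
    then show "\<exists>T. open T \<and> z \<in> T \<and> T \<subseteq> {z \<in> D. \<exists>N. open N \<and> z \<in> N \<and> (\<forall>w\<in>N. G w = H w)}"
      by (intro exI[of _ "N \<inter> D"]) (use D in blast)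
  qed
  have "closedin (top_of_set D) {z \<in> topspace (top_of_set D). G z = H z}"
    by (rule closedin_continuous_maps_eq[OF Hausdorff_space_disco])
      (auto intro!: continuous_map_aff_at D L G H)
  then have "closedin (top_of_set D) {z \<in> D. G z = H z}"
    by simp
  then have ne: "open (D - {z \<in> D. G z = H z})"
    using D(1) by (metis openin_diff openin_subtopology_self openin_open_eq)
  have DE: "open (D - E)"
  proof (subst open_subopen, intro ballI)
    fix z assume z: "z \<in> D - E"
    show "\<exists>T. open T \<and> z \<in> T \<and> T \<subseteq> D - E"
    proof (cases "G z = H z")
      case False
      have "D - {z \<in> D. G z = H z} \<subseteq> D - E"
        by (auto simp: E_def)
      with ne z False show ?thesis
        by (intro exI[of _ "D - {z \<in> D. G z = H z}"]) auto
    next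
      case True
      obtain c d where c: "c \<in> patches" "d \<in> pdom c" "G z = psi c d"
        using patches_cover aff_at_image[OF G] z by (metis DiffD1)
      obtain N1 \<mu> where N1: "open N1" "z \<in> N1" "\<mu> > 0"
        "\<And>w. w \<in> N1 \<Longrightarrow> d + \<mu> *\<^sub>R L (w - z) \<in> pdom c \<and> G w = psi c (d + \<mu> *\<^sub>R L (w - z))"
        using aff_atE[OF G L c] z by blast
      have zD: "z \<in> D" and Hz: "H z = psi c d"
        using z c(3) True by simp_all
      obtain N2 \<nu> where N2: "open N2" "z \<in> N2" "\<nu> > 0"
        "\<And>w. w \<in> N2 \<Longrightarrow> d + \<nu> *\<^sub>R L (w - z) \<in> pdom c \<and> H w = psi c (d + \<nu> *\<^sub>R L (w - z))"
        using aff_atE[OF H[OF zD] L c(1,2) Hz] by blast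
      have "N1 \<inter> N2 \<inter> E = {}"
      proof (rule ccontr)
        assume "N1 \<inter> N2 \<inter> E \<noteq> {}"
        then obtain w0 N where w0: "w0 \<in> N1" "w0 \<in> N2" "open N" "w0 \<in> N" "\<And>w. w \<in> N \<Longrightarrow> G w = H w"
          unfolding E_def by blast
        have "\<mu> *\<^sub>R L (w - z) - \<nu> *\<^sub>R L (w - z) = 0" if w: "w \<in> N1 \<inter> N2 \<inter> N" for w
        proof -
          have "psi c (d + \<mu> *\<^sub>R L (w - z)) = psi c (d + \<nu> *\<^sub>R L (w - z))"
            using N1(4)[of w] N2(4)[of w] w0(5)[of w] w by auto
          then have "d + \<mu> *\<^sub>R L (w - z) = d + \<nu> *\<^sub>R L (w - z)"
            using inj_on_psi[OF c(1)] N1(4)[of w] N2(4)[of w] w by (auto dest: inj_onD)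
          then show ?thesis by simp
        qed
        moreover have "linear (\<lambda>v. \<mu> *\<^sub>R L v - \<nu> *\<^sub>R L v)"
          using bounded_linear.linear[OF L] by (intro linear_compose_sub linear_compose_scale_right)
        ultimately have eq: "\<mu> *\<^sub>R L v - \<nu> *\<^sub>R L v = 0" for v
          using linear_zero_on_open[of "\<lambda>v. \<mu> *\<^sub>R L v - \<nu> *\<^sub>R L v" "N1 \<inter> N2 \<inter> N" w0 z v] w0 N1(1) N2(1) by blast
        have "G w = H w" if "w \<in> N1 \<inter> N2" for w
          using N1(4)[of w] N2(4)[of w] that eq[of "w - z"] by auto
        then have "z \<in> E"
          unfolding E_def using z N1(1,2) N2(1,2) by blast
        with z show False by blast
      qed
      then show ?thesis
        using z N1(1,2) N2(1,2) D(1) by (intro exI[of _ "N1 \<inter> N2 \<inter> D"]) auto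
    qed
  qed
  have "E = D"
  proof (rule ccontr)
    assume "E \<noteq> D"
    moreover have "E \<subseteq> D" "z0 \<in> E"
      unfolding E_def using N0 by blast+
    ultimately have "D - E \<noteq> {}" "E \<subseteq> D" "E \<noteq> {}"
      by blast+
    then show False
      using connectedD[OF D(2) E DE] by auto
  qed
  with z show ?thesis by (auto simp: E_def)
qed

section \<open>Affine automorphisms and their linear parts\<close>

lemma bounded_linear_matrix: "bounded_linear ((*v) (M :: real ^ 2 ^ 2))"
  by (rule matrix_vector_mul_bounded_linear)

lemma det_scaleR_2: "det (k *\<^sub>R (A :: real ^ 2 ^ 2)) = k\<^sup>2 * det A"
  by (simp add: det_2 power2_eq_square algebra_simps)

lemma scaleR_matrix_mult: "(k *\<^sub>R (A :: real ^ 2 ^ 2)) *v x = k *\<^sub>R (A *v x)"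
  by (simp add: scaleR_matrix_vector_assoc)

lemma det_normalise_det:
  assumes "det A > 0"
  shows "det (normalise_det A) = 1" and "A = sqrt (det A) *\<^sub>R normalise_det A"
  using assms by (simp_all add: normalise_det_def det_scaleR_2 power_divide)

lemma normalise_det_scaleR:
  assumes "det M = 1" "k > 0"
  shows "normalise_det (k *\<^sub>R M) = M"
  using assms by (simp add: normalise_det_def det_scaleR_2 real_sqrt_mult)

lemma scaleR_eq_det_one:
  assumes "det (M :: real ^ 2 ^ 2) = 1" "det M' = 1" "\<mu> > 0" "\<nu> > 0" "\<mu> *\<^sub>R M = \<nu> *\<^sub>R M'"
  shows "M = M'"
  using normalise_det_scaleR[OF assms(1,3)] normalise_det_scaleR[OF assms(2,4)] assms(5) by simp

text \<open>Read in one patch around the same image point, the two linear parts are positive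
  multiples of each other; determinant 1 removes the factor.\<close>

lemma aff_at_unique:
  assumes "aff_at ((*v) M) G z" "aff_at ((*v) M') G z" "det M = 1" "det M' = 1"
  shows "M = M'"
proof -
  obtain c d where c: "c \<in> patches" "d \<in> pdom c" "G z = psi c d"
    using patches_cover aff_at_image[OF assms(1)] by blast
  obtain N1 \<mu> where N1: "open N1" "z \<in> N1" "\<mu> > 0"
    "\<And>w. w \<in> N1 \<Longrightarrow> d + \<mu> *\<^sub>R (M *v (w - z)) \<in> pdom c \<and> G w = psi c (d + \<mu> *\<^sub>R (M *v (w - z)))"
    using aff_atE[OF assms(1) bounded_linear_matrix c] by blast
  obtain N2 \<nu> where N2: "open N2" "z \<in> N2" "\<nu> > 0"
    "\<And>w. w \<in> N2 \<Longrightarrow> d + \<nu> *\<^sub>R (M' *v (w - z)) \<in> pdom c \<and> G w = psi c (d + \<nu> *\<^sub>R (M' *v (w - z)))"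
    using aff_atE[OF assms(2) bounded_linear_matrix c] by blast
  have "\<mu> *\<^sub>R (M *v (w - z)) - \<nu> *\<^sub>R (M' *v (w - z)) = 0" if "w \<in> N1 \<inter> N2" for w
  proof -
    have "d + \<mu> *\<^sub>R (M *v (w - z)) = d + \<nu> *\<^sub>R (M' *v (w - z))"
      using N1(4)[of w] N2(4)[of w] that
      by (intro inj_onD[OF inj_on_psi[OF c(1)]]) auto
    then show ?thesis by simp
  qed
  moreover have "linear (\<lambda>v. \<mu> *\<^sub>R (M *v v) - \<nu> *\<^sub>R (M' *v v))"
    by (intro linear_compose_sub linear_compose_scale_right) simp_all
  ultimately have "\<mu> *\<^sub>R (M *v v) - \<nu> *\<^sub>R (M' *v v) = 0" for v
    using linear_zero_on_open[of "\<lambda>v. \<mu> *\<^sub>R (M *v v) - \<nu> *\<^sub>R (M' *v v)" "N1 \<inter> N2" z z v] N1(1,2) N2(1,2)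
    by blast
  then have "\<mu> *\<^sub>R M = \<nu> *\<^sub>R M'"
    by (simp add: matrix_eq scaleR_matrix_mult)
  then show ?thesis
    using scaleR_eq_det_one assms(3,4) N1(3) N2(3) by blast
qed

text \<open>The chain rule. The scaling factor of \<open>K\<close> passes through the linear map
  \<open>T\<close> and is absorbed, since only linear parts up to positive factors are
  recorded.\<close>

lemma aff_at_compose:
  fixes K :: "'a::real_normed_vector \<Rightarrow> (real ^ 2) set"
  assumes K: "aff_at L K z" "bounded_linear L" and c: "c \<in> patches" "d \<in> pdom c" "K z = psi c d"
    and f: "aff_at T (\<lambda>w. f (psi c w)) d" "bounded_linear T"
  shows "aff_at (\<lambda>w. T (L w)) (\<lambda>w. f (K w)) z"
proof -
  obtain N \<mu> where N: "open N" "z \<in> N" "\<mu> > 0"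
    "\<And>w. w \<in> N \<Longrightarrow> d + \<mu> *\<^sub>R L (w - z) \<in> pdom c \<and> K w = psi c (d + \<mu> *\<^sub>R L (w - z))"
    using aff_atE[OF K c] by blast
  note lin = bounded_linear.linear[OF K(2)] bounded_linear.linear[OF f(2)]
  have eq: "d + \<mu> *\<^sub>R L (w - z) = \<mu> *\<^sub>R L w + (d - \<mu> *\<^sub>R L z)" for w
    by (simp add: linear_diff[OF lin(1)] scaleR_diff_right)
  have "aff_at (\<lambda>w. T (\<mu> *\<^sub>R L w)) (\<lambda>w. f (psi c (\<mu> *\<^sub>R L w + (d - \<mu> *\<^sub>R L z)))) z"
    using aff_at_affine[of T "\<lambda>w. f (psi c w)" "\<lambda>w. \<mu> *\<^sub>R L w" z "d - \<mu> *\<^sub>R L z"] f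
      bounded_linear_compose[OF bounded_linear_scaleR_right K(2)] by simp
  then have "aff_at (\<lambda>w. \<mu> *\<^sub>R T (L w)) (\<lambda>w. f (psi c (\<mu> *\<^sub>R L w + (d - \<mu> *\<^sub>R L z)))) z"
    by (simp add: linear_scale[OF lin(2)])
  then have "aff_at (\<lambda>w. T (L w)) (\<lambda>w. f (psi c (\<mu> *\<^sub>R L w + (d - \<mu> *\<^sub>R L z)))) z"
    by (rule aff_at_scale[OF _ N(3)])
  then show ?thesis
    by (rule aff_at_cong[OF _ N(1,2)]) (use N(4) eq in auto)
qed

text \<open>\<open>K\<close> is locally a homothety and can be inverted. The linear part of
  \<open>f\<close> may thus be computed through whatever parametrisation is convenient, such as
  \<open>cyl\<close> or \<open>vcyl\<close>.\<close>

lemma aff_at_psi_of_immersion: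
  fixes K :: "real ^ 2 \<Rightarrow> (real ^ 2) set"
  assumes K: "aff_at (\<lambda>w. w) K z" and f: "aff_at T (\<lambda>w. f (K w)) z" "bounded_linear T"
    and c: "c \<in> patches" "d \<in> pdom c" "K z = psi c d"
  shows "aff_at T (\<lambda>w. f (psi c w)) d"
proof -
  obtain N \<mu> where N: "open N" "z \<in> N" "\<mu> > 0"
    "\<And>w. w \<in> N \<Longrightarrow> d + \<mu> *\<^sub>R (w - z) \<in> pdom c \<and> K w = psi c (d + \<mu> *\<^sub>R (w - z))"
    using aff_atE[OF K bounded_linear_ident c] by blast
  let ?h = "\<lambda>v. (1 / \<mu>) *\<^sub>R v + (z - (1 / \<mu>) *\<^sub>R d)"
  have hd: "?h d = z" by simp
  have "aff_at (\<lambda>w. T ((1 / \<mu>) *\<^sub>R w)) (\<lambda>v. f (K (?h v))) d"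
    using aff_at_affine[of T "\<lambda>w. f (K w)" "\<lambda>w. (1 / \<mu>) *\<^sub>R w" d "z - (1 / \<mu>) *\<^sub>R d"] f
      bounded_linear_scaleR_right unfolding hd by blast
  then have "aff_at (\<lambda>w. (1 / \<mu>) *\<^sub>R T w) (\<lambda>v. f (K (?h v))) d"
    using linear_scale[OF bounded_linear.linear[OF f(2)]] by simp
  then have "aff_at T (\<lambda>v. f (K (?h v))) d"
    by (rule aff_at_scale) (use N in simp)
  moreover have "open (?h -` N)"
    by (intro open_vimage N(1) continuous_intros)
  moreover have "f (psi c v) = f (K (?h v))" if "v \<in> ?h -` N" for v
  proof -
    have "d + \<mu> *\<^sub>R (?h v - z) = v"
      using N(3) by (simp add: algebra_simps)
    then show ?thesis
      using N(4)[of "?h v"] that by auto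
  qed
  ultimately show ?thesis
    using aff_at_cong[of T "\<lambda>v. f (K (?h v))" d "?h -` N" "\<lambda>w. f (psi c w)"] N(2) hd by simp
qed

text \<open>The working form of an affine automorphism: six patches in place of the maximal atlas,
  and a single normalised linear part valid at every nonsingular point.\<close>

definition affine_with :: "real ^ 2 ^ 2 \<Rightarrow> ((real ^ 2) set \<Rightarrow> (real ^ 2) set) \<Rightarrow> bool" where
  "affine_with M f \<longleftrightarrow> f \<in> Bij (topspace disco) \<and> homeomorphic_map disco disco f \<and>
     f ` disco_sing = disco_sing \<and> det M = 1 \<and>
     (\<forall>c\<in>patches. \<forall>d\<in>pdom c. aff_at ((*v) M) (\<lambda>w. f (psi c w)) d)"

lemma disco_sing_subset: "disco_sing \<subseteq> topspace disco"
  by (auto simp: disco_sing_eq topspace_disco_eq vertex_imp_rect)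

lemma nonsing_image:
  assumes "f \<in> Bij (topspace disco)" "f ` disco_sing = disco_sing" "p \<in> topspace disco" "p \<notin> disco_sing"
  shows "f p \<in> topspace disco" "f p \<notin> disco_sing"
proof -
  have bij: "bij_betw f (topspace disco) (topspace disco)"
    using assms(1) by (simp add: Bij_def)
  then show "f p \<in> topspace disco"
    using assms(3) bij_betwE by blast
  show "f p \<notin> disco_sing"
  proof
    assume "f p \<in> disco_sing"
    then obtain q where "q \<in> disco_sing" "f p = f q"
      using assms(2) by blast
    then show False
      using bij_betw_imp_inj_on[OF bij] assms(3,4) disco_sing_subset by (auto dest: inj_onD)
  qed
qed

lemma atlas_inj:
  assumes "(U, \<phi>) \<in> disco_atlas" "p \<in> U" "q \<in> U" "\<phi> p = \<phi> q"
  shows "p = q"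
proof -
  have "homeomorphic_map (subtopology disco U) (top_of_set (\<phi> ` U)) \<phi>" "openin disco U"
    using assms(1) by (auto simp: disco_atlas_def)
  then have "inj_on \<phi> (topspace disco \<inter> U)" "U \<subseteq> topspace disco"
    using homeomorphic_imp_injective_map openin_subset by fastforce+
  then show ?thesis
    using assms by (auto dest: inj_onD)
qed

lemma atlas_point:
  assumes "(U, \<phi>) \<in> disco_atlas" "p \<in> U"
  obtains c d where "c \<in> patches" "d \<in> pdom c" "p = psi c d"
proof -
  have "p \<in> topspace disco" "p \<notin> disco_sing"
    using assms openin_subset unfolding disco_atlas_def by fastforce+
  then show thesis
    using patches_cover that by blast
qed

lemma linear_at_imp_aff_at:
  assumes c1: "(U1, \<phi>1) \<in> disco_atlas" and c2: "(U2, \<phi>2) \<in> disco_atlas"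
    and c: "c \<in> patches" "d \<in> pdom c" and fp: "f (psi c d) \<in> U2"
    and lin: "linear_at f (U1, \<phi>1) (U2, \<phi>2) (psi c d) A" and det: "det A > 0"
  shows "aff_at ((*v) (normalise_det A)) (\<lambda>w. f (psi c w)) d"
proof -
  obtain W B where W: "openin disco W" "psi c d \<in> W" "W \<subseteq> U1" "f ` W \<subseteq> U2"
    "\<And>q. q \<in> W \<Longrightarrow> \<phi>2 (f q) = A *v \<phi>1 q + B"
    using lin unfolding linear_at_def by auto
  have "psi c d \<in> U1" using W by blast
  from atlas_psi[OF c1 c this] obtain N1 \<mu> b1 where N1: "open N1" "d \<in> N1" "N1 \<subseteq> pdom c" "\<mu> > 0"
    "\<And>w. w \<in> N1 \<Longrightarrow> psi c w \<in> U1 \<and> \<phi>1 (psi c w) = \<mu> *\<^sub>R w + b1"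
    by blast
  obtain c' d' where c': "c' \<in> patches" "d' \<in> pdom c'" "f (psi c d) = psi c' d'"
    using atlas_point[OF c2 fp] by blast
  from atlas_psi[OF c2 c'(1,2)] fp obtain N2 \<nu> b2 where N2: "open N2" "d' \<in> N2" "N2 \<subseteq> pdom c'" "\<nu> > 0"
    "\<And>w. w \<in> N2 \<Longrightarrow> psi c' w \<in> U2 \<and> \<phi>2 (psi c' w) = \<nu> *\<^sub>R w + b2"
    unfolding c'(3) by blast
  \<comment> \<open>\<open>h\<close> is \<open>f\<close> read between the two patches, obtained by
    solving the affine relation between the charts for the patch coordinate.\<close>
  define h where "h = (\<lambda>w. (\<mu> / \<nu>) *\<^sub>R (A *v w) + (1 / \<nu>) *\<^sub>R (A *v b1 + B - b2))"
  have h: "\<nu> *\<^sub>R h w + b2 = A *v (\<mu> *\<^sub>R w + b1) + B" for w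
    using N2(4) by (simp add: h_def algebra_simps matrix_vector_mult_add_rdistrib matrix_vector_right_distrib matrix_vector_mult_scaleR)
  have "\<nu> *\<^sub>R h d + b2 = \<nu> *\<^sub>R d' + b2"
    unfolding h using W(5)[OF W(2)] N1(5)[OF N1(2)] N2(5)[OF N2(2)] c'(3) by simp
  then have hd: "h d = d'"
    using N2(4) by simp
  have "continuous_on UNIV h"
    unfolding h_def by (intro continuous_intros bounded_linear.continuous_on[OF bounded_linear_matrix])
  then have "open (h -` N2)"
    by (rule open_vimage[OF N2(1)])
  moreover have "openin (top_of_set (pdom c)) {w \<in> pdom c. psi c w \<in> W}"
    using continuous_map_psi[OF c(1)] W(1) unfolding continuous_map_def by simp
  then have "open {w \<in> pdom c. psi c w \<in> W}"
    using open_pdom[OF c(1)] openin_open_eq by blast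
  ultimately have op: "open (N1 \<inter> h -` N2 \<inter> {w \<in> pdom c. psi c w \<in> W})"
    using N1(1) by (intro open_Int)
  have eq: "(\<mu> / \<nu> * sqrt (det A)) *\<^sub>R (normalise_det A *v w) + (1 / \<nu>) *\<^sub>R (A *v b1 + B - b2) = h w" for w
    using det by (simp add: h_def normalise_det_def scaleR_matrix_mult)
  show ?thesis
  proof (rule aff_atI[OF c'(1) op])
    show "0 < \<mu> / \<nu> * sqrt (det A)"
      using det N1(4) N2(4) by simp
    show "d \<in> N1 \<inter> h -` N2 \<inter> {w \<in> pdom c. psi c w \<in> W}"
      using N1(2) N2(2) hd c(2) W(2) by simp
    fix w assume w: "w \<in> N1 \<inter> h -` N2 \<inter> {w \<in> pdom c. psi c w \<in> W}"
    have "\<phi>2 (f (psi c w)) = \<phi>2 (psi c' (h w))"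
      using w W(5)[of "psi c w"] N1(5)[of w] N2(5)[of "h w"] h by simp
    moreover have "f (psi c w) \<in> U2" "psi c' (h w) \<in> U2" "h w \<in> pdom c'"
      using w W(4) N2(3,5) by blast+
    ultimately show "(\<mu> / \<nu> * sqrt (det A)) *\<^sub>R (normalise_det A *v w) + (1 / \<nu>) *\<^sub>R (A *v b1 + B - b2) \<in> pdom c' \<and>
       f (psi c w) = psi c' ((\<mu> / \<nu> * sqrt (det A)) *\<^sub>R (normalise_det A *v w) + (1 / \<nu>) *\<^sub>R (A *v b1 + B - b2))"
      unfolding eq using atlas_inj[OF c2] by blast
  qed
qed

text \<open>Besides existence, the last conclusion shows that every admissible matrix has the same
  normalisation. This gives the description operator in \<open>disco_rho\<close> a definite
  value.\<close>

lemma aff_at_imp_linear_at: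
  assumes c1: "(U1, \<phi>1) \<in> disco_atlas" and c2: "(U2, \<phi>2) \<in> disco_atlas"
    and c: "c \<in> patches" "d \<in> pdom c" and p: "psi c d \<in> U1" "f (psi c d) \<in> U2"
    and f: "aff_at ((*v) M) (\<lambda>w. f (psi c w)) d" and det: "det M = 1"
  obtains k where "k > 0" "linear_at f (U1, \<phi>1) (U2, \<phi>2) (psi c d) (k *\<^sub>R M)"
    "\<And>A. linear_at f (U1, \<phi>1) (U2, \<phi>2) (psi c d) A \<Longrightarrow> normalise_det A = M"
proof -
  from atlas_psi[OF c1 c p(1)] obtain N1 \<mu> b1 where N1: "open N1" "d \<in> N1" "N1 \<subseteq> pdom c" "\<mu> > 0"
    "\<And>w. w \<in> N1 \<Longrightarrow> psi c w \<in> U1 \<and> \<phi>1 (psi c w) = \<mu> *\<^sub>R w + b1"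
    by blast
  obtain c' d' where c': "c' \<in> patches" "d' \<in> pdom c'" "f (psi c d) = psi c' d'"
    using atlas_point[OF c2 p(2)] by blast
  from atlas_psi[OF c2 c'(1,2)] p(2) obtain N2 \<nu> b2 where N2: "open N2" "d' \<in> N2" "N2 \<subseteq> pdom c'" "\<nu> > 0"
    "\<And>w. w \<in> N2 \<Longrightarrow> psi c' w \<in> U2 \<and> \<phi>2 (psi c' w) = \<nu> *\<^sub>R w + b2"
    unfolding c'(3) by blast
  obtain N3 \<kappa> where N3: "open N3" "d \<in> N3" "\<kappa> > 0"
    "\<And>w. w \<in> N3 \<Longrightarrow> d' + \<kappa> *\<^sub>R (M *v (w - d)) \<in> pdom c' \<and> f (psi c w) = psi c' (d' + \<kappa> *\<^sub>R (M *v (w - d)))"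
    using aff_atE[OF f bounded_linear_matrix c'] by blast
  define h where "h = (\<lambda>w. d' + \<kappa> *\<^sub>R (M *v (w - d)))"
  define k where "k = \<nu> * \<kappa> / \<mu>"
  define N where "N = N1 \<inter> N3 \<inter> h -` N2"
  have "continuous_on UNIV h"
    unfolding h_def by (intro continuous_intros bounded_linear.continuous_on[OF bounded_linear_matrix])
  then have N: "open N" "d \<in> N" "N \<subseteq> pdom c"
    unfolding N_def using open_vimage[OF N2(1)] N1 N3 N2(2) by (auto simp: h_def)
  have k: "k > 0"
    using N1 N2 N3 by (simp add: k_def)
  define B where "B = \<nu> *\<^sub>R d' + b2 - (k *\<^sub>R M) *v (\<mu> *\<^sub>R d + b1)"
  have fN: "psi c w \<in> U1 \<and> f (psi c w) \<in> U2 \<and> \<phi>2 (f (psi c w)) = (k *\<^sub>R M) *v \<phi>1 (psi c w) + B" if w: "w \<in> N" for w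
  proof -
    have "\<phi>2 (f (psi c w)) = \<nu> *\<^sub>R h w + b2" "f (psi c w) \<in> U2"
      using w N3(4)[of w] N2(5)[of "h w"] by (auto simp: N_def h_def)
    moreover have "\<phi>1 (psi c w) = \<mu> *\<^sub>R w + b1" "psi c w \<in> U1"
      using w N1(5)[of w] by (auto simp: N_def)
    moreover have "\<nu> *\<^sub>R h w + b2 = (k *\<^sub>R M) *v (\<mu> *\<^sub>R w + b1) + B"
      using N1(4)
      by (simp add: B_def h_def k_def scaleR_matrix_mult matrix_vector_right_distrib matrix_vector_mult_scaleR
          matrix_vector_mult_diff_distrib algebra_simps)
    ultimately show ?thesis by simp
  qed
  have W: "openin disco (psi c ` N)"
    using open_psi_image[OF c(1) N(3,1)] .
  have 1: "linear_at f (U1, \<phi>1) (U2, \<phi>2) (psi c d) (k *\<^sub>R M)"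
    unfolding linear_at_def
    by (rule exI[of _ "psi c ` N"], rule exI[of _ B]) (use W N fN in auto)
  have 2: "normalise_det A = M" if lin: "linear_at f (U1, \<phi>1) (U2, \<phi>2) (psi c d) A" for A
  proof -
    obtain W' B' where W': "openin disco W'" "psi c d \<in> W'"
      "\<And>q. q \<in> W' \<Longrightarrow> \<phi>2 (f q) = A *v \<phi>1 q + B'"
      using lin unfolding linear_at_def by auto
    have "openin (top_of_set (pdom c)) {w \<in> pdom c. psi c w \<in> W'}"
      using continuous_map_psi[OF c(1)] W'(1) unfolding continuous_map_def by simp
    then have op: "open {w \<in> pdom c. psi c w \<in> W'}"
      using open_pdom[OF c(1)] openin_open_eq by blast
    let ?N = "N \<inter> {w \<in> pdom c. psi c w \<in> W'}"
    have eq: "A *v (\<mu> *\<^sub>R w + b1) + B' = (k *\<^sub>R M) *v (\<mu> *\<^sub>R w + b1) + B" if "w \<in> ?N" for w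
      using that fN[of w] W'(3)[of "psi c w"] N1(5)[of w] by (simp add: N_def)
    have "(A - k *\<^sub>R M) *v (w - d) = 0" if w: "w \<in> ?N" for w
    proof -
      have dN: "d \<in> ?N" using N W' c(2) by simp
      have "(A - k *\<^sub>R M) *v (\<mu> *\<^sub>R (w - d)) = (A - k *\<^sub>R M) *v ((\<mu> *\<^sub>R w + b1) - (\<mu> *\<^sub>R d + b1))"
        by (simp add: algebra_simps)
      also have "\<dots> = (A *v (\<mu> *\<^sub>R w + b1) + B' - ((k *\<^sub>R M) *v (\<mu> *\<^sub>R w + b1) + B))
            - (A *v (\<mu> *\<^sub>R d + b1) + B' - ((k *\<^sub>R M) *v (\<mu> *\<^sub>R d + b1) + B))"
        by (simp only: matrix_vector_mult_diff_rdistrib matrix_vector_mult_diff_distrib) simp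
      also have "\<dots> = 0"
        unfolding eq[OF w] eq[OF dN] by simp
      finally show ?thesis
        using N1(4) by (simp add: matrix_vector_mult_scaleR)
    qed
    then have "(A - k *\<^sub>R M) *v v = 0" for v
      using linear_zero_on_open[of "(*v) (A - k *\<^sub>R M)" ?N d d v] op N W' c(2) by auto
    then have "A = k *\<^sub>R M"
      by (simp add: matrix_eq matrix_vector_mult_diff_rdistrib)
    then show ?thesis
      using normalise_det_scaleR[OF det k] by simp
  qed
  show thesis
    using that k 1 2 by blast
qed

lemma affine_with_point:
  assumes "affine_with M f" "p \<in> topspace disco" "p \<notin> disco_sing"
  shows "f p \<in> topspace disco" "f p \<notin> disco_sing"
  using nonsing_image[OF _ _ assms(2,3)] assms(1) unfolding affine_with_def by auto

lemma inner_patch_in: "inner_patch \<in> patches" and side_patch_in: "side_patch \<in> patches"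
  by (simp_all add: patches_def)

lemma affine_with_rho:
  assumes f: "affine_with M f"
  shows "f \<in> carrier disco_affine" and "disco_rho f = M"
proof -
  have det: "det M = 1" and aff: "\<And>c d. c \<in> patches \<Longrightarrow> d \<in> pdom c \<Longrightarrow> aff_at ((*v) M) (\<lambda>w. f (psi c w)) d"
    using f by (auto simp: affine_with_def)
  have key: "(\<exists>k>0. linear_at f c1 c2 p (k *\<^sub>R M)) \<and> (\<forall>A. linear_at f c1 c2 p A \<longrightarrow> normalise_det A = M)"
    if "c1 \<in> disco_atlas" "c2 \<in> disco_atlas" "p \<in> fst c1" "f p \<in> fst c2" for c1 c2 p
  proof -
    obtain U1 \<phi>1 U2 \<phi>2 where eq: "c1 = (U1, \<phi>1)" "c2 = (U2, \<phi>2)"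
      by (metis surj_pair)
    have at: "(U1, \<phi>1) \<in> disco_atlas" "(U2, \<phi>2) \<in> disco_atlas" and p: "p \<in> U1" "f p \<in> U2"
      using that eq by auto
    obtain c d where c: "c \<in> patches" "d \<in> pdom c" "p = psi c d"
      using atlas_point[OF at(1) p(1)] by blast
    show ?thesis
      using aff_at_imp_linear_at[OF at c(1,2) _ _ aff[OF c(1,2)] det] p unfolding eq c(3) by metis
  qed
  have "\<exists>A. det A > 0 \<and> linear_at f c1 c2 p A"
    if at: "c1 \<in> disco_atlas" "c2 \<in> disco_atlas" "p \<in> fst c1" "f p \<in> fst c2" for c1 c2 p
  proof -
    obtain k where "k > 0" "linear_at f c1 c2 p (k *\<^sub>R M)"
      using key[OF at] by blast
    then show ?thesis
      by (intro exI[of _ "k *\<^sub>R M"]) (simp add: det_scaleR_2 det)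
  qed
  then show "f \<in> carrier disco_affine"
    using f by (simp add: disco_affine_def affine_with_def)
  show "disco_rho f = M"
    unfolding disco_rho_def
  proof (rule the_equality)
    show "\<forall>c\<in>disco_atlas. \<forall>c'\<in>disco_atlas. \<forall>p\<in>fst c. \<forall>A. f p \<in> fst c' \<longrightarrow> linear_at f c c' p A \<longrightarrow> normalise_det A = M"
      using key by blast
  next
    fix M' assume M': "\<forall>c\<in>disco_atlas. \<forall>c'\<in>disco_atlas. \<forall>p\<in>fst c. \<forall>A. f p \<in> fst c' \<longrightarrow> linear_at f c c' p A \<longrightarrow> normalise_det A = M'"
    \<comment> \<open>One actual pair of charts is required here: the condition on \<open>M'\<close>
      is universally quantified and says nothing until it is instantiated.\<close>
    have d: "pt 1 (1/2) \<in> pdom inner_patch"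
      by (simp add: inner_patch_simps mem_box_pt)
    define p where "p = psi inner_patch (pt 1 (1/2))"
    have "f p \<in> topspace disco" "f p \<notin> disco_sing"
      using affine_with_point[OF f] psi_in_topspace[OF inner_patch_in d] psi_notin_sing[OF inner_patch_in d]
      by (auto simp: p_def)
    then obtain c' d' where c': "c' \<in> patches" "d' \<in> pdom c'" "f p = psi c' d'"
      by (rule patches_cover)
    have "pchart inner_patch \<in> disco_atlas" "pchart c' \<in> disco_atlas" "p \<in> fst (pchart inner_patch)" "f p \<in> fst (pchart c')"
      using pchart_in_atlas inner_patch_in c' d by (auto simp: pchart_def p_def)
    then show "M' = M"
      using M' key by metis
  qed
qed

lemma aff_at_transfer:
  assumes f: "aff_at ((*v) M) (\<lambda>w. f (psi c w)) d" and c: "c \<in> patches" "d \<in> pdom c"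
    and c': "c' \<in> patches" "d' \<in> pdom c'" "psi c d = psi c' d'"
  shows "aff_at ((*v) M) (\<lambda>w. f (psi c' w)) d'"
  using aff_at_psi_of_immersion[OF aff_at_psi[OF c] f bounded_linear_matrix c'] .

lemma patch_meets_inner:
  assumes "c \<in> patches"
  obtains w where "w \<in> pdom c" "w \<in> pdom inner_patch" "psi c w = psi inner_patch w"
proof -
  have "\<exists>w. w \<in> pdom c \<and> w \<in> pdom inner_patch"
    using assms
  proof (cases rule: patches_cases)
    case (3 lo hi a b)
    then show ?thesis
      using edges_bounds[OF 3(1)]
      by (intro exI[of _ "pt ((lo + hi) / 2) (1/2)"])
        (auto simp: edge_patch_simps inner_patch_simps mem_box_pt field_simps)
  next
    case 1
    then show ?thesis by (intro exI[of _ "pt 4 (1/2)"]) (simp add: inner_patch_simps mem_box_pt)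
  next
    case 2
    then show ?thesis by (intro exI[of _ "pt 4 (1/2)"]) (simp add: inner_patch_simps side_patch_simps mem_box_pt)
  qed
  then obtain w where "w \<in> pdom c" "w \<in> pdom inner_patch" by blast
  moreover from this have "w \<in> disco_rect"
    by (simp add: inner_patch_simps mem_box_pt mem_disco_rect)
  ultimately show thesis
    using that by (simp add: psi_def)
qed

text \<open>Membership in the affine group allows a different matrix at each point. The normalised
  one is locally constant, hence constant on each connected patch, and every patch meets the inner
  one.\<close>

lemma carrier_affine_with:
  assumes f: "f \<in> carrier disco_affine"
  obtains M where "affine_with M f"
proof -
  have bij: "f \<in> Bij (topspace disco)" and hom: "homeomorphic_map disco disco f"
    and sing: "f ` disco_sing = disco_sing"
    and lin: "\<And>c c' p. c \<in> disco_atlas \<Longrightarrow> c' \<in> disco_atlas \<Longrightarrow> p \<in> fst c \<Longrightarrow> f p \<in> fst c' \<Longrightarrow>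
      \<exists>A. det A > 0 \<and> linear_at f c c' p A"
    using f by (auto simp: disco_affine_def)
  have ex: "\<exists>M. det M = 1 \<and> aff_at ((*v) M) (\<lambda>w. f (psi c w)) d" if c: "c \<in> patches" "d \<in> pdom c" for c d
  proof -
    have "f (psi c d) \<in> topspace disco" "f (psi c d) \<notin> disco_sing"
      using nonsing_image[OF bij sing psi_in_topspace[OF c] psi_notin_sing[OF c]] .
    then obtain c' d' where c': "c' \<in> patches" "d' \<in> pdom c'" "f (psi c d) = psi c' d'"
      by (rule patches_cover)
    have m: "pchart c \<in> disco_atlas" "pchart c' \<in> disco_atlas" "psi c d \<in> fst (pchart c)" "f (psi c d) \<in> fst (pchart c')"
      using pchart_in_atlas c c' by (auto simp: pchart_def)
    then obtain A where A: "det A > 0" "linear_at f (pchart c) (pchart c') (psi c d) A"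
      using lin by blast
    have "aff_at ((*v) (normalise_det A)) (\<lambda>w. f (psi c w)) d"
      using linear_at_imp_aff_at[of "fst (pchart c)" "snd (pchart c)" "fst (pchart c')" "snd (pchart c')" c d f A]
        m c A by simp
    then show ?thesis
      using det_normalise_det[OF A(1)] by blast
  qed
  let ?P = "\<lambda>M c d. aff_at ((*v) M) (\<lambda>w. f (psi c w)) d"
  have const: "?P M c d'" if c: "c \<in> patches" "d \<in> pdom c" "d' \<in> pdom c" and M: "det M = 1" "?P M c d" for M c d d'
  proof (rule ccontr)
    assume n: "\<not> ?P M c d'"
    define E where "E = {w \<in> pdom c. ?P M c w}"
    have nearby: "\<exists>T. open T \<and> w \<in> T \<and> T \<subseteq> pdom c \<and> (\<forall>v\<in>T. ?P M' c v)" if w: "w \<in> pdom c" "?P M' c w" for w M'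
    proof -
      obtain N where "open N" "w \<in> N" "\<And>v. v \<in> N \<Longrightarrow> ?P M' c v"
        using aff_at_nearby[OF w(2)] by blast
      then show ?thesis
        using open_pdom[OF c(1)] w(1) by (intro exI[of _ "N \<inter> pdom c"]) auto
    qed
    have "open E"
    proof (subst open_subopen, intro ballI)
      fix w assume "w \<in> E"
      then obtain T where "open T" "w \<in> T" "T \<subseteq> pdom c" "\<forall>v\<in>T. ?P M c v"
        using nearby[of w M] by (auto simp: E_def)
      then show "\<exists>T. open T \<and> w \<in> T \<and> T \<subseteq> E"
        unfolding E_def by (intro exI[of _ T]) blast
    qed
    moreover have "open (pdom c - E)"
    proof (subst open_subopen, intro ballI)
      fix w assume w: "w \<in> pdom c - E"
      then obtain M' where M': "det M' = 1" "?P M' c w"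
        using ex[OF c(1), of w] by blast
      then have "M' \<noteq> M"
        using w by (auto simp: E_def)
      obtain T where T: "open T" "w \<in> T" "T \<subseteq> pdom c" "\<forall>v\<in>T. ?P M' c v"
        using nearby[of w M'] w M'(2) by blast
      have "v \<notin> E" if "v \<in> T" for v
        using aff_at_unique[OF _ _ M'(1) M(1), of "\<lambda>w. f (psi c w)" v] T(4) that \<open>M' \<noteq> M\<close>
        by (auto simp: E_def)
      then show "\<exists>S. open S \<and> w \<in> S \<and> S \<subseteq> pdom c - E"
        using T by (intro exI[of _ T]) blast
    qed
    moreover have "d \<in> E" "d' \<in> pdom c - E"
      using c M n by (auto simp: E_def)
    ultimately show False
      using connectedD[OF convex_connected[OF convex_pdom[OF c(1)]], of E "pdom c - E"] c by blast
  qed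
  have d0: "pt 1 (1/2) \<in> pdom inner_patch"
    by (simp add: inner_patch_simps mem_box_pt)
  obtain M where M: "det M = 1" "?P M inner_patch (pt 1 (1/2))"
    using ex[OF inner_patch_in d0] by blast
  have "?P M c d" if c: "c \<in> patches" "d \<in> pdom c" for c d
  proof -
    obtain w where w: "w \<in> pdom c" "w \<in> pdom inner_patch" "psi c w = psi inner_patch w"
      using patch_meets_inner[OF c(1)] by blast
    have "?P M inner_patch w"
      using const[OF inner_patch_in d0 w(2) M] .
    then have "?P M c w"
      using aff_at_transfer[OF _ inner_patch_in w(2) c(1) w(1)] w(3) by simp
    then show ?thesis
      using const[OF c(1) w(1) c(2) M(1)] by blast
  qed
  then have "affine_with M f"
    using bij hom sing M(1) by (simp add: affine_with_def)
  then show thesis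
    by (rule that)
qed

lemma disco_Veech_eq: "disco_Veech = {M. \<exists>f. affine_with M f}"
  unfolding disco_Veech_def using affine_with_rho carrier_affine_with by (auto simp: image_iff) metis+

lemma affine_with_compose:
  assumes f: "affine_with M f" and g: "affine_with T g"
  shows "affine_with (T ** M) (compose (topspace disco) g f)"
proof -
  let ?h = "compose (topspace disco) g f"
  have f': "f \<in> Bij (topspace disco)" "homeomorphic_map disco disco f" "f ` disco_sing = disco_sing" "det M = 1"
    and g': "g \<in> Bij (topspace disco)" "homeomorphic_map disco disco g" "g ` disco_sing = disco_sing" "det T = 1"
    using f g by (auto simp: affine_with_def)
  have "homeomorphic_map disco disco (g \<circ> f)"
    using homeomorphic_map_compose f'(2) g'(2) by blast
  then have "homeomorphic_map disco disco ?h"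
    by (rule homeomorphic_map_eq) (simp add: compose_def)
  moreover have "?h ` disco_sing = disco_sing"
  proof -
    have "?h ` disco_sing = (g \<circ> f) ` disco_sing"
      using disco_sing_subset by (intro image_cong) (auto simp: compose_def)
    also have "\<dots> = g ` f ` disco_sing"
      by (simp only: image_comp)
    finally show ?thesis
      using f'(3) g'(3) by simp
  qed
  moreover have "aff_at ((*v) (T ** M)) (\<lambda>w. ?h (psi c w)) d" if c: "c \<in> patches" "d \<in> pdom c" for c d
  proof -
    have K: "aff_at ((*v) M) (\<lambda>w. f (psi c w)) d"
      using f c by (simp add: affine_with_def)
    obtain c' d' where c': "c' \<in> patches" "d' \<in> pdom c'" "f (psi c d) = psi c' d'"
      using patches_cover affine_with_point[OF f psi_in_topspace[OF c] psi_notin_sing[OF c]] by blast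
    have "aff_at (\<lambda>w. T *v (M *v w)) (\<lambda>w. g (f (psi c w))) d"
      using aff_at_compose[OF K bounded_linear_matrix c' _ bounded_linear_matrix] g c' by (simp add: affine_with_def)
    then have "aff_at ((*v) (T ** M)) (\<lambda>w. g (f (psi c w))) d"
      by (simp add: matrix_vector_mul_assoc)
    then show ?thesis
      by (rule aff_at_cong[OF _ open_pdom[OF c(1)] c(2)]) (simp add: compose_def psi_in_topspace[OF c(1)])
  qed
  moreover have "det (T ** M) = 1"
    using f'(4) g'(4) by (simp add: det_mul)
  ultimately show ?thesis
    using compose_Bij[OF g'(1) f'(1)] unfolding affine_with_def by blast
qed

section \<open>The horizontal cylinder\<close>

lemma continuous_map_disco_proj_comp:
  assumes "continuous_on T h" "h ` T \<subseteq> disco_rect"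
  shows "continuous_map (top_of_set T) disco (\<lambda>z. disco_proj (h z))"
proof -
  have "continuous_map (top_of_set T) (top_of_set disco_rect) h"
    using assms by auto
  from continuous_map_compose[OF this continuous_map_disco_proj] show ?thesis
    by (simp add: o_def)
qed

text \<open>Pasting along a locally finite cover by closed slabs of width \<open>p\<close>. It
  serves both coverings \<open>cyl\<close> and \<open>vcyl\<close>, whose formulas change at
  multiples of the period.\<close>

lemma continuous_map_slabs:
  fixes G :: "real ^ 2 \<Rightarrow> (real ^ 2) set"
  assumes "p > 0"
    and G: "\<And>k::int. continuous_map (top_of_set (A \<inter> {z. p * real_of_int k \<le> z $ i \<and> z $ i \<le> p * (real_of_int k + 1)})) disco G"
  shows "continuous_map (top_of_set A) disco G"
proof (rule pasting_lemma_locally_finite[where I = "UNIV :: int set" and f = "\<lambda>_. G"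
      and T = "\<lambda>k. A \<inter> {z. p * real_of_int k \<le> z $ i \<and> z $ i \<le> p * (real_of_int k + 1)}"])
  fix z assume "z \<in> topspace (top_of_set A)"
  then have z: "z \<in> A" by simp
  let ?V = "A \<inter> ball z p"
  have "{k::int. A \<inter> {w. p * real_of_int k \<le> w $ i \<and> w $ i \<le> p * (real_of_int k + 1)} \<inter> ?V \<noteq> {}} \<subseteq> {\<lfloor>z $ i / p\<rfloor> - 2 .. \<lfloor>z $ i / p\<rfloor> + 2}"
  proof
    fix k :: int assume "k \<in> {k::int. A \<inter> {w. p * real_of_int k \<le> w $ i \<and> w $ i \<le> p * (real_of_int k + 1)} \<inter> ?V \<noteq> {}}"
    then obtain w where w: "p * real_of_int k \<le> w $ i" "w $ i \<le> p * (real_of_int k + 1)" "dist z w < p"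
      by auto
    have "\<bar>z $ i - w $ i\<bar> < p"
      using component_le_norm_cart[of "z - w" i] w(3) by (simp add: dist_norm)
    then have "p * (real_of_int k - 1) < z $ i" "z $ i < p * (real_of_int k + 2)"
      using w(1,2) by (simp_all add: algebra_simps abs_less_iff)
    then have "real_of_int k - 1 < z $ i / p" "z $ i / p < real_of_int k + 2"
      using \<open>p > 0\<close> by (simp_all add: field_simps)
    then show "k \<in> {\<lfloor>z $ i / p\<rfloor> - 2 .. \<lfloor>z $ i / p\<rfloor> + 2}"
      unfolding atLeastAtMost_iff by linarith
  qed
  then have "finite {k \<in> UNIV. A \<inter> {w. p * real_of_int k \<le> w $ i \<and> w $ i \<le> p * (real_of_int k + 1)} \<inter> ?V \<noteq> {}}"
    using finite_subset by fastforce
  moreover have "openin (top_of_set A) ?V" "z \<in> ?V"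
    using z \<open>p > 0\<close> by auto
  ultimately show "\<exists>V. openin (top_of_set A) V \<and> z \<in> V \<and>
      finite {k \<in> UNIV. A \<inter> {w. p * real_of_int k \<le> w $ i \<and> w $ i \<le> p * (real_of_int k + 1)} \<inter> V \<noteq> {}}"
    by blast
next
  fix k :: int
  have "closed {z :: real ^ 2. p * real_of_int k \<le> z $ i \<and> z $ i \<le> p * (real_of_int k + 1)}"
    by (intro closed_Collect_conj closed_Collect_le continuous_intros)
  then show "closedin (top_of_set A) (A \<inter> {z. p * real_of_int k \<le> z $ i \<and> z $ i \<le> p * (real_of_int k + 1)})"
    by (rule closedin_closed_Int)
  show "continuous_map (subtopology (top_of_set A) (A \<inter> {z. p * real_of_int k \<le> z $ i \<and> z $ i \<le> p * (real_of_int k + 1)})) disco G"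
    using G[of k] by (simp add: subtopology_subtopology Int_absorb1 inf_assoc[symmetric])
next
  fix z assume "z \<in> topspace (top_of_set A)"
  then have z: "z \<in> A" by simp
  let ?k = "\<lfloor>z $ i / p\<rfloor>"
  have "real_of_int ?k \<le> z $ i / p" "z $ i / p \<le> real_of_int ?k + 1"
    by linarith+
  then have "p * real_of_int ?k \<le> z $ i" "z $ i \<le> p * (real_of_int ?k + 1)"
    using mult_left_mono[of "real_of_int ?k" "z $ i / p" p] mult_left_mono[of "z $ i / p" "real_of_int ?k + 1" p] \<open>p > 0\<close>
    by simp_all
  then show "\<exists>k. k \<in> UNIV \<and> z \<in> A \<inter> {z. p * real_of_int k \<le> z $ i \<and> z $ i \<le> p * (real_of_int k + 1)} \<and> G z = G z"
    using z by blast
qed simp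

text \<open>The covering of the horizontal cylinder by the strip \<open>0 \<le> y \<le> 1\<close>.\<close>

definition cyl :: "real ^ 2 \<Rightarrow> (real ^ 2) set" where
  "cyl z = disco_proj (pt (z $ 1 - 6 * real_of_int \<lfloor>z $ 1 / 6\<rfloor>) (z $ 2))"

lemma disco_proj_glue: "disco_glue z w \<Longrightarrow> disco_proj z = disco_proj w"
  using disco_glue_rep disco_proj_eq_iff[of z w] by (auto simp: disco_glue_iff mem_disco_rect)

text \<open>At the right end of the slab the floor jumps, and the gluing of the vertical sides
  restores the formula. The closed slab is what pasting requires.\<close>

lemma cyl_eq:
  assumes "6 * real_of_int k \<le> z $ 1" "z $ 1 \<le> 6 * (real_of_int k + 1)" "0 \<le> z $ 2" "z $ 2 \<le> 1"
  shows "cyl z = disco_proj (pt (z $ 1 - 6 * real_of_int k) (z $ 2))"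
proof (cases "z $ 1 = 6 * (real_of_int k + 1)")
  case True
  then have "z $ 1 / 6 = real_of_int (k + 1)"
    by (simp add: field_simps)
  then have "\<lfloor>z $ 1 / 6\<rfloor> = k + 1"
    by (simp only: floor_of_int)
  then have "cyl z = disco_proj (pt 0 (z $ 2))"
    using True by (simp add: cyl_def)
  also have "\<dots> = disco_proj (pt 6 (z $ 2))"
    using assms by (intro disco_proj_glue) (simp add: disco_glue_iff)
  finally show ?thesis
    using True by simp
next
  case False
  then have "\<lfloor>z $ 1 / 6\<rfloor> = k"
    using assms by (intro floor_unique) auto
  then show ?thesis
    by (simp add: cyl_def)
qed

lemma cyl_rect: "z \<in> disco_rect \<Longrightarrow> cyl z = disco_proj z"
  using cyl_eq[of 0 z] by (simp add: mem_disco_rect)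

lemma cyl_periodic: "cyl (pt (x + 6 * real_of_int k) y) = cyl (pt x y)"
proof -
  have "\<lfloor>(x + 6 * real_of_int k) / 6\<rfloor> = \<lfloor>x / 6\<rfloor> + k"
    by (simp add: add_divide_distrib)
  then show ?thesis
    by (simp add: cyl_def algebra_simps)
qed

lemma cyl_reduce:
  obtains k :: int where "6 * real_of_int k \<le> z $ 1" "z $ 1 < 6 * (real_of_int k + 1)"
proof (rule that[of "\<lfloor>z $ 1 / 6\<rfloor>"])
  have "real_of_int \<lfloor>z $ 1 / 6\<rfloor> \<le> z $ 1 / 6" "z $ 1 / 6 < real_of_int \<lfloor>z $ 1 / 6\<rfloor> + 1"
    by linarith+
  then show "6 * real_of_int \<lfloor>z $ 1 / 6\<rfloor> \<le> z $ 1" "z $ 1 < 6 * (real_of_int \<lfloor>z $ 1 / 6\<rfloor> + 1)"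
    by (simp_all add: field_simps)
qed

lemma continuous_map_cyl: "continuous_map (top_of_set {z. 0 \<le> z $ 2 \<and> z $ 2 \<le> 1}) disco cyl"
proof (rule continuous_map_slabs[of 6 _ 1])
  fix k :: int
  let ?T = "{z :: real ^ 2. 0 \<le> z $ 2 \<and> z $ 2 \<le> 1} \<inter> {z. 6 * real_of_int k \<le> z $ 1 \<and> z $ 1 \<le> 6 * (real_of_int k + 1)}"
  have "continuous_map (top_of_set ?T) disco (\<lambda>z. disco_proj (z - pt (6 * real_of_int k) 0))"
    by (rule continuous_map_disco_proj_comp) (auto intro!: continuous_intros simp: mem_disco_rect)
  then show "continuous_map (top_of_set ?T) disco cyl"
  proof (rule continuous_map_eq)
    fix z assume "z \<in> topspace (top_of_set ?T)"
    moreover have "z - pt (6 * real_of_int k) 0 = pt (z $ 1 - 6 * real_of_int k) (z $ 2)"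
      by (simp add: eq_2_iff)
    ultimately show "disco_proj (z - pt (6 * real_of_int k) 0) = cyl z"
      using cyl_eq[of k z] by auto
  qed
qed simp

lemma aff_at_cyl:
  assumes "0 < z $ 2" "z $ 2 < 1"
  shows "aff_at (\<lambda>w. w) cyl z"
proof -
  obtain k :: int where k: "6 * real_of_int k \<le> z $ 1" "z $ 1 < 6 * (real_of_int k + 1)"
    by (rule cyl_reduce)
  show ?thesis
  proof (cases "z $ 1 = 6 * real_of_int k")
    case False
    have op: "open {w :: real ^ 2. w + pt (- 6 * real_of_int k) 0 \<in> pdom inner_patch}"
      using open_vimage[OF open_pdom[OF inner_patch_in], of "\<lambda>w. w + pt (- 6 * real_of_int k) 0"]
      by (simp add: vimage_def continuous_intros)
    show ?thesis
    proof (rule aff_atI[OF inner_patch_in op, of _ 1 _ "pt (- 6 * real_of_int k) 0"])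
      show "z \<in> {w. w + pt (- 6 * real_of_int k) 0 \<in> pdom inner_patch}"
        using k False assms by (auto simp: inner_patch_simps mem_box_pt)
      fix w assume "w \<in> {w :: real ^ 2. w + pt (- 6 * real_of_int k) 0 \<in> pdom inner_patch}"
      then have w: "0 < w $ 1 - 6 * real_of_int k" "w $ 1 - 6 * real_of_int k < 6" "0 < w $ 2" "w $ 2 < 1"
        by (auto simp: inner_patch_simps mem_box_pt)
      have "w + pt (- 6 * real_of_int k) 0 = pt (w $ 1 - 6 * real_of_int k) (w $ 2)"
        by (simp add: eq_2_iff)
      then show "1 *\<^sub>R w + pt (- 6 * real_of_int k) 0 \<in> pdom inner_patch \<and> cyl w = psi inner_patch (1 *\<^sub>R w + pt (- 6 * real_of_int k) 0)"
        using w cyl_eq[of k w] by (simp add: psi_def inner_patch_simps mem_box_pt mem_disco_rect)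
    qed simp
  next
    case True
    \<comment> \<open>The shift moves the vertical seam at \<open>6 k\<close> to abscissa 6, the
      seam of the side patch.\<close>
    let ?b = "pt (6 - 6 * real_of_int k) 0"
    have op: "open {w :: real ^ 2. w + ?b \<in> pdom side_patch}"
      using open_vimage[OF open_pdom[OF side_patch_in], of "\<lambda>w. w + ?b"]
      by (simp add: vimage_def continuous_intros)
    show ?thesis
    proof (rule aff_atI[OF side_patch_in op, of _ 1 _ ?b])
      show "z \<in> {w. w + ?b \<in> pdom side_patch}"
        using True assms by (auto simp: side_patch_simps mem_box_pt)
      fix w assume m: "w \<in> {w :: real ^ 2. w + ?b \<in> pdom side_patch}"
      then have w: "- 3 < w $ 1 - 6 * real_of_int k" "w $ 1 - 6 * real_of_int k < 3" "0 < w $ 2" "w $ 2 < 1"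
        by (auto simp: side_patch_simps mem_box_pt)
      have wb: "w + ?b = pt (w $ 1 - 6 * real_of_int k + 6) (w $ 2)"
        by (simp add: eq_2_iff)
      have "cyl w = psi side_patch (w + ?b)"
      proof (cases "w $ 1 \<le> 6 * real_of_int k")
        case True
        then have "cyl w = disco_proj (pt (w $ 1 - 6 * real_of_int k + 6) (w $ 2))"
          using w cyl_eq[of "k - 1" w] by (simp add: algebra_simps)
        then show ?thesis
          unfolding wb using w True by (simp add: psi_def mem_disco_rect)
      next
        case False
        then show ?thesis
          unfolding wb using w cyl_eq[of k w] by (simp add: psi_def mem_disco_rect side_patch_simps)
      qed
      then show "1 *\<^sub>R w + ?b \<in> pdom side_patch \<and> cyl w = psi side_patch (1 *\<^sub>R w + ?b)"
        using m by simp
    qed simp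
  qed
qed

lemma cyl_in_sing_iff:
  assumes "0 \<le> z $ 2" "z $ 2 \<le> 1"
  shows "cyl z \<in> disco_sing \<longleftrightarrow> (z $ 2 = 0 \<or> z $ 2 = 1) \<and> (\<exists>k::int. z $ 1 - 6 * real_of_int k \<in> {0, 1, 3, 5})"
proof -
  obtain k :: int where k: "6 * real_of_int k \<le> z $ 1" "z $ 1 < 6 * (real_of_int k + 1)"
    by (rule cyl_reduce)
  have "cyl z \<in> disco_sing \<longleftrightarrow> vertex (pt (z $ 1 - 6 * real_of_int k) (z $ 2))"
    using k assms cyl_eq[of k z] by (simp add: disco_proj_in_sing_iff mem_disco_rect)
  also have "\<dots> \<longleftrightarrow> (z $ 2 = 0 \<or> z $ 2 = 1) \<and> z $ 1 - 6 * real_of_int k \<in> {0, 1, 3, 5}"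
    using k by (auto simp: vertex_def)
  also have "z $ 1 - 6 * real_of_int k \<in> {0, 1, 3, 5} \<longleftrightarrow> (\<exists>k::int. z $ 1 - 6 * real_of_int k \<in> {0, 1, 3, 5})"
  proof
    assume "\<exists>k::int. z $ 1 - 6 * real_of_int k \<in> {0, 1, 3, 5}"
    then obtain k' :: int where k': "z $ 1 - 6 * real_of_int k' \<in> {0, 1, 3, 5}" by blast
    then have "0 \<le> z $ 1 - 6 * real_of_int k'" "z $ 1 - 6 * real_of_int k' < 6" by auto
    then have "real_of_int (k - k') < 1" "real_of_int (k' - k) < 1"
      using k by auto
    then have "k = k'" by linarith
    with k' show "z $ 1 - 6 * real_of_int k \<in> {0, 1, 3, 5}" by simp
  qed blast
  finally show ?thesis .
qed

text \<open>Interior points are their own representatives up to the gluing of the vertical sides. As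
  \<open>w\<close> may lie on the boundary, this also says that interior levels never meet the
  boundary levels.\<close>

lemma cyl_eq_iff:
  assumes "0 < z $ 2" "z $ 2 < 1" "0 \<le> w $ 2" "w $ 2 \<le> 1"
  shows "cyl z = cyl w \<longleftrightarrow> z $ 2 = w $ 2 \<and> (\<exists>k::int. w $ 1 = z $ 1 + 6 * real_of_int k)"
proof
  assume eq: "cyl z = cyl w"
  obtain k :: int where k: "6 * real_of_int k \<le> z $ 1" "z $ 1 < 6 * (real_of_int k + 1)"
    by (rule cyl_reduce)
  obtain l :: int where l: "6 * real_of_int l \<le> w $ 1" "w $ 1 < 6 * (real_of_int l + 1)"
    by (rule cyl_reduce)
  let ?z = "pt (z $ 1 - 6 * real_of_int k) (z $ 2)" and ?w = "pt (w $ 1 - 6 * real_of_int l) (w $ 2)"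
  have r: "?z \<in> disco_rect" "?w \<in> disco_rect"
    using k l assms by (auto simp: mem_disco_rect)
  have "disco_proj ?z = disco_proj ?w"
    using eq k l assms cyl_eq[of k z] cyl_eq[of l w] by simp
  then have "rep ?w = rep ?z"
    using r disco_proj_eq_iff by metis
  also have "rep ?z = ?z"
    using assms k by (intro rep_eqI_interior) auto
  finally have "?w = ?z"
    using rep_interior_iff[OF r(2) assms(1,2)] l by (auto simp: eq_2_iff)
  then have "z $ 2 = w $ 2" "w $ 1 = z $ 1 + 6 * real_of_int (l - k)"
    by (simp_all add: eq_2_iff)
  then show "z $ 2 = w $ 2 \<and> (\<exists>k::int. w $ 1 = z $ 1 + 6 * real_of_int k)"
    by blast
next
  assume "z $ 2 = w $ 2 \<and> (\<exists>k::int. w $ 1 = z $ 1 + 6 * real_of_int k)"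
  then obtain k :: int where "w = pt (z $ 1 + 6 * real_of_int k) (z $ 2)"
    by (auto simp: eq_2_iff)
  then show "cyl z = cyl w"
    using cyl_periodic[of "z $ 1" k "z $ 2"] by simp
qed

section \<open>Affine maps induced from the rectangle\<close>

text \<open>The choice of a representative is harmless for a gluing invariant \<open>F\<close>;
  \<open>restrict\<close> makes the map extensional, as \<open>Bij\<close> demands.\<close>

definition induced :: "(real ^ 2 \<Rightarrow> (real ^ 2) set) \<Rightarrow> (real ^ 2) set \<Rightarrow> (real ^ 2) set" where
  "induced F = restrict (\<lambda>p. F (SOME z. z \<in> disco_rect \<and> disco_proj z = p)) (topspace disco)"

definition glue_invariant :: "(real ^ 2 \<Rightarrow> (real ^ 2) set) \<Rightarrow> bool" where
  "glue_invariant F \<longleftrightarrow> (\<forall>z w. disco_glue z w \<longrightarrow> F z = F w)"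

lemma glue_invariant_proj:
  assumes "glue_invariant F" "z \<in> disco_rect" "w \<in> disco_rect" "disco_proj z = disco_proj w"
  shows "F z = F w"
proof -
  have *: "F z = F w" if "equivclp disco_glue z w" for z w
    using that assms(1) by (induction rule: equivclp_induct) (auto simp: glue_invariant_def)
  have "rep z = rep w"
    using assms disco_proj_eq_iff by blast
  then show ?thesis
    using *[OF equivclp_disco_glue_rep[OF assms(2)]] *[OF equivclp_disco_glue_rep[OF assms(3)]] by simp
qed

lemma induced_proj:
  assumes "glue_invariant F" "z \<in> disco_rect"
  shows "induced F (disco_proj z) = F z"
proof -
  let ?w = "SOME w. w \<in> disco_rect \<and> disco_proj w = disco_proj z"
  have "?w \<in> disco_rect \<and> disco_proj ?w = disco_proj z"
    by (rule someI[of _ z]) (use assms in simp)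
  then have "F ?w = F z"
    using glue_invariant_proj[OF assms(1)] assms(2) by blast
  then show ?thesis
    using assms(2) by (simp add: induced_def topspace_disco_eq)
qed

lemma continuous_map_induced:
  assumes "glue_invariant F" "continuous_map (top_of_set disco_rect) disco F"
  shows "continuous_map disco disco (induced F)"
proof (rule continuous_compose_quotient_map[OF quotient_map_disco_proj])
  show "continuous_map (top_of_set disco_rect) disco (induced F \<circ> disco_proj)"
    using assms(2) by (rule continuous_map_eq) (simp add: induced_proj[OF assms(1)])
qed

text \<open>The inverse comes from a second map \<open>G\<close> on the rectangle, so no bijectivity
  argument is needed. In \<open>loc\<close> the parametrisation \<open>K\<close> may vary with the
  point, which lets each map be checked where it looks simplest.\<close>

lemma affine_with_induced:
  assumes F: "glue_invariant F" "continuous_map (top_of_set disco_rect) disco F"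
    and G: "glue_invariant G" "continuous_map (top_of_set disco_rect) disco G"
    and inv: "\<And>z. z \<in> disco_rect \<Longrightarrow> induced G (F z) = disco_proj z" "\<And>z. z \<in> disco_rect \<Longrightarrow> induced F (G z) = disco_proj z"
    and sing: "\<And>z. vertex z \<Longrightarrow> F z \<in> disco_sing" "\<And>z. vertex z \<Longrightarrow> G z \<in> disco_sing"
    and det: "det M = 1"
    and loc: "\<And>p. p \<in> topspace disco \<Longrightarrow> p \<notin> disco_sing \<Longrightarrow>
      \<exists>K z. aff_at (\<lambda>w. w) K z \<and> K z = p \<and> aff_at ((*v) M) (\<lambda>w. induced F (K w)) z"
  shows "affine_with M (induced F)"
proof -
  let ?f = "induced F" and ?g = "induced G"
  have cont: "continuous_map disco disco ?f" "continuous_map disco disco ?g"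
    using continuous_map_induced F G by auto
  have gf: "?g (?f p) = p" "?f (?g p) = p" if "p \<in> topspace disco" for p
    using that inv by (auto simp: topspace_disco_eq induced_proj[OF F(1)] induced_proj[OF G(1)])
  have hom: "homeomorphic_maps disco disco ?f ?g"
    using cont gf by (simp add: homeomorphic_maps_def)
  then have h: "homeomorphic_map disco disco ?f"
    using homeomorphic_maps_map by blast
  have "bij_betw ?f (topspace disco) (topspace disco)"
    using h by (simp add: homeomorphic_eq_everything_map bij_betw_def)
  then have bij: "?f \<in> Bij (topspace disco)"
    by (simp add: Bij_def induced_def)
  have fS: "?f p \<in> disco_sing" "?g p \<in> disco_sing" if "p \<in> disco_sing" for p
    using that sing by (auto simp: disco_sing_eq induced_proj[OF F(1)] induced_proj[OF G(1)] vertex_imp_rect)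
  have "?f ` disco_sing = disco_sing"
  proof (intro equalityI subsetI)
    fix p assume "p \<in> disco_sing"
    then show "p \<in> ?f ` disco_sing"
      using fS(2) gf(2)[of p] disco_sing_subset by (intro image_eqI[of _ _ "?g p"]) auto
  qed (use fS in auto)
  moreover have "aff_at ((*v) M) (\<lambda>w. ?f (psi c w)) d" if c: "c \<in> patches" "d \<in> pdom c" for c d
  proof -
    obtain K z where "aff_at (\<lambda>w. w) K z" "K z = psi c d" "aff_at ((*v) M) (\<lambda>w. ?f (K w)) z"
      using loc[OF psi_in_topspace[OF c] psi_notin_sing[OF c]] by blast
    then show ?thesis
      using aff_at_psi_of_immersion[of K z "(*v) M" ?f c d] bounded_linear_matrix c by blast
  qed
  ultimately show ?thesis
    using bij h det unfolding affine_with_def by blast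
qed

lemma mat2_mult:
  "(vector [vector [a, b], vector [c, d]] :: real ^ 2 ^ 2) *v w = pt (a * w $ 1 + b * w $ 2) (c * w $ 1 + d * w $ 2)"
  by (simp add: eq_2_iff matrix_vector_mult_def sum_2 vector_2)

lemma det_mat2: "det (vector [vector [a, b], vector [c, d]] :: real ^ 2 ^ 2) = a * d - b * c"
  by (simp add: det_2 vector_2)

section \<open>The rotation by a half turn and the horizontal twists\<close>

abbreviation neg_id :: "real ^ 2 ^ 2" where
  "neg_id \<equiv> vector [vector [-1, 0], vector [0, -1]]"

abbreviation shear_h :: "int \<Rightarrow> real ^ 2 ^ 2" where
  "shear_h s \<equiv> vector [vector [1, 6 * real_of_int s], vector [0, 1]]"

abbreviation shear_v :: "int \<Rightarrow> real ^ 2 ^ 2" where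
  "shear_v s \<equiv> vector [vector [1, 0], vector [3 / 2 * real_of_int s, 1]]"

definition rot :: "(real ^ 2) set \<Rightarrow> (real ^ 2) set" where
  "rot = induced (\<lambda>z. disco_proj (pt (6 - z $ 1) (1 - z $ 2)))"

text \<open>The half turn about \<open>(3, 1/2)\<close> exchanges top and bottom as well as left and
  right, and turns each gluing into the inverse of another one.\<close>

lemma glue_invariant_rot: "glue_invariant (\<lambda>z. disco_proj (pt (6 - z $ 1) (1 - z $ 2)))"
  unfolding glue_invariant_def
proof (intro allI impI)
  fix z w assume "disco_glue z w"
  then have "disco_glue (pt (6 - w $ 1) (1 - w $ 2)) (pt (6 - z $ 1) (1 - z $ 2))
    \<or> pt (6 - w $ 1) (1 - w $ 2) = pt (6 - z $ 1) (1 - z $ 2)"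
    unfolding disco_glue_iff[of z w] by (elim disjE conjE) (auto simp: disco_glue_iff eq_2_iff field_simps)
  then show "disco_proj (pt (6 - z $ 1) (1 - z $ 2)) = disco_proj (pt (6 - w $ 1) (1 - w $ 2))"
    using disco_proj_glue by auto
qed

lemma rot_proj: "z \<in> disco_rect \<Longrightarrow> rot (disco_proj z) = disco_proj (pt (6 - z $ 1) (1 - z $ 2))"
  unfolding rot_def by (rule induced_proj[OF glue_invariant_rot])

text \<open>After the half turn the bottom image of a side becomes a top side, glued by the
  conjugated inverse map, of slope \<open>1 / a\<close>.\<close>

lemma edges_opposite:
  assumes "(lo, hi, a, b) \<in> edges"
  shows "(6 - (a * hi + b), 6 - (a * lo + b), 1 / a, 6 - (6 - b) / a) \<in> edges"
  using assms by (cases rule: edges_cases) (hypsubst, simp add: edges_def)+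

lemma aff_at_rot:
  assumes c: "c \<in> patches" "d \<in> pdom c"
  shows "aff_at ((*v) neg_id) (\<lambda>w. rot (psi c w)) d"
  using c(1)
proof (cases rule: patches_cases)
  case 1
  show ?thesis
    by (rule aff_atI[OF inner_patch_in open_pdom[OF c(1)] c(2), of 1 _ "pt 6 1"])
      (auto simp: 1 mat2_mult eq_2_iff inner_patch_simps mem_box_pt psi_def mem_disco_rect rot_proj intro!: arg_cong[where f = disco_proj])
next
  case 2
  show ?thesis
  proof (rule aff_atI[OF side_patch_in open_pdom[OF c(1)] c(2), of 1 _ "pt 12 1"])
    fix w assume "w \<in> pdom c"
    then have w: "3 < w $ 1" "w $ 1 < 9" "0 < w $ 2" "w $ 2 < 1"
      by (auto simp: 2 side_patch_simps mem_box_pt)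
    have eq: "1 *\<^sub>R (neg_id *v w) + pt 12 1 = pt (12 - w $ 1) (1 - w $ 2)"
      by (simp add: mat2_mult eq_2_iff)
    consider "w $ 1 < 6" | "w $ 1 = 6" | "6 < w $ 1" by linarith
    then have "rot (psi c w) = psi side_patch (pt (12 - w $ 1) (1 - w $ 2))"
    proof cases
      case 2
      then show ?thesis
        using w disco_proj_glue[of "pt 0 (1 - w $ 2)" "pt 6 (1 - w $ 2)"]
        by (simp add: \<open>c = side_patch\<close> psi_def mem_disco_rect rot_proj disco_glue_iff)
    qed (use w in \<open>simp_all add: 2 psi_def mem_disco_rect rot_proj side_patch_simps\<close>)
    then show "1 *\<^sub>R (neg_id *v w) + pt 12 1 \<in> pdom side_patch \<and>
       rot (psi c w) = psi side_patch (1 *\<^sub>R (neg_id *v w) + pt 12 1)"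
      unfolding eq using w by (simp add: side_patch_simps mem_box_pt)
  qed simp
next
  case (3 lo hi a b)
  let ?b = "6 - (6 - b) / a"
  let ?e = "edge_patch (6 - (a * hi + b), 6 - (a * lo + b), 1 / a, ?b)"
  note e = edges_opposite[OF 3(1)]
  have e': "?e \<in> patches"
    using e by (simp add: patches_def)
  have a: "0 < a" by (rule edges_bounds[OF 3(1)])
  show ?thesis
  proof (rule aff_atI[OF e' open_pdom[OF c(1)] c(2), of a _ "pt (6 - b) (1 + a)"])
    fix w assume wc: "w \<in> pdom c"
    then have w: "lo < w $ 1" "w $ 1 < hi" "0 < w $ 2" "w $ 2 < 1 + 1 / a"
      by (auto simp: 3 edge_patch_simps mem_box_pt)
    \<comment> \<open>\<open>?v\<close> is the half turn of \<open>pglue c w\<close>: the upper part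
      of the source patch goes to the lower part of the opposite one, which accounts for the factor
      \<open>a\<close>.\<close>
    let ?v = "pt (6 - b - a * w $ 1) (1 + a - a * w $ 2)"
    have eq: "a *\<^sub>R (neg_id *v w) + pt (6 - b) (1 + a) = ?v"
      by (simp add: mat2_mult eq_2_iff)
    have "a * w $ 2 < a + 1"
      using w(4) a by (simp add: field_simps)
    then have v: "?v \<in> pdom ?e"
      using w a by (simp add: edge_patch_simps mem_box_pt)
    have vr: "?v \<in> disco_rect \<longleftrightarrow> 1 \<le> w $ 2" and gr: "pglue ?e ?v \<in> disco_rect \<longleftrightarrow> w $ 2 \<le> 1"
      using edge_rect_iff[OF e v] a by (auto simp: mult_le_cancel_left1 le_diff_eq)
    have g: "pglue ?e ?v = pt (6 - w $ 1) (1 - w $ 2)"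
      using a by (simp add: edge_patch_simps eq_2_iff field_simps)
    have wr: "w \<in> disco_rect \<longleftrightarrow> w $ 2 \<le> 1" "pglue c w \<in> disco_rect \<longleftrightarrow> 1 \<le> w $ 2"
      using edge_rect_iff[OF 3(1), of w] wc 3(2) by auto
    have "rot (psi c w) = psi ?e ?v"
    proof (cases "w $ 2 \<le> 1")
      case True
      then have "rot (psi c w) = disco_proj (pglue ?e ?v)"
        unfolding g using wr by (simp add: psi_def rot_proj)
      then show ?thesis
        using psi_eq_iff[OF e' v] gr True by simp
    next
      case False
      then have "rot (psi c w) = disco_proj ?v"
        using wr by (simp add: psi_def rot_proj) (simp add: 3 edge_patch_simps algebra_simps)
      then show ?thesis
        using False vr by (simp add: psi_def)
    qed
    then show "a *\<^sub>R (neg_id *v w) + pt (6 - b) (1 + a) \<in> pdom ?e \<and>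
       rot (psi c w) = psi ?e (a *\<^sub>R (neg_id *v w) + pt (6 - b) (1 + a))"
      unfolding eq using v by simp
  qed (rule a)
qed

lemma affine_with_rot: "affine_with neg_id rot"
proof -
  let ?F = "\<lambda>z. disco_proj (pt (6 - z $ 1) (1 - z $ 2))"
  have r: "pt (6 - z $ 1) (1 - z $ 2) \<in> disco_rect" if "z \<in> disco_rect" for z
    using that by (auto simp: mem_disco_rect)
  have cont: "continuous_map (top_of_set disco_rect) disco ?F"
  proof (rule continuous_map_eq)
    show "continuous_map (top_of_set disco_rect) disco (\<lambda>z. disco_proj (pt 6 1 - z))"
      by (rule continuous_map_disco_proj_comp) (auto intro!: continuous_intros simp: mem_disco_rect)
    have "pt 6 1 - z = pt (6 - z $ 1) (1 - z $ 2)" for z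
      by (simp add: eq_2_iff)
    then show "disco_proj (pt 6 1 - z) = ?F z" for z
      by simp
  qed
  have "affine_with neg_id (induced ?F)"
  proof (rule affine_with_induced[OF glue_invariant_rot cont glue_invariant_rot cont])
    show "induced ?F (?F z) = disco_proj z" if "z \<in> disco_rect" for z
      using rot_proj[OF r[OF that]] by (simp add: rot_def)
    then show "induced ?F (?F z) = disco_proj z" if "z \<in> disco_rect" for z
      using that .
    show "?F z \<in> disco_sing" if "vertex z" for z
      unfolding disco_sing_eq by (rule imageI) (use that in \<open>auto simp: vertex_def\<close>)
    then show "?F z \<in> disco_sing" if "vertex z" for z
      using that .
    fix p assume "p \<in> topspace disco" "p \<notin> disco_sing"
    then obtain c d where c: "c \<in> patches" "d \<in> pdom c" "p = psi c d"
      by (rule patches_cover)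
    then show "\<exists>K z. aff_at (\<lambda>w. w) K z \<and> K z = p \<and>
        aff_at ((*v) neg_id) (\<lambda>w. induced ?F (K w)) z"
      using aff_at_psi aff_at_rot unfolding rot_def by blast
  qed (simp add: det_mat2)
  then show ?thesis
    by (simp add: rot_def)
qed

definition htwist :: "int \<Rightarrow> real ^ 2 \<Rightarrow> (real ^ 2) set" where
  "htwist s z = cyl (pt (z $ 1 + 6 * real_of_int s * z $ 2) (z $ 2))"

text \<open>At height 1 the shift is \<open>6 s\<close>, a whole number of circumferences. The twist
  therefore fixes both boundary circles pointwise and is compatible with the gluing of top to
  bottom.\<close>

lemma htwist_boundary:
  assumes "z \<in> disco_rect" "z $ 2 = 0 \<or> z $ 2 = 1"
  shows "htwist s z = disco_proj z"
  using assms(2)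
proof
  assume "z $ 2 = 0"
  then show ?thesis
    using cyl_rect[OF assms(1)] by (simp add: htwist_def cyl_def)
next
  assume 1: "z $ 2 = 1"
  then have "htwist s z = cyl (pt (z $ 1) (z $ 2))"
    using cyl_periodic[of "z $ 1" s 1] by (simp add: htwist_def)
  then show ?thesis
    using cyl_rect[OF assms(1)] by simp
qed

lemma glue_invariant_htwist: "glue_invariant (htwist s)"
  unfolding glue_invariant_def
proof (intro allI impI)
  fix z w assume g: "disco_glue z w"
  then have r: "z \<in> disco_rect" "w \<in> disco_rect"
    by (auto simp: disco_glue_iff mem_disco_rect)
  from g consider "z $ 1 = 0" "w = pt 6 (z $ 2)" | "z $ 2 = 1" "w $ 2 = 0"
    by (auto simp: disco_glue_iff)
  then show "htwist s z = htwist s w"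
  proof cases
    case 1
    then show ?thesis
      using cyl_periodic[of "6 * real_of_int s * z $ 2" 1 "z $ 2"] by (simp add: htwist_def algebra_simps)
  next
    case 2
    then show ?thesis
      using htwist_boundary r disco_proj_glue[OF g] by simp
  qed
qed

lemma continuous_map_htwist: "continuous_map (top_of_set disco_rect) disco (htwist s)"
proof -
  let ?h = "\<lambda>z :: real ^ 2. shear_h s *v z"
  have "continuous_map (top_of_set disco_rect) (top_of_set {z :: real ^ 2. 0 \<le> z $ 2 \<and> z $ 2 \<le> 1}) ?h"
  proof -
    have "continuous_on disco_rect ?h"
      by (intro bounded_linear.continuous_on[OF bounded_linear_matrix] continuous_intros)
    moreover have "?h ` disco_rect \<subseteq> {z :: real ^ 2. 0 \<le> z $ 2 \<and> z $ 2 \<le> 1}"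
      by (auto simp: mem_disco_rect mat2_mult)
    ultimately show ?thesis
      by auto
  qed
  from continuous_map_compose[OF this continuous_map_cyl] show ?thesis
    by (rule continuous_map_eq) (simp add: htwist_def mat2_mult)
qed

lemma induced_htwist_cyl:
  assumes "0 \<le> z $ 2" "z $ 2 \<le> 1"
  shows "induced (htwist s) (cyl z) = cyl (pt (z $ 1 + 6 * real_of_int s * z $ 2) (z $ 2))"
proof -
  obtain k :: int where k: "6 * real_of_int k \<le> z $ 1" "z $ 1 < 6 * (real_of_int k + 1)"
    by (rule cyl_reduce)
  let ?w = "pt (z $ 1 - 6 * real_of_int k) (z $ 2)"
  have "?w \<in> disco_rect"
    using k assms by (simp add: mem_disco_rect)
  then have "induced (htwist s) (cyl z) = htwist s ?w"
    using cyl_eq[of k z] k assms induced_proj[OF glue_invariant_htwist] by simp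
  also have "\<dots> = cyl (pt (z $ 1 + 6 * real_of_int s * z $ 2 + 6 * real_of_int (- k)) (z $ 2))"
    by (simp add: htwist_def algebra_simps)
  finally show ?thesis
    by (simp only: cyl_periodic)
qed

lemma affine_with_htwist: "affine_with (shear_h s) (induced (htwist s))"
  (is "affine_with ?M _")
proof (rule affine_with_induced[OF glue_invariant_htwist continuous_map_htwist glue_invariant_htwist[of "- s"] continuous_map_htwist])
  have inv: "induced (htwist (- s)) (htwist s z) = disco_proj z" if "z \<in> disco_rect" for s z
    using that unfolding htwist_def by (subst htwist_def[symmetric], subst induced_htwist_cyl) (auto simp: mem_disco_rect cyl_rect)
  show "induced (htwist (- s)) (htwist s z) = disco_proj z" "induced (htwist s) (htwist (- s) z) = disco_proj z"
    if "z \<in> disco_rect" for z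
    using inv[OF that, of s] inv[OF that, of "- s"] by simp_all
  show "htwist s z \<in> disco_sing" "htwist (- s) z \<in> disco_sing" if "vertex z" for z
    using that htwist_boundary[OF vertex_imp_rect[OF that]] disco_proj_in_sing_iff[OF vertex_imp_rect[OF that]]
    by (auto simp: vertex_def)
  fix p assume p: "p \<in> topspace disco" "p \<notin> disco_sing"
  then obtain c d where c: "c \<in> patches" "d \<in> pdom c" "p = psi c d"
    by (rule patches_cover)
  have inside: "\<exists>K z. aff_at (\<lambda>w. w) K z \<and> K z = p \<and> aff_at ((*v) ?M) (\<lambda>w. induced (htwist s) (K w)) z"
    if z: "p = cyl z" "0 < z $ 2" "z $ 2 < 1" for z
  proof (intro exI conjI)
    show "aff_at (\<lambda>w. w) cyl z" "cyl z = p"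
      using aff_at_cyl z by auto
    have "aff_at (\<lambda>w. ?M *v w) (\<lambda>w. cyl (?M *v w + 0)) z"
      using aff_at_affine[of "\<lambda>w. w" cyl "(*v) ?M" z 0] aff_at_cyl[of "?M *v z"] z bounded_linear_matrix
      by (simp add: mat2_mult bounded_linear_ident)
    moreover have "open {w :: real ^ 2. 0 < w $ 2 \<and> w $ 2 < 1}"
      by (intro open_Collect_conj open_Collect_less continuous_intros)
    ultimately show "aff_at ((*v) ?M) (\<lambda>w. induced (htwist s) (cyl w)) z"
      by (rule aff_at_cong) (use z in \<open>auto simp: induced_htwist_cyl mat2_mult\<close>)
  qed
  show "\<exists>K z. aff_at (\<lambda>w. w) K z \<and> K z = p \<and> aff_at ((*v) ?M) (\<lambda>w. induced (htwist s) (K w)) z"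
    using c(1)
  proof (cases rule: patches_cases)
    case 1
    then show ?thesis
      using c by (intro inside[of d]) (auto simp: inner_patch_simps mem_box_pt psi_def mem_disco_rect cyl_rect)
  next
    case 2
    then have "0 < d $ 2" "d $ 2 < 1" "3 < d $ 1" "d $ 1 < 9"
      using c by (auto simp: side_patch_simps mem_box_pt)
    moreover from this have "p = cyl d"
      using cyl_eq[of 0 d] cyl_eq[of 1 d] by (auto simp: c(3) 2 psi_def mem_disco_rect side_patch_simps)
    ultimately show ?thesis
      by (intro inside[of d]) auto
  next
    case (3 lo hi a b)
    \<comment> \<open>\<open>?B\<close> centres the shear at height 1, so that it fixes the seam.
      Below the seam this changes the lift by \<open>s\<close> full turns, and above it the shear
      commutes with the homothety \<open>pglue\<close>.\<close>
    let ?B = "pt (- 6 * real_of_int s) 0"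
    define N where "N = {w \<in> pdom c. ?M *v w + ?B \<in> pdom c}"
    have d: "lo < d $ 1" "d $ 1 < hi" "0 < d $ 2" "d $ 2 < 1 + 1 / a" and a: "0 < a"
      using c(2) edges_bounds[OF 3(1)] by (auto simp: 3 edge_patch_simps mem_box_pt)
    note dr = edge_rect_iff[OF 3(1), folded 3(2)]
    have psic: "psi c w = (if w $ 2 \<le> 1 then cyl w else cyl (pglue c w))" if "w \<in> pdom c" for w
      using dr[OF that] by (auto simp: psi_def cyl_rect)
    have psic': "psi c w = cyl (pglue c w)" if "w \<in> pdom c" "1 \<le> w $ 2" for w
      using dr[OF that(1)] that psi_eq_iff[OF c(1) that(1), of "pglue c w"] by (auto simp: cyl_rect)
    have MB: "?M *v w + ?B = pt (w $ 1 + 6 * real_of_int s * (w $ 2 - 1)) (w $ 2)" for w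
      by (simp add: eq_2_iff mat2_mult algebra_simps)
    have shift: "induced (htwist s) (psi c w) = psi c (?M *v w + ?B)" if "w \<in> N" for w
    proof (cases "w $ 2 \<le> 1")
      case True
      have w: "w \<in> pdom c" "?M *v w + ?B \<in> pdom c" "0 < w $ 2"
        using that by (auto simp: N_def 3 edge_patch_simps mem_box_pt)
      have "induced (htwist s) (psi c w) = cyl (pt (w $ 1 + 6 * real_of_int s * w $ 2) (w $ 2))"
        using psic[OF w(1)] True w(3) by (simp add: induced_htwist_cyl)
      also have "\<dots> = cyl (pt ((w $ 1 + 6 * real_of_int s * (w $ 2 - 1)) + 6 * real_of_int s) (w $ 2))"
        by (simp add: algebra_simps)
      also have "\<dots> = psi c (?M *v w + ?B)"
        using psic[OF w(2)] True unfolding MB cyl_periodic by simp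
      finally show ?thesis .
    next
      case False
      have w: "w \<in> pdom c" "?M *v w + ?B \<in> pdom c" "w $ 2 < 1 + 1 / a"
        using that by (auto simp: N_def 3 edge_patch_simps mem_box_pt)
      have h: "0 \<le> a * (w $ 2 - 1)" "a * (w $ 2 - 1) \<le> 1"
        using edge_upper[OF a _ w(3)] False by (auto simp: less_imp_le)
      have "induced (htwist s) (psi c w) = cyl (pt (a * w $ 1 + b + 6 * real_of_int s * (a * (w $ 2 - 1))) (a * (w $ 2 - 1)))"
        using psic[OF w(1)] False h by (simp add: induced_htwist_cyl 3 edge_patch_simps)
      also have "\<dots> = cyl (pglue c (?M *v w + ?B))"
        unfolding MB by (simp add: 3 edge_patch_simps algebra_simps)
      also have "\<dots> = psi c (?M *v w + ?B)"
        using psic'[OF w(2)] False unfolding MB by simp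
      finally show ?thesis .
    qed
    show ?thesis
    proof (cases "d $ 2 = 1")
      case True
      have "open N"
      proof -
        have "open ((\<lambda>w. ?M *v w + ?B) -` pdom c)"
          by (intro open_vimage open_pdom[OF c(1)] continuous_intros bounded_linear.continuous_on[OF bounded_linear_matrix])
        moreover have "N = pdom c \<inter> (\<lambda>w. ?M *v w + ?B) -` pdom c"
          by (auto simp: N_def)
        ultimately show ?thesis
          using open_pdom[OF c(1)] by (simp add: open_Int)
      qed
      moreover have "?M *v d + ?B = d"
        unfolding MB using True by (simp add: eq_2_iff)
      then have "d \<in> N"
        using c(2) by (simp only: N_def mem_Collect_eq simp_thms)
      ultimately have "aff_at ((*v) ?M) (\<lambda>w. induced (htwist s) (psi c w)) d"
        using shift by (intro aff_atI[OF c(1), of N d 1 "(*v) ?M" ?B]) (auto simp: N_def)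
      then show ?thesis
        using aff_at_psi c by blast
    next
      case False
      then consider "d $ 2 < 1" | "1 < d $ 2" by linarith
      then show ?thesis
      proof cases
        case 1
        then show ?thesis
          using psic[OF c(2)] c(3) d by (intro inside[of d]) auto
      next
        case 2
        then show ?thesis
          using psic[OF c(2)] c(3) edge_upper[OF a 2 d(4)] by (intro inside[of "pglue c d"]) (auto simp: 3 edge_patch_simps)
      qed
    qed
  qed
qed (simp add: det_mat2)

section \<open>The vertical twists\<close>

lemma top_of_set_Collect:
  "subtopology (top_of_set T) {x \<in> topspace (top_of_set T). P x} = top_of_set (T \<inter> {x. P x})"
proof -
  have "T \<inter> {x \<in> topspace (top_of_set T). P x} = T \<inter> {x. P x}"
    by auto
  then show ?thesis
    by (simp only: subtopology_subtopology)
qed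

text \<open>The covering of the left vertical cylinder by the strip \<open>0 \<le> x \<le> 1\<close>: the unit square
  followed by \<open>[1, 3] \<times> [0, 1]\<close> rescaled by \<open>1/2\<close>, so of circumference \<open>3/2\<close>. The right cylinder
  is its image under \<open>rot\<close>.\<close>

definition vcyl :: "real ^ 2 \<Rightarrow> (real ^ 2) set" where
  "vcyl z = (let h = z $ 2 - 3 / 2 * real_of_int \<lfloor>z $ 2 / (3 / 2)\<rfloor> in
     if h \<le> 1 then disco_proj (pt (z $ 1) h) else disco_proj (pt (2 * z $ 1 + 1) (2 * (h - 1))))"

lemma vcyl_reduce:
  obtains k :: int where "3 / 2 * real_of_int k \<le> z $ 2" "z $ 2 < 3 / 2 * (real_of_int k + 1)"
proof (rule that[of "\<lfloor>z $ 2 / (3 / 2)\<rfloor>"])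
  let ?k = "\<lfloor>z $ 2 / (3 / 2)\<rfloor>"
  have "real_of_int ?k \<le> z $ 2 / (3 / 2)" "z $ 2 / (3 / 2) < real_of_int ?k + 1"
    by linarith+
  then show "3 / 2 * real_of_int ?k \<le> z $ 2" "z $ 2 < 3 / 2 * (real_of_int ?k + 1)"
    by (simp_all add: field_simps)
qed

lemma vcyl_periodic: "vcyl (pt x (y + 3 / 2 * real_of_int k)) = vcyl (pt x y)"
proof -
  have "\<lfloor>(y + 3 / 2 * real_of_int k) / (3 / 2)\<rfloor> = \<lfloor>y / (3 / 2) + real_of_int k\<rfloor>"
    by (simp add: add_divide_distrib)
  also have "\<dots> = \<lfloor>y / (3 / 2)\<rfloor> + k"
    by (rule floor_add_int[symmetric])
  finally show ?thesis
    unfolding vcyl_def Let_def pt_nth by (simp add: algebra_simps)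
qed

text \<open>At height 1 the line enters \<open>[1, 3] \<times> [0, 1]\<close> and at height 3/2 it
  returns to the unit square; the gluings \<open>e1\<close> and \<open>e2\<close> make the formulas
  agree there.\<close>

lemma vcyl_base:
  assumes "0 \<le> x" "x \<le> 1" "0 \<le> y" "y \<le> 3 / 2"
  shows "y \<le> 1 \<Longrightarrow> vcyl (pt x y) = disco_proj (pt x y)"
    and "1 \<le> y \<Longrightarrow> vcyl (pt x y) = disco_proj (pt (2 * x + 1) (2 * (y - 1)))"
proof -
  have e1: "disco_proj (pt x 1) = disco_proj (pt (2 * x + 1) 0)"
    by (rule disco_proj_glue) (use assms in \<open>simp add: disco_glue_iff\<close>)
  have e2: "disco_proj (pt (2 * x + 1) 1) = disco_proj (pt x 0)"
    by (rule disco_proj_glue) (use assms in \<open>simp add: disco_glue_iff\<close>)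
  have *: "vcyl (pt x y) = (if y \<le> 1 then disco_proj (pt x y) else disco_proj (pt (2 * x + 1) (2 * (y - 1))))"
  proof (cases "y = 3 / 2")
    case True
    show ?thesis
      unfolding True by (simp add: vcyl_def e2)
  next
    case False
    then have "\<lfloor>y / (3 / 2)\<rfloor> = 0"
      using assms by (intro floor_unique) auto
    then show ?thesis
      by (simp add: vcyl_def)
  qed
  show "y \<le> 1 \<Longrightarrow> vcyl (pt x y) = disco_proj (pt x y)"
    using * by simp
  show "1 \<le> y \<Longrightarrow> vcyl (pt x y) = disco_proj (pt (2 * x + 1) (2 * (y - 1)))"
    using * e1 by (cases "y = 1") auto
qed

lemma vcyl_eq:
  assumes "0 \<le> z $ 1" "z $ 1 \<le> 1" "3 / 2 * real_of_int k \<le> z $ 2" "z $ 2 \<le> 3 / 2 * (real_of_int k + 1)"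
  shows "z $ 2 \<le> 3 / 2 * real_of_int k + 1 \<Longrightarrow> vcyl z = disco_proj (pt (z $ 1) (z $ 2 - 3 / 2 * real_of_int k))"
    and "3 / 2 * real_of_int k + 1 \<le> z $ 2 \<Longrightarrow>
      vcyl z = disco_proj (pt (2 * z $ 1 + 1) (2 * (z $ 2 - 3 / 2 * real_of_int k - 1)))"
proof -
  have eq: "vcyl z = vcyl (pt (z $ 1) (z $ 2 - 3 / 2 * real_of_int k))"
    using vcyl_periodic[of "z $ 1" "z $ 2 - 3 / 2 * real_of_int k" k] by simp
  have b: "0 \<le> z $ 2 - 3 / 2 * real_of_int k" "z $ 2 - 3 / 2 * real_of_int k \<le> 3 / 2"
    using assms by (auto simp: algebra_simps)
  show "z $ 2 \<le> 3 / 2 * real_of_int k + 1 \<Longrightarrow> vcyl z = disco_proj (pt (z $ 1) (z $ 2 - 3 / 2 * real_of_int k))"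
    unfolding eq by (rule vcyl_base(1)[OF assms(1,2) b]) simp
  show "3 / 2 * real_of_int k + 1 \<le> z $ 2 \<Longrightarrow>
      vcyl z = disco_proj (pt (2 * z $ 1 + 1) (2 * (z $ 2 - 3 / 2 * real_of_int k - 1)))"
    unfolding eq by (rule vcyl_base(2)[OF assms(1,2) b]) simp
qed

lemma continuous_map_vcyl: "continuous_map (top_of_set {z. 0 \<le> z $ 1 \<and> z $ 1 \<le> 1}) disco vcyl"
proof (rule continuous_map_slabs[of "3/2" _ 2])
  fix k :: int
  let ?T = "{z :: real ^ 2. 0 \<le> z $ 1 \<and> z $ 1 \<le> 1} \<inter> {z. 3 / 2 * real_of_int k \<le> z $ 2 \<and> z $ 2 \<le> 3 / 2 * (real_of_int k + 1)}"
  let ?f = "\<lambda>z. disco_proj (z - pt 0 (3 / 2 * real_of_int k))"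
  let ?g = "\<lambda>z. disco_proj (2 *\<^sub>R z + pt 1 (- 3 * real_of_int k - 2))"
  have eq: "z - pt 0 (3 / 2 * real_of_int k) = pt (z $ 1) (z $ 2 - 3 / 2 * real_of_int k)"
    "2 *\<^sub>R z + pt 1 (- 3 * real_of_int k - 2) = pt (2 * z $ 1 + 1) (2 * (z $ 2 - 3 / 2 * real_of_int k - 1))" for z
    by (simp_all add: eq_2_iff)
  have "continuous_map (top_of_set ?T) disco (\<lambda>z. if z $ 2 \<le> 3 / 2 * real_of_int k + 1 then ?f z else ?g z)"
  proof (rule continuous_map_cases_le)
    show "continuous_map (top_of_set ?T) euclideanreal (\<lambda>z. z $ 2)"
      "continuous_map (top_of_set ?T) euclideanreal (\<lambda>z. 3 / 2 * real_of_int k + 1)"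
      by (auto intro!: continuous_intros)
    have "continuous_map (top_of_set (?T \<inter> {z. z $ 2 \<le> 3 / 2 * real_of_int k + 1})) disco ?f"
      by (rule continuous_map_disco_proj_comp) (auto intro!: continuous_intros simp: mem_disco_rect)
    then show "continuous_map (subtopology (top_of_set ?T) {x \<in> topspace (top_of_set ?T). x $ 2 \<le> 3 / 2 * real_of_int k + 1}) disco ?f"
      by (simp only: top_of_set_Collect)
    have "continuous_map (top_of_set (?T \<inter> {z. 3 / 2 * real_of_int k + 1 \<le> z $ 2})) disco ?g"
      by (rule continuous_map_disco_proj_comp) (auto intro!: continuous_intros simp: mem_disco_rect)
    then show "continuous_map (subtopology (top_of_set ?T) {x \<in> topspace (top_of_set ?T). 3 / 2 * real_of_int k + 1 \<le> x $ 2}) disco ?g"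
      by (simp only: top_of_set_Collect)
    fix z assume "z \<in> topspace (top_of_set ?T)" "z $ 2 = 3 / 2 * real_of_int k + 1"
    then show "?f z = ?g z"
      using vcyl_eq[of z k] unfolding eq by auto
  qed
  then show "continuous_map (top_of_set ?T) disco vcyl"
  proof (rule continuous_map_eq)
    fix z assume "z \<in> topspace (top_of_set ?T)"
    then show "(if z $ 2 \<le> 3 / 2 * real_of_int k + 1 then ?f z else ?g z) = vcyl z"
      unfolding eq using vcyl_eq[of z k] by auto
  qed
qed simp

lemma aff_at_vcyl:
  assumes "0 < z $ 1" "z $ 1 < 1"
  shows "aff_at (\<lambda>w. w) vcyl z"
proof -
  obtain k :: int where k: "3 / 2 * real_of_int k \<le> z $ 2" "z $ 2 < 3 / 2 * (real_of_int k + 1)"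
    by (rule vcyl_reduce)
  define kk where "kk = 3 / 2 * real_of_int k"
  have kk: "kk \<le> z $ 2" "z $ 2 < kk + 3 / 2"
    using k by (simp_all add: kk_def algebra_simps)
  show ?thesis
  proof (cases "z $ 2 = kk")
    case False
    \<comment> \<open>This patch has height \<open>1 + 1/2 = 3/2\<close>: it is one full open period
      of the strip.\<close>
    let ?c = "edge_patch (0, 1, 2, 1)"
    have e: "(0, 1, 2, 1) \<in> edges" and c: "?c \<in> patches"
      by (simp_all add: edges_def patches_def)
    let ?b = "pt 0 (- kk)"
    have op: "open ((\<lambda>w. w + ?b) -` pdom ?c)"
      by (intro open_vimage open_pdom[OF c] continuous_intros)
    show ?thesis
    proof (rule aff_atI[OF c op, of _ 1 _ ?b])
      show "z \<in> (\<lambda>w. w + ?b) -` pdom ?c"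
        using kk False assms by (simp add: edge_patch_simps mem_box_pt)
      fix w assume m: "w \<in> (\<lambda>w. w + ?b) -` pdom ?c"
      then have w: "0 < w $ 1" "w $ 1 < 1" "kk < w $ 2" "w $ 2 < kk + 3 / 2"
        by (auto simp: edge_patch_simps mem_box_pt)
      have wb: "w + ?b = pt (w $ 1) (w $ 2 - kk)"
        by (simp add: eq_2_iff)
      have "vcyl w = psi ?c (pt (w $ 1) (w $ 2 - kk))"
        using vcyl_eq[of w k, folded kk_def] w
        by (cases "w $ 2 \<le> kk + 1") (simp_all add: psi_def mem_disco_rect edge_patch_simps kk_def)
      then show "1 *\<^sub>R w + ?b \<in> pdom ?c \<and> vcyl w = psi ?c (1 *\<^sub>R w + ?b)"
        using m wb by simp
    qed simp
  next
    case True
    \<comment> \<open>The remaining heights are multiples of 3/2, where \<open>[1, 3]\<close> is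
      glued back to \<open>[0, 1]\<close>. This patch is developed across that seam, at twice the
      scale of the strip.\<close>
    let ?c = "edge_patch (1, 3, 1/2, -1/2)"
    have e: "(1, 3, 1/2, -1/2) \<in> edges" and c: "?c \<in> patches"
      by (simp_all add: edges_def patches_def)
    let ?b = "pt 1 (1 - 2 * kk)"
    have op: "open ((\<lambda>w. 2 *\<^sub>R w + ?b) -` pdom ?c)"
      by (intro open_vimage open_pdom[OF c] continuous_intros)
    show ?thesis
    proof (rule aff_atI[OF c op, of _ 2 _ ?b])
      show "z \<in> (\<lambda>w. 2 *\<^sub>R w + ?b) -` pdom ?c"
        using True assms by (simp add: edge_patch_simps mem_box_pt)
      fix w assume m: "w \<in> (\<lambda>w. 2 *\<^sub>R w + ?b) -` pdom ?c"
      then have w: "0 < w $ 1" "w $ 1 < 1" "kk - 1 / 2 < w $ 2" "w $ 2 < kk + 1"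
        by (auto simp: edge_patch_simps mem_box_pt)
      have wb: "2 *\<^sub>R w + ?b = pt (2 * w $ 1 + 1) (2 * (w $ 2 - kk) + 1)"
        by (simp add: eq_2_iff)
      have "vcyl w = psi ?c (pt (2 * w $ 1 + 1) (2 * (w $ 2 - kk) + 1))"
      proof (cases "w $ 2 \<le> kk")
        case True
        have k1: "3 / 2 * real_of_int (k - 1) = kk - 3 / 2" "3 / 2 * (real_of_int (k - 1) + 1) = kk"
          by (simp_all add: kk_def field_simps)
        have "vcyl w = disco_proj (pt (2 * w $ 1 + 1) (2 * (w $ 2 - (kk - 3 / 2) - 1)))"
          by (rule vcyl_eq(2)[of w "k - 1", unfolded k1]) (use w True in linarith)+
        also have "2 * (w $ 2 - (kk - 3 / 2) - 1) = 2 * (w $ 2 - kk) + 1"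
          by simp
        finally show ?thesis
          using w True by (simp add: psi_def mem_disco_rect)
      next
        case False
        then have "vcyl w = disco_proj (pt (w $ 1) (w $ 2 - kk))"
          using vcyl_eq(1)[of w k, folded kk_def] w by (simp add: kk_def)
        moreover have "pglue ?c (pt (2 * w $ 1 + 1) (2 * (w $ 2 - kk) + 1)) = pt (w $ 1) (w $ 2 - kk)"
          by (simp add: edge_patch_simps eq_2_iff field_simps)
        ultimately show ?thesis
          using w False by (simp add: psi_def mem_disco_rect)
      qed
      then show "2 *\<^sub>R w + ?b \<in> pdom ?c \<and> vcyl w = psi ?c (2 *\<^sub>R w + ?b)"
        using m wb by simp
    qed simp
  qed
qed

lemma rot_rot: "p \<in> topspace disco \<Longrightarrow> rot (rot p) = p"
  by (auto simp: topspace_disco_eq rot_proj mem_disco_rect)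

text \<open>The second branch is the same shear in the strip coordinates
  \<open>u = (x - 1) / 2\<close> and \<open>h = 1 + y / 2\<close> of the rescaled half, where
  \<open>3/2 s u\<close> becomes \<open>3/4 s (x - 1)\<close>.\<close>

definition vtwist_left :: "int \<Rightarrow> real ^ 2 \<Rightarrow> (real ^ 2) set" where
  "vtwist_left s z = (if z $ 1 \<le> 1 then vcyl (pt (z $ 1) (z $ 2 + 3 / 2 * real_of_int s * z $ 1))
     else vcyl (pt ((z $ 1 - 1) / 2) (1 + z $ 2 / 2 + 3 / 4 * real_of_int s * (z $ 1 - 1))))"

text \<open>The right cylinder is twisted by conjugation with \<open>rot\<close>, so that the
  verifications reduce to the left half.\<close>

definition vtwist :: "int \<Rightarrow> real ^ 2 \<Rightarrow> (real ^ 2) set" where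
  "vtwist s z = (if z $ 1 \<le> 3 then vtwist_left s z else rot (vtwist_left s (pt (6 - z $ 1) (1 - z $ 2))))"

lemma vtwist_left_lift:
  assumes "z \<in> disco_rect" "z $ 1 \<le> 3"
  obtains u h where "0 \<le> u" "u \<le> 1" "disco_proj z = vcyl (pt u h)"
    "\<And>s. vtwist_left s z = vcyl (pt u (h + 3 / 2 * real_of_int s * u))"
proof (cases "z $ 1 \<le> 1")
  case True
  then show thesis
    using assms vcyl_base(1)[of "z $ 1" "z $ 2"]
    by (intro that[of "z $ 1" "z $ 2"]) (simp_all add: vtwist_left_def mem_disco_rect)
next
  case False
  have "pt (2 * ((z $ 1 - 1) / 2) + 1) (2 * ((1 + z $ 2 / 2) - 1)) = z"
    by (simp add: eq_2_iff field_simps)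
  then have "disco_proj z = vcyl (pt ((z $ 1 - 1) / 2) (1 + z $ 2 / 2))"
    using False assms vcyl_base(2)[of "(z $ 1 - 1) / 2" "1 + z $ 2 / 2"] unfolding mem_disco_rect by simp
  moreover have "vtwist_left s z = vcyl (pt ((z $ 1 - 1) / 2) (1 + z $ 2 / 2 + 3 / 2 * real_of_int s * ((z $ 1 - 1) / 2)))" for s
    using False by (simp add: vtwist_left_def)
  ultimately show thesis
    using that[of "(z $ 1 - 1) / 2" "1 + z $ 2 / 2"] False assms(2) by simp
qed

text \<open>On these lines the strip coordinate is 0 or 1, so the shift is zero or \<open>s\<close>
  whole periods of length 3/2.\<close>

lemma vtwist_left_boundary:
  assumes "z \<in> disco_rect" "z $ 1 = 0 \<or> z $ 1 = 1 \<or> z $ 1 = 3"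
  shows "vtwist_left s z = disco_proj z"
proof -
  have z: "0 \<le> z $ 2" "z $ 2 \<le> 1"
    using assms by (auto simp: mem_disco_rect)
  consider "z $ 1 = 0" | "z $ 1 = 1" | "z $ 1 = 3" using assms by blast
  then show ?thesis
  proof cases
    case 1
    then have "vtwist_left s z = vcyl (pt 0 (z $ 2))"
      by (simp add: vtwist_left_def)
    also have "\<dots> = disco_proj (pt 0 (z $ 2))"
      using z by (intro vcyl_base) auto
    finally show ?thesis
      using 1 pt_eta[of z] by simp
  next
    case 2
    then have "vtwist_left s z = vcyl (pt 1 (z $ 2))"
      using vcyl_periodic[of 1 "z $ 2" s] by (simp add: vtwist_left_def)
    also have "\<dots> = disco_proj (pt 1 (z $ 2))"
      using z by (intro vcyl_base) auto
    finally show ?thesis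
      using 2 pt_eta[of z] by simp
  next
    case 3
    then have "vtwist_left s z = vcyl (pt 1 (1 + z $ 2 / 2))"
      using vcyl_periodic[of 1 "1 + z $ 2 / 2" s] by (simp add: vtwist_left_def)
    also have "\<dots> = disco_proj (pt (2 * 1 + 1) (2 * ((1 + z $ 2 / 2) - 1)))"
      using z by (intro vcyl_base) auto
    also have "\<dots> = disco_proj (pt 3 (z $ 2))"
      by simp
    finally show ?thesis
      using 3 pt_eta[of z] by simp
  qed
qed

lemma vtwist_boundary:
  assumes "z \<in> disco_rect" "z $ 1 \<in> {0, 1, 3, 5, 6}"
  shows "vtwist s z = disco_proj z"
proof (cases "z $ 1 \<le> 3")
  case True
  then show ?thesis
    using assms vtwist_left_boundary[of z s] by (auto simp: vtwist_def)
next
  case False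
  let ?w = "pt (6 - z $ 1) (1 - z $ 2)"
  have w: "?w \<in> disco_rect" "?w $ 1 = 0 \<or> ?w $ 1 = 1 \<or> ?w $ 1 = 3"
    using assms False by (auto simp: mem_disco_rect)
  then show ?thesis
    using False vtwist_left_boundary[OF w, of s] rot_proj[OF w(1)] by (simp add: vtwist_def)
qed

lemma vtwist_left_glue:
  assumes g: "disco_glue z w" and z: "z $ 2 = 1" "z $ 1 < 3" "z $ 1 \<notin> {0, 1, 3, 5, 6}"
  shows "vtwist_left s z = vtwist_left s w" "w $ 1 < 3"
proof -
  have "0 \<le> z $ 1"
    using g z by (auto simp: disco_glue_iff)
  then consider "0 < z $ 1" "z $ 1 < 1" "w = pt (2 * z $ 1 + 1) 0" | "1 < z $ 1" "z $ 1 < 3" "w = pt ((z $ 1 - 1) / 2) 0"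
    using g z by (auto simp: disco_glue_iff)
  then have "vtwist_left s z = vtwist_left s w \<and> w $ 1 < 3"
  proof cases
    case 1
    then show ?thesis
      using z by (simp add: vtwist_left_def algebra_simps)
  next
    case 2
    let ?x = "(z $ 1 - 1) / 2"
    have "vtwist_left s z = vcyl (pt ?x (3 / 2 * real_of_int s * ?x + 3 / 2 * real_of_int 1))"
      using 2 z by (simp add: vtwist_left_def algebra_simps)
    also have "\<dots> = vcyl (pt ?x (3 / 2 * real_of_int s * ?x))"
      by (rule vcyl_periodic)
    also have "\<dots> = vtwist_left s w"
      using 2 by (simp add: vtwist_left_def)
    finally show ?thesis
      using 2 by simp
  qed
  then show "vtwist_left s z = vtwist_left s w" "w $ 1 < 3" by auto
qed

lemma glue_invariant_vtwist: "glue_invariant (vtwist s)"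
  unfolding glue_invariant_def
proof (intro allI impI)
  fix z w assume g: "disco_glue z w"
  then have r: "z \<in> disco_rect" "w \<in> disco_rect"
    by (auto simp: disco_glue_iff mem_disco_rect)
  show "vtwist s z = vtwist s w"
  proof (cases "z $ 1 \<in> {0, 1, 3, 5, 6}")
    case True
    moreover from this have "w $ 1 \<in> {0, 1, 3, 5, 6}"
      using g by (auto simp: disco_glue_iff)
    ultimately show ?thesis
      using vtwist_boundary[OF r(1)] vtwist_boundary[OF r(2)] disco_proj_glue[OF g] by simp
  next
    case F: False
    then have z2: "z $ 2 = 1"
      using g by (auto simp: disco_glue_iff)
    show ?thesis
    proof (cases "z $ 1 < 3")
      case True
      then show ?thesis
        using vtwist_left_glue[OF g z2 True F] by (simp add: vtwist_def)
    next
      case False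
      let ?z = "pt (6 - z $ 1) (1 - z $ 2)" and ?w = "pt (6 - w $ 1) (1 - w $ 2)"
      consider "3 < z $ 1" "z $ 1 < 5" "w = pt (z $ 1 / 2 + 7 / 2) 0" | "5 < z $ 1" "z $ 1 < 6" "w = pt (2 * z $ 1 - 7) 0"
        using g F False z2 by (auto simp: disco_glue_iff)
      then have w: "3 < w $ 1 \<and> w $ 1 < 6 \<and> w $ 1 \<noteq> 5 \<and> w $ 2 = 0 \<and> 3 < z $ 1 \<and> disco_glue ?w ?z"
        by cases (use z2 in \<open>simp_all add: disco_glue_iff eq_2_iff\<close>)
      then have gl: "disco_glue ?w ?z" by blast
      have "vtwist_left s ?w = vtwist_left s ?z"
        by (rule vtwist_left_glue(1)[OF gl]) (use w in simp_all)
      then show ?thesis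
        using w by (simp add: vtwist_def)
    qed
  qed
qed

lemma continuous_map_vtwist_left:
  "continuous_map (top_of_set (disco_rect \<inter> {z. z $ 1 \<le> 3})) disco (vtwist_left s)"
proof -
  let ?T = "disco_rect \<inter> {z. z $ 1 \<le> 3}"
  let ?S = "{z :: real ^ 2. 0 \<le> z $ 1 \<and> z $ 1 \<le> 1}"
  let ?A = "vector [vector [1, 0], vector [3 / 2 * real_of_int s, 1]] :: real ^ 2 ^ 2"
  \<comment> \<open>\<open>?g\<close> is the shear composed with the passage \<open>(x, y)\<close>
    to \<open>((x - 1) / 2, 1 + y / 2)\<close> from the rescaled half to strip coordinates.\<close>
  let ?B = "vector [vector [1 / 2, 0], vector [3 / 4 * real_of_int s, 1 / 2]] :: real ^ 2 ^ 2"
  let ?g = "\<lambda>z. ?B *v z + pt (- 1 / 2) (1 - 3 / 4 * real_of_int s)"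
  have A: "?A *v z = pt (z $ 1) (z $ 2 + 3 / 2 * real_of_int s * z $ 1)" for z
    by (simp add: mat2_mult eq_2_iff)
  have B: "?g z = pt ((z $ 1 - 1) / 2) (1 + z $ 2 / 2 + 3 / 4 * real_of_int s * (z $ 1 - 1))" for z
    by (simp add: mat2_mult eq_2_iff field_simps)
  have "continuous_map (top_of_set ?T) disco (\<lambda>z. if z $ 1 \<le> 1 then vcyl (?A *v z) else vcyl (?g z))"
  proof (rule continuous_map_cases_le)
    show "continuous_map (top_of_set ?T) euclideanreal (\<lambda>z. z $ 1)"
      "continuous_map (top_of_set ?T) euclideanreal (\<lambda>z. 1)"
      by (auto intro!: continuous_intros)
    have "continuous_on (?T \<inter> {z. z $ 1 \<le> 1}) ((*v) ?A)"
      by (intro bounded_linear.continuous_on[OF bounded_linear_matrix] continuous_intros)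
    moreover have "(*v) ?A ` (?T \<inter> {z. z $ 1 \<le> 1}) \<subseteq> ?S"
      unfolding A by (auto simp: mem_disco_rect)
    ultimately have "continuous_map (top_of_set (?T \<inter> {z. z $ 1 \<le> 1})) (top_of_set ?S) ((*v) ?A)"
      by auto
    from continuous_map_compose[OF this continuous_map_vcyl]
    show "continuous_map (subtopology (top_of_set ?T) {x \<in> topspace (top_of_set ?T). x $ 1 \<le> 1}) disco (\<lambda>z. vcyl (?A *v z))"
      by (simp only: top_of_set_Collect o_def)
    have "continuous_on (?T \<inter> {z. 1 \<le> z $ 1}) ?g"
      by (intro continuous_intros bounded_linear.continuous_on[OF bounded_linear_matrix])
    moreover have "?g ` (?T \<inter> {z. 1 \<le> z $ 1}) \<subseteq> ?S"
      unfolding B by (auto simp: mem_disco_rect)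
    ultimately have "continuous_map (top_of_set (?T \<inter> {z. 1 \<le> z $ 1})) (top_of_set ?S) ?g"
      by auto
    from continuous_map_compose[OF this continuous_map_vcyl]
    show "continuous_map (subtopology (top_of_set ?T) {x \<in> topspace (top_of_set ?T). 1 \<le> x $ 1}) disco (\<lambda>z. vcyl (?g z))"
      by (simp only: top_of_set_Collect o_def)
    fix z assume z: "z \<in> topspace (top_of_set ?T)" "z $ 1 = 1"
    have "vcyl (?g z) = vcyl (pt 0 (1 + z $ 2 / 2))"
      unfolding B using z by simp
    also have "\<dots> = disco_proj (pt (2 * 0 + 1) (2 * ((1 + z $ 2 / 2) - 1)))"
      using z by (intro vcyl_base) (auto simp: mem_disco_rect)
    also have "pt (2 * 0 + 1) (2 * ((1 + z $ 2 / 2) - 1)) = z"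
      using z by (simp add: eq_2_iff)
    also have "disco_proj z = vtwist_left s z"
      using z by (simp add: vtwist_left_boundary)
    also have "\<dots> = vcyl (?A *v z)"
      unfolding A using z by (simp add: vtwist_left_def)
    finally show "vcyl (?A *v z) = vcyl (?g z)" ..
  qed
  then show ?thesis
    by (rule continuous_map_eq) (simp only: A B vtwist_left_def)
qed

lemma continuous_map_rot: "continuous_map disco disco rot"
  using affine_with_rot homeomorphic_imp_continuous_map unfolding affine_with_def by blast

lemma continuous_map_vtwist: "continuous_map (top_of_set disco_rect) disco (vtwist s)"
proof -
  let ?r = "\<lambda>z. pt (6 - z $ 1) (1 - z $ 2)"
  have "continuous_map (top_of_set disco_rect) disco
     (\<lambda>z. if z $ 1 \<le> 3 then vtwist_left s z else rot (vtwist_left s (?r z)))"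
  proof (rule continuous_map_cases_le)
    show "continuous_map (top_of_set disco_rect) euclideanreal (\<lambda>z. z $ 1)"
      "continuous_map (top_of_set disco_rect) euclideanreal (\<lambda>z. 3)"
      by (auto intro!: continuous_intros)
    show "continuous_map (subtopology (top_of_set disco_rect) {x \<in> topspace (top_of_set disco_rect). x $ 1 \<le> 3}) disco (vtwist_left s)"
      using continuous_map_vtwist_left by (simp only: top_of_set_Collect)
    have r: "?r z = pt 6 1 - z" for z
      by (simp add: eq_2_iff)
    have "continuous_on (disco_rect \<inter> {z. 3 \<le> z $ 1}) ?r"
      unfolding r by (intro continuous_intros)
    moreover have "?r ` (disco_rect \<inter> {z. 3 \<le> z $ 1}) \<subseteq> disco_rect \<inter> {z. z $ 1 \<le> 3}"
      by (auto simp: mem_disco_rect)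
    ultimately have "continuous_map (top_of_set (disco_rect \<inter> {z. 3 \<le> z $ 1})) (top_of_set (disco_rect \<inter> {z. z $ 1 \<le> 3})) ?r"
      by auto
    from continuous_map_compose[OF continuous_map_compose[OF this continuous_map_vtwist_left] continuous_map_rot]
    show "continuous_map (subtopology (top_of_set disco_rect) {x \<in> topspace (top_of_set disco_rect). 3 \<le> x $ 1}) disco
        (\<lambda>z. rot (vtwist_left s (?r z)))"
      by (simp only: top_of_set_Collect o_def)
    fix z assume z: "z \<in> topspace (top_of_set disco_rect)" "z $ 1 = 3"
    have w: "?r z \<in> disco_rect" "?r z $ 1 = 3"
      using z by (auto simp: mem_disco_rect)
    have "pt 3 (z $ 2) = z"
      using z by (simp add: eq_2_iff)
    then show "vtwist_left s z = rot (vtwist_left s (?r z))"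
      using z w vtwist_left_boundary[of z s] vtwist_left_boundary[of "?r z" s] rot_proj[OF w(1)] by simp
  qed
  then show ?thesis
    by (rule continuous_map_eq) (simp add: vtwist_def)
qed

lemma induced_vtwist_vcyl:
  assumes "0 \<le> u" "u \<le> 1"
  shows "induced (vtwist s) (vcyl (pt u h)) = vcyl (pt u (h + 3 / 2 * real_of_int s * u))"
proof -
  obtain k :: int where k: "3 / 2 * real_of_int k \<le> pt u h $ 2" "pt u h $ 2 < 3 / 2 * (real_of_int k + 1)"
    by (rule vcyl_reduce)
  define h' where "h' = h - 3 / 2 * real_of_int k"
  have h': "0 \<le> h'" "h' \<le> 3 / 2"
    using k by (auto simp: h'_def algebra_simps)
  have per: "vcyl (pt u (x + h)) = vcyl (pt u (x + h'))" for x
    using vcyl_periodic[of u "x + h'" k] by (simp add: h'_def algebra_simps)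
  have "induced (vtwist s) (vcyl (pt u h')) = vcyl (pt u (h' + 3 / 2 * real_of_int s * u))"
  proof (cases "h' \<le> 1")
    case True
    have "pt u h' \<in> disco_rect"
      using assms h' True by (simp add: mem_disco_rect)
    then have "induced (vtwist s) (vcyl (pt u h')) = vtwist s (pt u h')"
      using vcyl_base(1)[OF assms h' True] induced_proj[OF glue_invariant_vtwist] by simp
    then show ?thesis
      using assms by (simp add: vtwist_def vtwist_left_def)
  next
    case False
    have r: "pt (2 * u + 1) (2 * (h' - 1)) \<in> disco_rect"
      using assms h' False by (simp add: mem_disco_rect)
    then have "induced (vtwist s) (vcyl (pt u h')) = vtwist s (pt (2 * u + 1) (2 * (h' - 1)))"
      using vcyl_base(2)[OF assms h'] False induced_proj[OF glue_invariant_vtwist] by simp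
    also have "\<dots> = vcyl (pt u (h' + 3 / 2 * real_of_int s * u))"
    proof (cases "u = 0")
      case True
      then show ?thesis
        using vtwist_boundary[OF r, of s] vcyl_base(2)[OF assms h'] False by simp
    next
      case F: False
      have "vtwist s (pt (2 * u + 1) (2 * (h' - 1))) =
          vcyl (pt ((2 * u + 1 - 1) / 2) (1 + 2 * (h' - 1) / 2 + 3 / 4 * real_of_int s * (2 * u + 1 - 1)))"
        unfolding vtwist_def vtwist_left_def pt_nth using assms F by (subst if_P, simp, subst if_not_P) simp_all
      also have "(2 * u + 1 - 1) / 2 = u"
        by simp
      also have "1 + 2 * (h' - 1) / 2 + 3 / 4 * real_of_int s * (2 * u + 1 - 1) = h' + 3 / 2 * real_of_int s * u"
        by (simp add: field_simps)
      finally show ?thesis .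
    qed
    finally show ?thesis .
  qed
  then show ?thesis
    using per[of 0] per[of "3 / 2 * real_of_int s * u"] by (simp add: algebra_simps)
qed

lemma vtwist_left_in_topspace:
  assumes "z \<in> disco_rect" "z $ 1 \<le> 3"
  shows "vtwist_left s z \<in> topspace disco"
  using continuous_map_image_subset_topspace[OF continuous_map_vtwist_left] assms by auto

text \<open>Built into the definition of the right half; only the common line at abscissa 3, which
  the twist fixes, has to be looked at separately.\<close>

lemma induced_vtwist_rot:
  assumes "p \<in> topspace disco"
  shows "induced (vtwist s) (rot p) = rot (induced (vtwist s) p)"
proof -
  obtain z where z: "z \<in> disco_rect" "p = disco_proj z"
    using assms by (auto simp: topspace_disco_eq)
  let ?w = "pt (6 - z $ 1) (1 - z $ 2)"
  have w: "?w \<in> disco_rect"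
    using z by (auto simp: mem_disco_rect)
  have *: "induced (vtwist s) (rot p) = vtwist s ?w" "induced (vtwist s) p = vtwist s z"
    using z w rot_proj induced_proj[OF glue_invariant_vtwist] by simp_all
  consider "z $ 1 < 3" | "z $ 1 = 3" | "3 < z $ 1" by linarith
  then show ?thesis
  proof cases
    case 1
    then show ?thesis unfolding * by (simp add: vtwist_def)
  next
    case 2
    then show ?thesis
      unfolding * using vtwist_boundary[OF z(1)] vtwist_boundary[OF w] rot_proj[OF z(1)] by simp
  next
    case 3
    then show ?thesis
      unfolding * using vtwist_left_in_topspace[OF w] by (simp add: vtwist_def rot_rot)
  qed
qed

text \<open>Dropping \<open>s k\<close> periods recentres the shear at abscissa \<open>k\<close>.
  For \<open>k\<close> equal to 0 or 1 this is a boundary line, near which points then stay inside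
  one patch.\<close>

lemma vtwist_left_strip1:
  assumes "0 \<le> z $ 1" "z $ 1 \<le> 1" and y: "0 \<le> z $ 2 + 3 / 2 * real_of_int s * (z $ 1 - real_of_int k)"
    "z $ 2 + 3 / 2 * real_of_int s * (z $ 1 - real_of_int k) \<le> 1"
  shows "vtwist_left s z = disco_proj (pt (z $ 1) (z $ 2 + 3 / 2 * real_of_int s * (z $ 1 - real_of_int k)))"
proof -
  let ?y = "z $ 2 + 3 / 2 * real_of_int s * (z $ 1 - real_of_int k)"
  have eq: "?y + 3 / 2 * real_of_int (s * k) = z $ 2 + 3 / 2 * real_of_int s * z $ 1"
    by (simp add: field_simps)
  have "vtwist_left s z = vcyl (pt (z $ 1) (?y + 3 / 2 * real_of_int (s * k)))"
    unfolding eq using assms(2) by (simp add: vtwist_left_def)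
  also have "\<dots> = vcyl (pt (z $ 1) ?y)"
    by (rule vcyl_periodic)
  also have "\<dots> = disco_proj (pt (z $ 1) ?y)"
    by (rule vcyl_base(1)) (use assms in linarith)+
  finally show ?thesis .
qed

lemma vtwist_left_strip2:
  assumes "1 < z $ 1" "z $ 1 \<le> 3" and y: "0 \<le> z $ 2 + 3 / 2 * real_of_int s * (z $ 1 - (2 * real_of_int k + 1))"
    "z $ 2 + 3 / 2 * real_of_int s * (z $ 1 - (2 * real_of_int k + 1)) \<le> 1"
  shows "vtwist_left s z = disco_proj (pt (z $ 1) (z $ 2 + 3 / 2 * real_of_int s * (z $ 1 - (2 * real_of_int k + 1))))"
proof -
  let ?y = "z $ 2 + 3 / 2 * real_of_int s * (z $ 1 - (2 * real_of_int k + 1))"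
  let ?u = "(z $ 1 - 1) / 2"
  have eq: "1 + ?y / 2 + 3 / 2 * real_of_int (s * k) = 1 + z $ 2 / 2 + 3 / 4 * real_of_int s * (z $ 1 - 1)"
    by (simp add: field_simps)
  have "vtwist_left s z = vcyl (pt ?u (1 + ?y / 2 + 3 / 2 * real_of_int (s * k)))"
    unfolding eq using assms(1) by (simp add: vtwist_left_def)
  also have "\<dots> = vcyl (pt ?u (1 + ?y / 2))"
    by (rule vcyl_periodic)
  also have "\<dots> = disco_proj (pt (2 * ?u + 1) (2 * ((1 + ?y / 2) - 1)))"
  proof -
    have "vcyl (pt ?u (1 + y / 2)) = disco_proj (pt (2 * ?u + 1) (2 * ((1 + y / 2) - 1)))" if "0 \<le> y" "y \<le> 1" for y
      using assms(1,2) that by (intro vcyl_base(2)) simp_all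
    then show ?thesis
      using y by blast
  qed
  also have "pt (2 * ?u + 1) (2 * ((1 + ?y / 2) - 1)) = pt (z $ 1) ?y"
    by (simp add: eq_2_iff field_simps)
  finally show ?thesis .
qed

lemma vtwist_right:
  assumes "3 < z $ 1" "0 \<le> y" "y \<le> 1" "z $ 1 \<le> 6"
    and "vtwist_left s (pt (6 - z $ 1) (1 - z $ 2)) = disco_proj (pt (6 - z $ 1) (1 - y))"
  shows "vtwist s z = disco_proj (pt (z $ 1) y)"
proof -
  have "pt (6 - z $ 1) (1 - y) \<in> disco_rect"
    using assms by (simp add: mem_disco_rect)
  then show ?thesis
    using assms by (simp add: vtwist_def rot_proj)
qed

lemma shear_v_mult: "shear_v s *v w + pt 0 (- 3 / 2 * real_of_int s * k) = pt (w $ 1) (w $ 2 + 3 / 2 * real_of_int s * (w $ 1 - k))"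
  by (simp add: mat2_mult eq_2_iff field_simps)

text \<open>The twist fixes the common boundary lines of the vertical pieces. Near such a line it is
  the shear about that line, read in one and the same patch for source and target.\<close>

lemma aff_at_vtwist_seam:
  assumes c: "c \<in> patches" "d \<in> pdom c" "d $ 1 = k"
    and f: "\<And>w. w \<in> pdom c \<Longrightarrow> \<bar>w $ 1 - k\<bar> < 1 \<Longrightarrow> pt (w $ 1) (w $ 2 + 3 / 2 * real_of_int s * (w $ 1 - k)) \<in> pdom c \<Longrightarrow>
      induced (vtwist s) (psi c w) = psi c (pt (w $ 1) (w $ 2 + 3 / 2 * real_of_int s * (w $ 1 - k)))"
  shows "aff_at ((*v) (shear_v s)) (\<lambda>w. induced (vtwist s) (psi c w)) d"
proof -
  let ?h = "\<lambda>w. shear_v s *v w + pt 0 (- 3 / 2 * real_of_int s * k)"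
  let ?N = "pdom c \<inter> ?h -` pdom c \<inter> {w. \<bar>w $ 1 - k\<bar> < 1}"
  have "open (?h -` pdom c)"
    by (intro open_vimage open_pdom[OF c(1)] continuous_intros bounded_linear.continuous_on[OF bounded_linear_matrix])
  moreover have "open {w :: real ^ 2. \<bar>w $ 1 - k\<bar> < 1}"
    by (intro open_Collect_less continuous_intros)
  ultimately have op: "open ?N"
    by (intro open_Int open_pdom[OF c(1)])
  have "?h d = d"
    unfolding shear_v_mult using c(3) by (simp add: eq_2_iff)
  then have d: "d \<in> ?N"
    using c by simp
  show ?thesis
  proof (rule aff_atI[OF c(1) op d zero_less_one])
    fix w assume w: "w \<in> ?N"
    then have "pt (w $ 1) (w $ 2 + 3 / 2 * real_of_int s * (w $ 1 - k)) \<in> pdom c"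
      unfolding shear_v_mult by simp
    then show "1 *\<^sub>R (shear_v s *v w) + pt 0 (- 3 / 2 * real_of_int s * k) \<in> pdom c \<and>
      induced (vtwist s) (psi c w) = psi c (1 *\<^sub>R (shear_v s *v w) + pt 0 (- 3 / 2 * real_of_int s * k))"
      using f[of w] w unfolding scaleR_one shear_v_mult by blast
  qed
qed

lemma aff_at_rot_comp:
  assumes K: "aff_at L K z" and L: "bounded_linear L"
  shows "aff_at (\<lambda>w. - L w) (\<lambda>w. rot (K w)) z"
proof -
  obtain c d where c: "c \<in> patches" "d \<in> pdom c" "K z = psi c d"
    using patches_cover aff_at_image[OF K] by blast
  have "aff_at (\<lambda>w. neg_id *v (L w)) (\<lambda>w. rot (K w)) z"
    by (rule aff_at_compose[OF K L c aff_at_rot[OF c(1,2)] bounded_linear_matrix])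
  moreover have "neg_id *v v = - v" for v
    by (simp add: mat2_mult eq_2_iff)
  ultimately show ?thesis
    by simp
qed

definition vtwist_aff :: "int \<Rightarrow> (real ^ 2) set \<Rightarrow> bool" where
  "vtwist_aff s p \<longleftrightarrow> (\<exists>K z. aff_at (\<lambda>w. w) K z \<and> K z = p \<and> aff_at ((*v) (shear_v s)) (\<lambda>w. induced (vtwist s) (K w)) z)"

text \<open>The new parametrisation is \<open>rot\<close> after \<open>K\<close> after negation. Two
  sign changes cancel, so the linear part is unaffected by the conjugation.\<close>

lemma vtwist_aff_rot:
  assumes "vtwist_aff s p"
  shows "vtwist_aff s (rot p)"
proof -
  obtain K z where K: "aff_at (\<lambda>w. w) K z" "K z = p" "aff_at ((*v) (shear_v s)) (\<lambda>w. induced (vtwist s) (K w)) z"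
    using assms unfolding vtwist_aff_def by blast
  let ?K = "\<lambda>w. rot (K (- w))"
  have neg: "bounded_linear (\<lambda>w :: real ^ 2. - w)"
    using bounded_linear_minus[OF bounded_linear_ident] .
  have "aff_at (\<lambda>w. - w) (\<lambda>w. K (- w)) (- z)"
    using aff_at_affine[of "\<lambda>w. w" K "\<lambda>w. - w" "- z" 0] K(1) neg bounded_linear_ident by simp
  then have 1: "aff_at (\<lambda>w. w) ?K (- z)"
    using aff_at_rot_comp[OF _ neg] by force
  have "aff_at (\<lambda>w. shear_v s *v (- w)) (\<lambda>w. induced (vtwist s) (K (- w))) (- z)"
    using aff_at_affine[of "(*v) (shear_v s)" "\<lambda>w. induced (vtwist s) (K w)" "\<lambda>w. - w" "- z" 0] K(3) neg bounded_linear_matrix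
    by simp
  then have "aff_at (\<lambda>w. - (shear_v s *v (- w))) (\<lambda>w. rot (induced (vtwist s) (K (- w)))) (- z)"
    by (rule aff_at_rot_comp) (rule bounded_linear_compose[OF bounded_linear_matrix neg])
  moreover have "- (shear_v s *v (- w)) = shear_v s *v w" for w
    by (simp add: mat2_mult eq_2_iff)
  ultimately have 2: "aff_at ((*v) (shear_v s)) (\<lambda>w. rot (induced (vtwist s) (K (- w)))) (- z)"
    by simp
  obtain N where N: "open N" "z \<in> N" "\<And>w. w \<in> N \<Longrightarrow> aff_at (\<lambda>w. w) K w"
    using aff_at_nearby[OF K(1)] by blast
  have op: "open ((\<lambda>w. - w) -` N)"
    by (intro open_vimage N(1) continuous_intros)
  have "aff_at ((*v) (shear_v s)) (\<lambda>w. induced (vtwist s) (?K w)) (- z)"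
  proof (rule aff_at_cong[OF 2 op])
    show "induced (vtwist s) (?K w) = rot (induced (vtwist s) (K (- w)))" if "w \<in> (\<lambda>w. - w) -` N" for w
      using induced_vtwist_rot[OF aff_at_image(1)[OF N(3), of "- w"]] that by simp
  qed (use N(2) in simp)
  with 1 K(2) show ?thesis
    unfolding vtwist_aff_def by (intro exI[of _ ?K] exI[of _ "- z"]) simp
qed

lemma vtwist_aff_vcyl:
  assumes "0 < z $ 1" "z $ 1 < 1"
  shows "vtwist_aff s (vcyl z)"
  unfolding vtwist_aff_def
proof (intro exI conjI)
  show "aff_at (\<lambda>w. w) vcyl z" "vcyl z = vcyl z"
    using aff_at_vcyl assms by auto
  have 1: "aff_at (\<lambda>w. shear_v s *v w) (\<lambda>w. vcyl (shear_v s *v w + 0)) z"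
    using aff_at_affine[of "\<lambda>w. w" vcyl "(*v) (shear_v s)" z 0] aff_at_vcyl[of "shear_v s *v z"] assms bounded_linear_matrix
    by (simp add: mat2_mult bounded_linear_ident)
  have 2: "open {w :: real ^ 2. 0 < w $ 1 \<and> w $ 1 < 1}"
    by (intro open_Collect_conj open_Collect_less continuous_intros)
  have 3: "induced (vtwist s) (vcyl w) = vcyl (shear_v s *v w + 0)" if "w \<in> {w. 0 < w $ 1 \<and> w $ 1 < 1}" for w
    using induced_vtwist_vcyl[of "w $ 1" s "w $ 2"] that by (simp add: mat2_mult add.commute)
  show "aff_at ((*v) (shear_v s)) (\<lambda>w. induced (vtwist s) (vcyl w)) z"
    by (rule aff_at_cong[OF 1 2 _ 3]) (simp_all add: assms)
qed

lemma vtwist_aff_left: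
  assumes z: "z \<in> disco_rect" "\<not> vertex z" "z $ 1 \<le> 3"
  shows "vtwist_aff s (disco_proj z)"
proof -
  let ?t = "\<lambda>w k. w $ 2 + 3 / 2 * real_of_int s * (w $ 1 - k)"
  have zb: "0 \<le> z $ 1" "0 \<le> z $ 2" "z $ 2 \<le> 1"
    using z by (auto simp: mem_disco_rect)
  have inner: "vtwist_aff s (disco_proj z)"
    if d: "z \<in> pdom inner_patch" and f: "\<And>w. w \<in> pdom inner_patch \<Longrightarrow> \<bar>w $ 1 - z $ 1\<bar> < 1 \<Longrightarrow> pt (w $ 1) (?t w (z $ 1)) \<in> pdom inner_patch \<Longrightarrow>
      vtwist s w = disco_proj (pt (w $ 1) (?t w (z $ 1)))"
  proof -
    have r: "w \<in> disco_rect" if "w \<in> pdom inner_patch" for w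
      using that by (simp add: inner_patch_simps mem_box_pt mem_disco_rect)
    have psi: "psi inner_patch w = disco_proj w" if "w \<in> pdom inner_patch" for w
      using r[OF that] by (simp add: psi_def)
    have "aff_at ((*v) (shear_v s)) (\<lambda>w. induced (vtwist s) (psi inner_patch w)) z"
      by (rule aff_at_vtwist_seam[OF inner_patch_in d refl])
        (use f psi r induced_proj[OF glue_invariant_vtwist] in auto)
    then show ?thesis
      unfolding vtwist_aff_def using aff_at_psi[OF inner_patch_in d] psi[OF d] by metis
  qed
  consider "z $ 1 = 0" | "0 < z $ 1" "z $ 1 < 1" | "z $ 1 = 1" | "1 < z $ 1" "z $ 1 < 3" | "z $ 1 = 3"
    using zb z(3) by linarith
  then show ?thesis
  proof cases
    case 1
    then have z2: "0 < z $ 2" "z $ 2 < 1"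
      using z zb by (auto simp: vertex_def le_less)
    \<comment> \<open>The line at abscissa 0 is seen at abscissa 6 of the side patch, with the right
      cylinder on its left and the left cylinder, translated by 6, on its right.\<close>
    let ?d = "pt 6 (z $ 2)"
    have d: "?d \<in> pdom side_patch" "?d $ 1 = 6"
      using z2 by (auto simp: side_patch_simps mem_box_pt)
    have "aff_at ((*v) (shear_v s)) (\<lambda>w. induced (vtwist s) (psi side_patch w)) ?d"
    proof (rule aff_at_vtwist_seam[OF side_patch_in d])
      fix w assume "w \<in> pdom side_patch" and "\<bar>w $ 1 - 6\<bar> < 1" and "pt (w $ 1) (?t w 6) \<in> pdom side_patch"
      then have w: "0 < w $ 2" "w $ 2 < 1" "0 < ?t w 6" "?t w 6 < 1" "5 < w $ 1" "w $ 1 < 7"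
        by (auto simp: side_patch_simps mem_box_pt abs_less_iff)
      show "induced (vtwist s) (psi side_patch w) = psi side_patch (pt (w $ 1) (?t w 6))"
      proof (cases "w $ 1 \<le> 6")
        case True
        have "vtwist s w = disco_proj (pt (w $ 1) (?t w 6))"
        proof (rule vtwist_right)
          have key: "(1 - w $ 2) + 3 / 2 * real_of_int s * ((6 - w $ 1) - real_of_int 0) = 1 - ?t w 6"
            by (simp add: field_simps)
          show "vtwist_left s (pt (6 - w $ 1) (1 - w $ 2)) = disco_proj (pt (6 - w $ 1) (1 - ?t w 6))"
            using w True by (intro vtwist_left_strip1[of "pt (6 - w $ 1) (1 - w $ 2)" s 0, unfolded pt_nth key]) linarith+
        qed (use w True in linarith)+
        moreover have "w \<in> disco_rect" "pt (w $ 1) (?t w 6) \<in> disco_rect"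
          using w True by (auto simp: mem_disco_rect)
        ultimately show ?thesis
          using induced_proj[OF glue_invariant_vtwist] by (simp add: psi_def)
      next
        case False
        let ?w = "pt (w $ 1 - 6) (w $ 2)"
        have "vtwist_left s ?w = disco_proj (pt (?w $ 1) (?w $ 2 + 3 / 2 * real_of_int s * (?w $ 1 - real_of_int 0)))"
          using w False by (intro vtwist_left_strip1) simp_all
        then have "vtwist s ?w = disco_proj (pt (w $ 1 - 6) (?t w 6))"
          using w by (simp add: vtwist_def)
        moreover have "?w \<in> disco_rect"
          using w False by (auto simp: mem_disco_rect)
        ultimately show ?thesis
          using False induced_proj[OF glue_invariant_vtwist, of ?w]
          by (simp add: psi_def mem_disco_rect side_patch_simps)
      qed
    qed
    moreover have "psi side_patch ?d = disco_proj z"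
      using 1 zb disco_proj_glue[of z ?d] by (simp add: psi_def mem_disco_rect disco_glue_iff)
    ultimately show ?thesis
      unfolding vtwist_aff_def using aff_at_psi[OF side_patch_in d(1)] by metis
  next
    case 2
    then show ?thesis
      using vtwist_aff_vcyl[of z s] vcyl_base(1)[of "z $ 1" "z $ 2"] zb by simp
  next
    case 3
    have "z \<in> pdom inner_patch"
      using 3 z zb by (auto simp: vertex_def le_less inner_patch_simps mem_box_pt)
    then show ?thesis
    proof (rule inner)
      fix w assume "w \<in> pdom inner_patch" and "\<bar>w $ 1 - z $ 1\<bar> < 1" "pt (w $ 1) (?t w (z $ 1)) \<in> pdom inner_patch"
      then have w: "0 < w $ 1" "w $ 1 < 2" "0 < ?t w 1" "?t w 1 < 1"
        using 3 by (auto simp: inner_patch_simps mem_box_pt abs_less_iff)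
      show "vtwist s w = disco_proj (pt (w $ 1) (?t w (z $ 1)))"
        using w vtwist_left_strip1[of w s 1] vtwist_left_strip2[of w s 0] unfolding 3
        by (cases "w $ 1 \<le> 1") (simp_all add: vtwist_def)
    qed
  next
    case 4
    have "vcyl (pt ((z $ 1 - 1) / 2) (1 + z $ 2 / 2)) = disco_proj (pt (2 * ((z $ 1 - 1) / 2) + 1) (2 * ((1 + z $ 2 / 2) - 1)))"
      using 4 zb by (intro vcyl_base(2)) auto
    also have "pt (2 * ((z $ 1 - 1) / 2) + 1) (2 * ((1 + z $ 2 / 2) - 1)) = z"
      by (simp add: eq_2_iff field_simps)
    finally show ?thesis
      using vtwist_aff_vcyl[of "pt ((z $ 1 - 1) / 2) (1 + z $ 2 / 2)" s] 4 by simp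
  next
    case 5
    have "z \<in> pdom inner_patch"
      using 5 z zb by (auto simp: vertex_def le_less inner_patch_simps mem_box_pt)
    then show ?thesis
    proof (rule inner)
      fix w assume "w \<in> pdom inner_patch" and "\<bar>w $ 1 - z $ 1\<bar> < 1" "pt (w $ 1) (?t w (z $ 1)) \<in> pdom inner_patch"
      then have w: "2 < w $ 1" "w $ 1 < 4" "0 < ?t w 3" "?t w 3 < 1"
        using 5 by (auto simp: inner_patch_simps mem_box_pt abs_less_iff)
      show "vtwist s w = disco_proj (pt (w $ 1) (?t w (z $ 1)))"
      proof (cases "w $ 1 \<le> 3")
        case True
        then show ?thesis
          using w vtwist_left_strip2[of w s 1] unfolding 5 by (simp add: vtwist_def)
      next
        case False
        show ?thesis
          unfolding 5
        proof (rule vtwist_right)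
          have key: "(1 - w $ 2) + 3 / 2 * real_of_int s * ((6 - w $ 1) - (2 * real_of_int 1 + 1)) = 1 - ?t w 3"
            by (simp add: field_simps)
          show "vtwist_left s (pt (6 - w $ 1) (1 - w $ 2)) = disco_proj (pt (6 - w $ 1) (1 - ?t w 3))"
            using w False by (intro vtwist_left_strip2[of "pt (6 - w $ 1) (1 - w $ 2)" s 1, unfolded pt_nth key]) linarith+
        qed (use w False in linarith)+
      qed
    qed
  qed
qed

lemma affine_with_vtwist: "affine_with (shear_v s) (induced (vtwist s))"
proof (rule affine_with_induced[OF glue_invariant_vtwist continuous_map_vtwist glue_invariant_vtwist[of "- s"] continuous_map_vtwist])
  have inv: "induced (vtwist (- s)) (vtwist s z) = disco_proj z" if z: "z \<in> disco_rect" for s z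
  proof -
    have left: "induced (vtwist (- s)) (vtwist_left s z) = disco_proj z" if z: "z \<in> disco_rect" "z $ 1 \<le> 3" for z
    proof -
      obtain u h where "0 \<le> u" "u \<le> 1" "disco_proj z = vcyl (pt u h)"
        "vtwist_left s z = vcyl (pt u (h + 3 / 2 * real_of_int s * u))"
        using vtwist_left_lift[OF z] by metis
      then show ?thesis
        by (simp add: induced_vtwist_vcyl)
    qed
    show ?thesis
    proof (cases "z $ 1 \<le> 3")
      case True
      then show ?thesis using left[OF z] by (simp add: vtwist_def)
    next
      case False
      let ?w = "pt (6 - z $ 1) (1 - z $ 2)"
      have w: "?w \<in> disco_rect" "?w $ 1 \<le> 3"
        using z False by (auto simp: mem_disco_rect)
      then show ?thesis
        using False left[OF w] vtwist_left_in_topspace[OF w] rot_proj[OF w(1)]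
        by (simp add: vtwist_def induced_vtwist_rot)
    qed
  qed
  show "induced (vtwist (- s)) (vtwist s z) = disco_proj z" "induced (vtwist s) (vtwist (- s) z) = disco_proj z"
    if "z \<in> disco_rect" for z
    using inv[OF that, of s] inv[OF that, of "- s"] by simp_all
  show "vtwist s z \<in> disco_sing" "vtwist (- s) z \<in> disco_sing" if "vertex z" for z
    using that vtwist_boundary[OF vertex_imp_rect[OF that]] disco_proj_in_sing_iff[OF vertex_imp_rect[OF that]]
    by (auto simp: vertex_def)
  fix p assume p: "p \<in> topspace disco" "p \<notin> disco_sing"
  then obtain z where z: "z \<in> disco_rect" "p = disco_proj z"
    by (auto simp: topspace_disco_eq)
  then have nv: "\<not> vertex z"
    using p(2) disco_proj_in_sing_iff by blast
  have "vtwist_aff s p"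
  proof (cases "z $ 1 \<le> 3")
    case True
    then show ?thesis using vtwist_aff_left z nv by simp
  next
    case False
    let ?w = "pt (6 - z $ 1) (1 - z $ 2)"
    have w: "?w \<in> disco_rect" "\<not> vertex ?w" "?w $ 1 \<le> 3"
      using z nv False by (auto simp: mem_disco_rect vertex_def)
    then show ?thesis
      using vtwist_aff_rot[OF vtwist_aff_left[OF w]] rot_proj[OF w(1)] z(2) by simp
  qed
  then show "\<exists>K z. aff_at (\<lambda>w. w) K z \<and> K z = p \<and> aff_at ((*v) (shear_v s)) (\<lambda>w. induced (vtwist s) (K w)) z"
    unfolding vtwist_aff_def .
qed (simp add: det_mat2)

section \<open>The group \<open>disco_Gamma\<close> acts by affine maps\<close>

lemma mat2_times:
  "(vector [vector [a, b], vector [c, d]] :: real ^ 2 ^ 2) ** (vector [vector [a', b'], vector [c', d']] :: real ^ 2 ^ 2) =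
     vector [vector [a * a' + b * c', a * b' + b * d'], vector [c * a' + d * c', c * b' + d * d']]"
  by (simp add: vec_eq_iff forall_2 matrix_matrix_mult_def sum_2 vector_2)

lemma mat2_one: "vector [vector [1, 0], vector [0, 1]] = (mat 1 :: real ^ 2 ^ 2)"
  by (simp add: vec_eq_iff forall_2 mat_def vector_2)

lemma SL2R_simps: "carrier SL2R = {A. det A = 1}" "A \<otimes>\<^bsub>SL2R\<^esub> B = A ** B" "\<one>\<^bsub>SL2R\<^esub> = mat 1"
  by (simp_all add: SL2R_def)

lemma inv_SL2R:
  assumes "B ** A = mat 1" "det A = 1" "det B = 1"
  shows "inv\<^bsub>SL2R\<^esub> A = B"
  using group.inv_equality[OF group_SL2R, of B A] assms by (simp add: SL2R_simps)

lemma disco_Gamma_eq: "disco_Gamma = generate SL2R {shear_h 1, shear_v 1, neg_id}"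
  by (simp add: disco_Gamma_def)

text \<open>Inverses of the generators are supplied by the twists with \<open>s = -1\<close> and by
  the half turn itself.\<close>

lemma disco_Gamma_subset_Veech: "disco_Gamma \<subseteq> disco_Veech"
proof
  have veech: "affine_with M f \<Longrightarrow> M \<in> disco_Veech" for M f
    by (auto simp: disco_Veech_eq)
  fix M assume "M \<in> disco_Gamma"
  then show "M \<in> disco_Veech"
    unfolding disco_Gamma_eq
  proof (induction rule: generate.induct)
    case one
    then show ?case
      using veech[OF affine_with_htwist[of 0]] by (simp add: mat2_one SL2R_simps)
  next
    case (incl h)
    then show ?case
      using veech[OF affine_with_htwist[of 1]] veech[OF affine_with_vtwist[of 1]] veech[OF affine_with_rot]
      by auto
  next
    case (inv h)
    have "inv\<^bsub>SL2R\<^esub> shear_h 1 = shear_h (-1)" "inv\<^bsub>SL2R\<^esub> shear_v 1 = shear_v (-1)" "inv\<^bsub>SL2R\<^esub> neg_id = neg_id"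
      by (rule inv_SL2R; simp add: mat2_times mat2_one det_mat2)+
    then show ?case
      using inv veech[OF affine_with_htwist[of "-1"]] veech[OF affine_with_vtwist[of "-1"]] veech[OF affine_with_rot]
      by auto
  next
    case (eng h1 h2)
    then obtain f1 f2 where "affine_with h1 f1" "affine_with h2 f2"
      by (auto simp: disco_Veech_eq)
    then show ?case
      using veech[OF affine_with_compose[of h2 f2 h1 f1]] unfolding SL2R_simps by blast
  qed
qed

section \<open>Comparing germs with the horizontal cylinder\<close>

lemma aff_at_match:
  fixes K :: "real ^ 2 \<Rightarrow> (real ^ 2) set"
  assumes G: "aff_at L G z0" "bounded_linear L" and K: "aff_at (\<lambda>w. w) K w0" "K w0 = G z0"
  obtains N \<mu> where "open N" "z0 \<in> N" "\<mu> > 0" "\<And>z. z \<in> N \<Longrightarrow> G z = K (w0 + \<mu> *\<^sub>R L (z - z0))"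
proof -
  obtain c d where c: "c \<in> patches" "d \<in> pdom c" "G z0 = psi c d"
    using patches_cover aff_at_image[OF G(1)] by blast
  obtain N1 \<mu> where N1: "open N1" "z0 \<in> N1" "\<mu> > 0"
    "\<And>z. z \<in> N1 \<Longrightarrow> d + \<mu> *\<^sub>R L (z - z0) \<in> pdom c \<and> G z = psi c (d + \<mu> *\<^sub>R L (z - z0))"
    using aff_atE[OF G c] by blast
  have Kc: "K w0 = psi c d"
    using c(3) K(2) by simp
  obtain N2 \<nu> where N2: "open N2" "w0 \<in> N2" "\<nu> > 0"
    "\<And>w. w \<in> N2 \<Longrightarrow> d + \<nu> *\<^sub>R (w - w0) \<in> pdom c \<and> K w = psi c (d + \<nu> *\<^sub>R (w - w0))"
    using aff_atE[OF K(1) bounded_linear_ident c(1,2) Kc] by blast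
  let ?h = "\<lambda>z. w0 + (\<mu> / \<nu>) *\<^sub>R L (z - z0)"
  have "open (?h -` N2)"
    by (intro open_vimage N2(1) continuous_intros bounded_linear.continuous_on[OF G(2)])
  then have op: "open (N1 \<inter> ?h -` N2)"
    using N1(1) by blast
  show thesis
  proof (rule that[OF op])
    show "z0 \<in> N1 \<inter> ?h -` N2"
      using N1 N2 linear_0[OF bounded_linear.linear[OF G(2)]] by simp
    show "\<mu> / \<nu> > 0"
      using N1 N2 by simp
    fix z assume z: "z \<in> N1 \<inter> ?h -` N2"
    then have "K (?h z) = psi c (d + \<nu> *\<^sub>R (?h z - w0))"
      using N2(4)[of "?h z"] by simp
    also have "\<nu> *\<^sub>R (?h z - w0) = \<mu> *\<^sub>R L (z - z0)"
      using N2(3) by simp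
    finally show "G z = K (?h z)"
      using N1(4)[of z] z by simp
  qed
qed

lemma aff_at_cyl_affine:
  assumes "\<mu> > 0" "bounded_linear L" "0 < (w0 + \<mu> *\<^sub>R L z) $ 2" "(w0 + \<mu> *\<^sub>R L z) $ 2 < 1"
  shows "aff_at L (\<lambda>z. cyl (w0 + \<mu> *\<^sub>R L z)) z"
proof -
  have "aff_at (\<lambda>z. \<mu> *\<^sub>R L z) (\<lambda>z. cyl (\<mu> *\<^sub>R L z + w0)) z"
    using aff_at_affine[of "\<lambda>w. w" cyl "\<lambda>z. \<mu> *\<^sub>R L z" z w0] aff_at_cyl assms
      bounded_linear_compose[OF bounded_linear_scaleR_right assms(2)] bounded_linear_ident
    by (simp add: add.commute)
  then show ?thesis
    using aff_at_scale[OF _ assms(1)] by (simp add: add.commute)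
qed

text \<open>Extends an identity from an open region, where continuation works, to boundary points
  whose images may be singular.\<close>

lemma closed_agreement:
  assumes "continuous_map (top_of_set T) disco g" "continuous_map (top_of_set T) disco h"
    and "\<And>x. x \<in> A \<Longrightarrow> g x = h x" "A \<subseteq> T" "x \<in> closure A" "x \<in> T"
  shows "g x = h x"
proof -
  have "closedin (top_of_set T) {x \<in> topspace (top_of_set T). g x = h x}"
    by (rule closedin_continuous_maps_eq[OF Hausdorff_space_disco assms(1,2)])
  then obtain C where C: "closed C" "{x \<in> T. g x = h x} = T \<inter> C"
    by (auto simp: closedin_closed)
  have "A \<subseteq> C"
    using C(2) assms(3,4) by blast
  then have "closure A \<subseteq> C"
    using C(1) by (rule closure_minimal)
  then show ?thesis
    using C(2) assms(5,6) by blast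
qed

section \<open>Straight lines\<close>

text \<open>Such a line is defined for all times and never meets a singular point, because
  \<open>aff_at\<close> forces nonsingular values.\<close>

definition geod :: "real ^ 2 \<Rightarrow> (real \<Rightarrow> (real ^ 2) set) \<Rightarrow> bool" where
  "geod v \<gamma> \<longleftrightarrow> (\<forall>s. aff_at (\<lambda>s. s *\<^sub>R v) \<gamma> s)"

lemma bounded_linear_dir: "bounded_linear (\<lambda>s. s *\<^sub>R (v :: real ^ 2))"
  by (rule bounded_linear_scaleR_left)

lemma geod_continuous: "geod v \<gamma> \<Longrightarrow> continuous_map euclideanreal disco \<gamma>"
  using continuous_map_aff_at[OF open_UNIV bounded_linear_dir, of v \<gamma>] by (simp add: geod_def)

text \<open>From the time \<open>\<sigma>\<close> on, the line climbs through the rectangle with vertical speed \<open>\<mu>\<close>, starting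
  from abscissa \<open>x\<close> at the bottom. Traversing a side multiplies the speed by the slope of the gluing.\<close>

definition rising :: "(real \<Rightarrow> (real ^ 2) set) \<Rightarrow> real \<Rightarrow> real \<Rightarrow> real \<Rightarrow> real \<Rightarrow> bool" where
  "rising \<gamma> t \<sigma> x \<mu> \<longleftrightarrow> \<mu> > 0 \<and>
     (\<forall>s. \<sigma> \<le> s \<and> s \<le> \<sigma> + 1 / \<mu> \<longrightarrow> \<gamma> s = cyl (pt (x + \<mu> * (s - \<sigma>) * t) (\<mu> * (s - \<sigma>))))"

lemma risingD:
  assumes "rising \<gamma> t \<sigma> x \<mu>" "\<sigma> \<le> s" "s \<le> \<sigma> + 1 / \<mu>"
  shows "\<gamma> s = cyl (pt (x + \<mu> * (s - \<sigma>) * t) (\<mu> * (s - \<sigma>)))"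
  using assms unfolding rising_def by blast

text \<open>A short interval of agreement suffices: continuation spreads it over the open crossing,
  continuity to the two end times.\<close>

lemma risingI:
  assumes g: "geod (pt t 1) \<gamma>" and \<mu>: "\<mu> > 0" and ab: "\<sigma> \<le> a" "a < b" "b \<le> \<sigma> + 1 / \<mu>"
    and eq: "\<And>s. a < s \<Longrightarrow> s < b \<Longrightarrow> \<gamma> s = cyl (pt (x + \<mu> * (s - \<sigma>) * t) (\<mu> * (s - \<sigma>)))"
  shows "rising \<gamma> t \<sigma> x \<mu>"
proof -
  let ?w = "pt (x - \<mu> * \<sigma> * t) (- \<mu> * \<sigma>)"
  let ?H = "\<lambda>s. cyl (?w + \<mu> *\<^sub>R (s *\<^sub>R pt t 1))"
  have H: "?w + \<mu> *\<^sub>R (s *\<^sub>R pt t 1) = pt (x + \<mu> * (s - \<sigma>) * t) (\<mu> * (s - \<sigma>))" for s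
    by (simp add: eq_2_iff algebra_simps)
  let ?D = "{\<sigma><..<\<sigma> + 1 / \<mu>}"
  have D: "0 < \<mu> * (s - \<sigma>) \<and> \<mu> * (s - \<sigma>) < 1" if "s \<in> ?D" for s
    using that \<mu> by (auto simp: field_simps)
  have inner: "\<gamma> s = ?H s" if s: "s \<in> ?D" for s
  proof (rule aff_at_identity[of ?D "\<lambda>s. s *\<^sub>R pt t 1" \<gamma> ?H "{a<..<b}" "(a + b) / 2"])
    show "aff_at (\<lambda>s. s *\<^sub>R pt t 1) ?H s" if "s \<in> ?D" for s
      using aff_at_cyl_affine[OF \<mu> bounded_linear_dir[of "pt t 1"], of ?w s] D[OF that] unfolding H by simp
    show "\<gamma> s = ?H s" if "s \<in> {a<..<b}" for s
      unfolding H using eq[of s] that by simp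
    show "aff_at (\<lambda>s. s *\<^sub>R pt t 1) \<gamma> s" for s
      using g by (simp add: geod_def)
  qed (use s ab bounded_linear_dir in auto)
  have "\<gamma> s = ?H s" if s: "s \<in> {\<sigma>..\<sigma> + 1 / \<mu>}" for s
  proof (rule closed_agreement[of "{\<sigma>..\<sigma> + 1 / \<mu>}" \<gamma> ?H ?D])
    show "continuous_map (top_of_set {\<sigma>..\<sigma> + 1 / \<mu>}) disco \<gamma>"
      using geod_continuous[OF g] by (rule continuous_map_from_subtopology)
    have "continuous_map (top_of_set {\<sigma>..\<sigma> + 1 / \<mu>}) (top_of_set {z :: real ^ 2. 0 \<le> z $ 2 \<and> z $ 2 \<le> 1}) (\<lambda>s. ?w + \<mu> *\<^sub>R (s *\<^sub>R pt t 1))"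
    proof -
      have "continuous_on {\<sigma>..\<sigma> + 1 / \<mu>} (\<lambda>s. ?w + \<mu> *\<^sub>R (s *\<^sub>R pt t 1))"
        by (intro continuous_intros)
      moreover have "(\<lambda>s. ?w + \<mu> *\<^sub>R (s *\<^sub>R pt t 1)) ` {\<sigma>..\<sigma> + 1 / \<mu>} \<subseteq> {z :: real ^ 2. 0 \<le> z $ 2 \<and> z $ 2 \<le> 1}"
        unfolding H using \<mu> by (auto simp: field_simps)
      ultimately show ?thesis by auto
    qed
    from continuous_map_compose[OF this continuous_map_cyl]
    show "continuous_map (top_of_set {\<sigma>..\<sigma> + 1 / \<mu>}) disco ?H"
      by (simp add: o_def)
    show "s \<in> closure ?D"
      using s \<mu> by simp
  qed (use inner s in auto)
  then show ?thesis
    unfolding rising_def H using \<mu> by auto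
qed

text \<open>The line through \<open>z\<close> is prolonged backwards to height 0. With direction
  \<open>(t, 1)\<close> it starts at abscissa \<open>z $ 1 - z $ 2 * t\<close>.\<close>

lemma rising_start:
  assumes g: "geod (pt t 1) \<gamma>" and z: "\<gamma> s0 = cyl z" "0 < z $ 2" "z $ 2 < 1"
  obtains \<sigma> \<mu> where "rising \<gamma> t \<sigma> (z $ 1 - z $ 2 * t) \<mu>"
proof -
  have "aff_at (\<lambda>s. s *\<^sub>R pt t 1) \<gamma> s0"
    using g by (simp add: geod_def)
  then obtain N \<mu> where N: "open N" "s0 \<in> N" "\<mu> > 0"
    "\<And>s. s \<in> N \<Longrightarrow> \<gamma> s = cyl (z + \<mu> *\<^sub>R ((s - s0) *\<^sub>R pt t 1))"
    using aff_at_match[OF _ bounded_linear_dir aff_at_cyl[OF z(2,3)]] z(1) by metis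
  obtain e where e: "e > 0" "ball s0 e \<subseteq> N"
    using N(1,2) open_contains_ball by blast
  define \<sigma> where "\<sigma> = s0 - z $ 2 / \<mu>"
  define b where "b = min (s0 + e) (\<sigma> + 1 / \<mu>)"
  have mz: "\<mu> * \<sigma> = \<mu> * s0 - z $ 2"
    using N(3) by (simp add: \<sigma>_def algebra_simps)
  have s0: "\<sigma> < s0" "s0 < \<sigma> + 1 / \<mu>"
    using z(2,3) N(3) by (auto simp: \<sigma>_def field_simps)
  have "rising \<gamma> t \<sigma> (z $ 1 - z $ 2 * t) \<mu>"
  proof (rule risingI[OF g N(3)])
    show "\<sigma> \<le> s0" "s0 < b" "b \<le> \<sigma> + 1 / \<mu>"
      using s0 e by (auto simp: b_def)
    fix s assume "s0 < s" "s < b"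
    then have "s \<in> N"
      using e by (auto simp: b_def dist_real_def subset_iff)
    then have "\<gamma> s = cyl (z + \<mu> *\<^sub>R ((s - s0) *\<^sub>R pt t 1))"
      by (rule N(4))
    also have "z + \<mu> *\<^sub>R ((s - s0) *\<^sub>R pt t 1) = pt (z $ 1 - z $ 2 * t + \<mu> * (s - \<sigma>) * t) (\<mu> * (s - \<sigma>))"
    proof -
      have q: "\<mu> * (s - \<sigma>) = \<mu> * (s - s0) + z $ 2"
        using mz by (simp add: algebra_simps)
      show ?thesis
        unfolding q by (simp add: eq_2_iff algebra_simps)
    qed
    finally show "\<gamma> s = cyl (pt (z $ 1 - z $ 2 * t + \<mu> * (s - \<sigma>) * t) (\<mu> * (s - \<sigma>)))" .
  qed
  then show thesis by (rule that)
qed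

lemma edge_of_top:
  assumes "cyl (pt X 1) \<notin> disco_sing"
  obtains lo hi a b and k :: int where "(lo, hi, a, b) \<in> edges" "lo < X - 6 * real_of_int k" "X - 6 * real_of_int k < hi"
proof -
  obtain k :: int where k: "6 * real_of_int k \<le> pt X 1 $ 1" "pt X 1 $ 1 < 6 * (real_of_int k + 1)"
    by (rule cyl_reduce)
  define Y where "Y = X - 6 * real_of_int k"
  have "Y \<notin> {0, 1, 3, 5}"
    using cyl_in_sing_iff[of "pt X 1"] assms unfolding Y_def by auto
  moreover have "0 \<le> Y" "Y < 6"
    using k by (auto simp: Y_def)
  ultimately have "0 < Y \<and> Y < 1 \<or> 1 < Y \<and> Y < 3 \<or> 3 < Y \<and> Y < 5 \<or> 5 < Y \<and> Y < 6"
    by auto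
  moreover have "(0, 1, 2, 1) \<in> edges" "(1, 3, 1/2, -1/2) \<in> edges" "(3, 5, 1/2, 7/2) \<in> edges" "(5, 6, 2, -7) \<in> edges"
    by (auto simp: edges_def)
  ultimately show thesis
    using that unfolding Y_def by blast
qed

text \<open>The line is nonsingular at the top, so it leaves through the interior of one side. The
  edge patch there shows it on both sides of the crossing as one straight segment.\<close>

lemma rising_step:
  assumes g: "geod (pt t 1) \<gamma>" and r: "rising \<gamma> t \<sigma> x \<mu>"
  obtains lo hi a b and k :: int where "(lo, hi, a, b) \<in> edges"
    "lo < x + t - 6 * real_of_int k" "x + t - 6 * real_of_int k < hi"
    "rising \<gamma> t (\<sigma> + 1 / \<mu>) (a * (x + t - 6 * real_of_int k) + b) (a * \<mu>)"
proof -
  have \<mu>: "\<mu> > 0"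
    using r by (simp add: rising_def)
  define s1 where "s1 = \<sigma> + 1 / \<mu>"
  have "\<gamma> s1 = cyl (pt (x + \<mu> * (s1 - \<sigma>) * t) (\<mu> * (s1 - \<sigma>)))"
    by (rule risingD[OF r]) (use \<mu> in \<open>simp_all add: s1_def\<close>)
  then have top: "\<gamma> s1 = cyl (pt (x + t) 1)"
    using \<mu> by (simp add: s1_def)
  have aff: "aff_at (\<lambda>s. s *\<^sub>R pt t 1) \<gamma> s1"
    using g by (simp add: geod_def)
  then have "cyl (pt (x + t) 1) \<notin> disco_sing"
    using aff_at_image(2) top by metis
  then obtain lo hi a b and k :: int where e: "(lo, hi, a, b) \<in> edges"
    "lo < x + t - 6 * real_of_int k" "x + t - 6 * real_of_int k < hi"
    by (rule edge_of_top)
  define X where "X = x + t - 6 * real_of_int k"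
  define c where "c = edge_patch (lo, hi, a, b)"
  have c: "c \<in> patches"
    using e by (auto simp: c_def patches_def)
  have a: "0 < a" and lohi: "0 \<le> lo" "hi \<le> 6"
    using edges_bounds[OF e(1)] by auto
  have d: "pt X 1 \<in> pdom c"
    using e a by (simp add: c_def edge_patch_simps mem_box_pt X_def)
  have "cyl (pt (X + 6 * real_of_int k) 1) = cyl (pt X 1)"
    by (rule cyl_periodic)
  moreover have "cyl (pt X 1) = disco_proj (pt X 1)"
    using e lohi by (intro cyl_rect) (simp add: mem_disco_rect X_def)
  moreover have "psi c (pt X 1) = disco_proj (pt X 1)"
    using e lohi by (simp add: psi_def mem_disco_rect X_def)
  ultimately have "\<gamma> s1 = psi c (pt X 1)"
    using top by (simp add: X_def)
  then obtain N \<nu> where N: "open N" "s1 \<in> N" "\<nu> > 0"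
    "\<And>s. s \<in> N \<Longrightarrow> pt X 1 + \<nu> *\<^sub>R ((s - s1) *\<^sub>R pt t 1) \<in> pdom c \<and> \<gamma> s = psi c (pt X 1 + \<nu> *\<^sub>R ((s - s1) *\<^sub>R pt t 1))"
    using aff_atE[OF aff bounded_linear_dir c d] by metis
  have lin: "pt X 1 + \<nu> *\<^sub>R ((s - s1) *\<^sub>R pt t 1) = pt (X + \<nu> * (s - s1) * t) (1 + \<nu> * (s - s1))" for s
    by (simp add: eq_2_iff algebra_simps)
  obtain \<epsilon> where \<epsilon>: "\<epsilon> > 0" "ball s1 \<epsilon> \<subseteq> N"
    using N(1,2) open_contains_ball by blast
  have near: "s \<in> N" if "\<bar>s - s1\<bar> < \<epsilon>" for s
    using that \<epsilon>(2) by (auto simp: dist_real_def subset_iff abs_minus_commute)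
  \<comment> \<open>The speed in the patch is identified just before the crossing: interior heights
    are determined by \<open>cyl\<close>, and both descriptions have height 1 at time
    \<open>s1\<close>.\<close>
  have "\<nu> = \<mu>"
  proof -
    define s where "s = s1 - min (\<epsilon> / 2) (1 / (2 * \<mu>))"
    have s: "s < s1" "\<bar>s - s1\<bar> < \<epsilon>" "\<sigma> < s"
      using \<epsilon> \<mu> by (auto simp: s_def s1_def min_def field_simps)
    have h: "0 < \<mu> * (s - \<sigma>)" "\<mu> * (s - \<sigma>) < 1"
      using s \<mu> by (auto simp: s1_def field_simps)
    have m: "pt (X + \<nu> * (s - s1) * t) (1 + \<nu> * (s - s1)) \<in> pdom c"
      "\<gamma> s = psi c (pt (X + \<nu> * (s - s1) * t) (1 + \<nu> * (s - s1)))"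
      using N(4)[OF near[OF s(2)]] unfolding lin by auto
    have le: "1 + \<nu> * (s - s1) \<le> 1"
      using s(1) N(3) by (simp add: mult_le_0_iff)
    then have "pt (X + \<nu> * (s - s1) * t) (1 + \<nu> * (s - s1)) \<in> disco_rect"
      using edge_rect_iff(1)[OF e(1), folded c_def, OF m(1)] by simp
    then have "\<gamma> s = cyl (pt (X + \<nu> * (s - s1) * t) (1 + \<nu> * (s - s1)))"
      using m(2) by (simp add: psi_def cyl_rect)
    moreover have "\<gamma> s = cyl (pt (x + \<mu> * (s - \<sigma>) * t) (\<mu> * (s - \<sigma>)))"
      by (rule risingD[OF r]) (use s in \<open>simp_all add: s1_def\<close>)
    moreover have "0 \<le> 1 + \<nu> * (s - s1)"
      using m(1) by (simp add: c_def edge_patch_simps mem_box_pt)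
    ultimately have "\<mu> * (s - \<sigma>) = 1 + \<nu> * (s - s1)"
      using cyl_eq_iff[of "pt (x + \<mu> * (s - \<sigma>) * t) (\<mu> * (s - \<sigma>))" "pt (X + \<nu> * (s - s1) * t) (1 + \<nu> * (s - s1))"] h le
      by simp
    also have "1 = \<mu> * (s1 - \<sigma>)"
      using \<mu> by (simp add: s1_def)
    finally have "\<mu> * (s - s1) = \<nu> * (s - s1)"
      by (simp add: algebra_simps)
    with s show ?thesis by simp
  qed
  have "rising \<gamma> t s1 (a * X + b) (a * \<mu>)"
  proof (rule risingI[OF g])
    show "0 < a * \<mu>" "s1 \<le> s1" "s1 < s1 + min \<epsilon> (1 / (a * \<mu>))" "s1 + min \<epsilon> (1 / (a * \<mu>)) \<le> s1 + 1 / (a * \<mu>)"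
      using a \<mu> \<epsilon> by auto
    fix s assume s: "s1 < s" "s < s1 + min \<epsilon> (1 / (a * \<mu>))"
    then have "\<bar>s - s1\<bar> < \<epsilon>" by auto
    then have m: "pt (X + \<mu> * (s - s1) * t) (1 + \<mu> * (s - s1)) \<in> pdom c"
      "\<gamma> s = psi c (pt (X + \<mu> * (s - s1) * t) (1 + \<mu> * (s - s1)))"
      using N(4)[OF near] lin \<open>\<nu> = \<mu>\<close> by auto
    have "0 < \<mu> * (s - s1)"
      using s \<mu> by simp
    then have r: "pglue c (pt (X + \<mu> * (s - s1) * t) (1 + \<mu> * (s - s1))) \<in> disco_rect"
      and nr: "pt (X + \<mu> * (s - s1) * t) (1 + \<mu> * (s - s1)) \<notin> disco_rect"
      using edge_rect_iff[OF e(1), folded c_def, OF m(1)] by auto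
    have "\<gamma> s = cyl (pglue c (pt (X + \<mu> * (s - s1) * t) (1 + \<mu> * (s - s1))))"
      using m(2) nr cyl_rect[OF r] by (simp add: psi_def)
    also have "pglue c (pt (X + \<mu> * (s - s1) * t) (1 + \<mu> * (s - s1))) = pt (a * X + b + a * \<mu> * (s - s1) * t) (a * \<mu> * (s - s1))"
      by (simp add: c_def edge_patch_simps eq_2_iff algebra_simps)
    finally show "\<gamma> s = cyl (pt (a * X + b + a * \<mu> * (s - s1) * t) (a * \<mu> * (s - s1)))" .
  qed
  then show thesis
    using that[OF e] by (simp add: X_def s1_def)
qed

section \<open>Periodic lines\<close>

text \<open>One step of the first return map, on unreduced abscissae; \<open>k\<close> brings the
  top point back to \<open>[0, 6]\<close>. The speed is carried along, so that
  \<open>\<mu> n / \<mu> 0\<close> is the accumulated slope.\<close>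

definition crossing_step :: "real \<Rightarrow> real \<Rightarrow> real \<Rightarrow> real \<Rightarrow> real \<Rightarrow> bool" where
  "crossing_step t x \<mu> x' \<mu>' \<longleftrightarrow> (\<exists>lo hi a b. \<exists>k::int. (lo, hi, a, b) \<in> edges \<and>
     lo < x + t - 6 * real_of_int k \<and> x + t - 6 * real_of_int k < hi \<and>
     x' = a * (x + t - 6 * real_of_int k) + b \<and> \<mu>' = a * \<mu>)"

lemma rising_orbit:
  assumes g: "geod (pt t 1) \<gamma>" and r: "rising \<gamma> t \<sigma>0 x0 \<mu>0"
  obtains \<sigma> x \<mu> :: "nat \<Rightarrow> real" where "\<sigma> 0 = \<sigma>0" "x 0 = x0" "\<mu> 0 = \<mu>0"
    "\<And>n. rising \<gamma> t (\<sigma> n) (x n) (\<mu> n)" "\<And>n. \<sigma> (Suc n) = \<sigma> n + 1 / \<mu> n"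
    "\<And>n. crossing_step t (x n) (\<mu> n) (x (Suc n)) (\<mu> (Suc n))"
proof -
  let ?P = "\<lambda>n (\<sigma>, x, \<mu>). rising \<gamma> t \<sigma> x \<mu> \<and> (n = (0::nat) \<longrightarrow> (\<sigma>, x, \<mu>) = (\<sigma>0, x0, \<mu>0))"
  let ?Q = "\<lambda>n (\<sigma>, x, \<mu>) (\<sigma>', x', \<mu>'). \<sigma>' = \<sigma> + 1 / \<mu> \<and> crossing_step t x \<mu> x' \<mu>'"
  have "\<exists>f. \<forall>n. ?P n (f n) \<and> ?Q n (f n) (f (Suc n))"
  proof (rule dependent_nat_choice)
    show "\<exists>st. ?P 0 st"
      using r by (intro exI[of _ "(\<sigma>0, x0, \<mu>0)"]) simp
    fix st n assume "?P n st"
    then obtain \<sigma> x \<mu> where st: "st = (\<sigma>, x, \<mu>)" "rising \<gamma> t \<sigma> x \<mu>"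
      by (cases st) auto
    obtain lo hi a b and k :: int where e: "(lo, hi, a, b) \<in> edges"
      "lo < x + t - 6 * real_of_int k" "x + t - 6 * real_of_int k < hi"
      "rising \<gamma> t (\<sigma> + 1 / \<mu>) (a * (x + t - 6 * real_of_int k) + b) (a * \<mu>)"
      using rising_step[OF g st(2)] by metis
    then have "crossing_step t x \<mu> (a * (x + t - 6 * real_of_int k) + b) (a * \<mu>)"
      unfolding crossing_step_def by blast
    then show "\<exists>st'. ?P (Suc n) st' \<and> ?Q n st st'"
      using e(4) st(1) by (intro exI[of _ "(\<sigma> + 1 / \<mu>, a * (x + t - 6 * real_of_int k) + b, a * \<mu>)"]) simp
  qed
  then obtain f where f: "\<And>n. ?P n (f n) \<and> ?Q n (f n) (f (Suc n))" by blast
  show thesis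
    by (rule that[of "\<lambda>n. fst (f n)" "\<lambda>n. fst (snd (f n))" "\<lambda>n. snd (snd (f n))"])
      (use f in \<open>auto simp: case_prod_unfold prod_eq_iff\<close>)
qed

text \<open>The projection is a closed map. Closed levels will rule out accumulation of the crossing
  times.\<close>

lemma closedin_cyl_level:
  assumes "0 \<le> y" "y \<le> 1"
  shows "closedin disco {cyl (pt x y) |x. True}"
proof -
  let ?C = "{z \<in> disco_rect. z $ 2 = y}"
  have "closed {z :: real ^ 2. z $ 2 = y}"
    by (intro closed_Collect_eq continuous_intros)
  then have "closedin (top_of_set disco_rect) (disco_rect \<inter> {z. z $ 2 = y})"
    by (rule closedin_closed_Int)
  moreover have "disco_rect \<inter> {z. z $ 2 = y} = ?C"
    by auto
  ultimately have "closedin disco (disco_proj ` ?C)"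
    using closed_map_disco_proj unfolding closed_map_def by simp
  moreover have "disco_proj ` ?C = {cyl (pt x y) |x. True}"
  proof (intro equalityI subsetI)
    fix p assume "p \<in> disco_proj ` ?C"
    then obtain z where z: "z \<in> disco_rect" "z $ 2 = y" "p = disco_proj z" by auto
    then have "p = cyl (pt (z $ 1) y)"
      using cyl_rect[OF z(1)] pt_eta[of z] by simp
    then show "p \<in> {cyl (pt x y) |x. True}" by blast
  next
    fix p assume "p \<in> {cyl (pt x y) |x. True}"
    then obtain x where p: "p = cyl (pt x y)" by blast
    obtain k :: int where k: "6 * real_of_int k \<le> pt x y $ 1" "pt x y $ 1 < 6 * (real_of_int k + 1)"
      by (rule cyl_reduce)
    then have "p = disco_proj (pt (x - 6 * real_of_int k) y)" "pt (x - 6 * real_of_int k) y \<in> ?C"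
      using p cyl_eq[of k "pt x y"] assms by (auto simp: mem_disco_rect)
    then show "p \<in> disco_proj ` ?C" by blast
  qed
  ultimately show ?thesis by simp
qed

lemma geod_level_limit:
  assumes g: "geod v \<gamma>" and y: "0 \<le> y" "y \<le> 1" and s: "s \<longlonglongrightarrow> L" and lev: "\<And>n. \<exists>x. \<gamma> (s n) = cyl (pt x y)"
  shows "\<exists>x. \<gamma> L = cyl (pt x y)"
proof -
  let ?K = "{cyl (pt x y) |x. True}"
  have "closedin euclideanreal {s \<in> topspace euclideanreal. \<gamma> s \<in> ?K}"
    by (rule closedin_continuous_map_preimage[OF geod_continuous[OF g] closedin_cyl_level[OF y]])
  then have "closed {s. \<gamma> s \<in> ?K}"
    by simp
  then have "L \<in> {s. \<gamma> s \<in> ?K}"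
    by (rule closed_sequentially) (use s lev in auto)
  then show ?thesis by blast
qed

text \<open>Some crossing starts exactly one period after the first. Positions then agree modulo 6,
  and following the line a little further shows that the speeds agree too, which is triviality of
  the holonomy.\<close>

lemma rising_periodic_return:
  assumes g: "geod (pt t 1) \<gamma>" and \<tau>: "\<tau> > 0" "\<And>s. \<gamma> (s + \<tau>) = \<gamma> s"
    and r: "\<And>n. rising \<gamma> t (\<sigma> n) (x n) (\<mu> n)" "\<And>n. \<sigma> (Suc n) = \<sigma> n + 1 / \<mu> n"
  obtains n and k :: int where "n \<ge> 1" "x n = x 0 + 6 * real_of_int k" "\<mu> n = \<mu> 0"
proof -
  have \<mu>: "\<mu> n > 0" for n
    using r(1)[of n] by (simp add: rising_def)
  have inc: "\<sigma> n < \<sigma> (Suc n)" for n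
    using r(2)[of n] \<mu>[of n] by simp
  then have mono: "incseq \<sigma>"
    by (intro incseq_SucI less_imp_le)
  have start: "\<gamma> (\<sigma> n) = cyl (pt (x n) 0)" for n
    using risingD[OF r(1)[of n], of "\<sigma> n"] \<mu>[of n] by simp
  \<comment> \<open>Speeds may grow, so the crossing times might converge. At their limit the line
    would be at height 0, by the starting points, and at height 1/2, by the midpoints of the
    crossings.\<close>
  have "\<exists>n. \<sigma> 0 + \<tau> < \<sigma> n"
  proof (rule ccontr)
    assume "\<nexists>n. \<sigma> 0 + \<tau> < \<sigma> n"
    then have "\<sigma> n \<le> \<sigma> 0 + \<tau>" for n
      by (auto simp: not_less)
    then obtain L where L: "\<sigma> \<longlonglongrightarrow> L"
      using incseq_convergent[OF mono] by metis
    have half: "\<exists>x. \<gamma> (\<sigma> n + 1 / (2 * \<mu> n)) = cyl (pt x (1/2))" for n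
    proof -
      have "\<gamma> (\<sigma> n + 1 / (2 * \<mu> n)) = cyl (pt (x n + \<mu> n * (\<sigma> n + 1 / (2 * \<mu> n) - \<sigma> n) * t) (\<mu> n * (\<sigma> n + 1 / (2 * \<mu> n) - \<sigma> n)))"
        by (rule risingD[OF r(1)]) (use \<mu>[of n] in \<open>auto simp: field_simps\<close>)
      then show ?thesis
        using \<mu>[of n] by auto
    qed
    have "(\<lambda>n. \<sigma> n + 1 / (2 * \<mu> n)) \<longlonglongrightarrow> L"
    proof (rule tendsto_sandwich[OF _ _ L LIMSEQ_Suc[OF L]])
      show "\<forall>\<^sub>F n in sequentially. \<sigma> n \<le> \<sigma> n + 1 / (2 * \<mu> n)"
        using \<mu> by (intro always_eventually allI) (simp add: less_imp_le)
      show "\<forall>\<^sub>F n in sequentially. \<sigma> n + 1 / (2 * \<mu> n) \<le> \<sigma> (Suc n)"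
        using \<mu> r(2) by (intro always_eventually allI) (simp add: field_simps)
    qed
    then obtain x1 where "\<gamma> L = cyl (pt x1 (1/2))"
      using geod_level_limit[OF g _ _ _ half] by force
    moreover obtain x2 where "\<gamma> L = cyl (pt x2 0)"
      using geod_level_limit[OF g _ _ L, of 0] start by force
    ultimately show False
      using cyl_eq_iff[of "pt x1 (1/2)" "pt x2 0"] by simp
  qed
  then obtain m where m: "\<sigma> 0 + \<tau> < \<sigma> m" "\<And>i. i < m \<Longrightarrow> \<sigma> i \<le> \<sigma> 0 + \<tau>"
    using exists_least_iff[of "\<lambda>n. \<sigma> 0 + \<tau> < \<sigma> n"] by (auto simp: not_less)
  then have "m \<noteq> 0"
    using \<tau>(1) by (intro notI) simp
  then obtain n where n: "m = Suc n"
    using not0_implies_Suc by blast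
  then have le: "\<sigma> n \<le> \<sigma> 0 + \<tau>" "\<sigma> 0 + \<tau> < \<sigma> (Suc n)"
    using m by auto
  \<comment> \<open>The height after one period, inside crossing \<open>n\<close>. By periodicity
    the point lies on the bottom level, which no interior level meets, so \<open>h\<close>
    vanishes.\<close>
  define h where "h = \<mu> n * (\<sigma> 0 + \<tau> - \<sigma> n)"
  have h: "0 \<le> h" "h < 1"
  proof -
    have "\<mu> n * (\<sigma> 0 + \<tau> - \<sigma> n) < \<mu> n * (1 / \<mu> n)"
      using le r(2)[of n] \<mu>[of n] by (intro mult_strict_left_mono) auto
    then show "h < 1"
      using \<mu>[of n] by (simp add: h_def)
    show "0 \<le> h"
      using le \<mu>[of n] by (simp add: h_def)
  qed
  have "\<gamma> (\<sigma> 0 + \<tau>) = cyl (pt (x n + \<mu> n * (\<sigma> 0 + \<tau> - \<sigma> n) * t) h)"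
    unfolding h_def by (rule risingD[OF r(1)]) (use le r(2)[of n] in auto)
  moreover have "\<gamma> (\<sigma> 0 + \<tau>) = cyl (pt (x 0) 0)"
    using \<tau>(2) start by simp
  ultimately have "h = 0"
    using cyl_eq_iff[of "pt (x n + \<mu> n * (\<sigma> 0 + \<tau> - \<sigma> n) * t) h" "pt (x 0) 0"] h by force
  then have \<sigma>n: "\<sigma> n = \<sigma> 0 + \<tau>"
    using \<mu>[of n] by (simp add: h_def)
  then have "n \<noteq> 0"
    using \<tau>(1) by (intro notI) simp
  \<comment> \<open>Short enough that both crossings are still below height 1, where
    \<open>cyl\<close> determines the height and the abscissa modulo 6.\<close>
  define s where "s = min (1 / (2 * \<mu> 0)) (1 / (2 * \<mu> n))"
  have s: "0 < s" "\<mu> 0 * s < 1" "\<mu> n * s < 1" "s \<le> 1 / \<mu> 0" "s \<le> 1 / \<mu> n"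
    using \<mu>[of 0] \<mu>[of n] by (auto simp: s_def min_def field_simps)
  have "cyl (pt (x 0 + \<mu> 0 * s * t) (\<mu> 0 * s)) = \<gamma> (\<sigma> 0 + s)"
    using risingD[OF r(1)[of 0], of "\<sigma> 0 + s"] s by simp
  also have "\<dots> = \<gamma> (\<sigma> n + s)"
    using \<tau>(2)[of "\<sigma> 0 + s"] \<sigma>n by (simp add: algebra_simps)
  also have "\<dots> = cyl (pt (x n + \<mu> n * s * t) (\<mu> n * s))"
    using risingD[OF r(1)[of n], of "\<sigma> n + s"] s by simp
  finally have eq: "cyl (pt (x 0 + \<mu> 0 * s * t) (\<mu> 0 * s)) = cyl (pt (x n + \<mu> n * s * t) (\<mu> n * s))" .
  have "pt (x 0 + \<mu> 0 * s * t) (\<mu> 0 * s) $ 2 = pt (x n + \<mu> n * s * t) (\<mu> n * s) $ 2 \<and>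
      (\<exists>k::int. pt (x n + \<mu> n * s * t) (\<mu> n * s) $ 1 = pt (x 0 + \<mu> 0 * s * t) (\<mu> 0 * s) $ 1 + 6 * real_of_int k)"
    by (rule cyl_eq_iff[THEN iffD1, OF _ _ _ _ eq]) (use s \<mu>[of 0] \<mu>[of n] in \<open>simp_all add: less_imp_le\<close>)
  then have "\<mu> 0 * s = \<mu> n * s \<and> (\<exists>k::int. x n + \<mu> n * s * t = x 0 + \<mu> 0 * s * t + 6 * real_of_int k)"
    unfolding pt_nth .
  then obtain k :: int where k: "\<mu> 0 * s = \<mu> n * s" "x n + \<mu> n * s * t = x 0 + \<mu> 0 * s * t + 6 * real_of_int k"
    by blast
  then have "\<mu> n = \<mu> 0"
    using s(1) by simp
  moreover from this have "x n = x 0 + 6 * real_of_int k"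
    using k(2) by simp
  ultimately show thesis
    using that[of n k] \<open>n \<noteq> 0\<close> by (simp add: Suc_le_eq)
qed

text \<open>Each step adds \<open>t\<close>, subtracts a multiple of 6 and applies a rational
  gluing. So the coefficient of \<open>x 0\<close> is the accumulated slope, and that of
  \<open>t\<close> is positive after the first step.\<close>

lemma crossing_step_affine:
  assumes step: "\<And>n. crossing_step t (x n) (\<mu> n) (x (Suc n)) (\<mu> (Suc n))"
  shows "\<exists>c\<in>\<rat>. \<exists>c1\<in>\<rat>. \<exists>c0\<in>\<rat>. c > 0 \<and> \<mu> n = c * \<mu> 0 \<and> x n = c * x 0 + c1 * t + c0 \<and> 0 \<le> c1 \<and> (n \<ge> 1 \<longrightarrow> 0 < c1)"
proof (induction n)
  case 0
  show ?case
    by (rule bexI[of _ 1], rule bexI[of _ 0], rule bexI[of _ 0]) auto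
next
  case (Suc n)
  then obtain c c1 c0 where c: "c \<in> \<rat>" "c1 \<in> \<rat>" "c0 \<in> \<rat>" "c > 0" "\<mu> n = c * \<mu> 0" "x n = c * x 0 + c1 * t + c0" "0 \<le> c1"
    by blast
  obtain lo hi a b and k :: int where e: "(lo, hi, a, b) \<in> edges"
    "x (Suc n) = a * (x n + t - 6 * real_of_int k) + b" "\<mu> (Suc n) = a * \<mu> n"
    using step[of n] unfolding crossing_step_def by blast
  have "a \<in> \<rat> \<and> b \<in> \<rat> \<and> a > 0"
    using e(1) by (cases rule: edges_cases) (hypsubst, simp add: Rats_divide)+
  then have ab: "a \<in> \<rat>" "b \<in> \<rat>" "a > 0"
    by auto
  have pos: "0 < a * c" "0 < a * (c1 + 1)"
    using ab c by (simp_all add: add_nonneg_pos)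
  show ?case
  proof (rule bexI[of _ "a * c"], rule bexI[of _ "a * (c1 + 1)"], rule bexI[of _ "a * (c0 - 6 * real_of_int k) + b"])
    show "a * c \<in> \<rat>" "a * (c1 + 1) \<in> \<rat>" "a * (c0 - 6 * real_of_int k) + b \<in> \<rat>"
      using c ab by (auto intro!: Rats_add Rats_mult Rats_diff)
    show "a * c > 0 \<and> \<mu> (Suc n) = a * c * \<mu> 0 \<and>
        x (Suc n) = a * c * x 0 + a * (c1 + 1) * t + (a * (c0 - 6 * real_of_int k) + b) \<and>
        0 \<le> a * (c1 + 1) \<and> (Suc n \<ge> 1 \<longrightarrow> 0 < a * (c1 + 1))"
      using pos e(2,3) c(5,6) by (simp add: less_imp_le algebra_simps del: zero_less_mult_iff)
  qed
qed

text \<open>For slopes in \<open>[1, 4]\<close> the first return map sends \<open>(0, 1)\<close>, together with \<open>(5, 6)\<close> when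
  \<open>t \<ge> 2\<close>, into itself through gluings of slope \<open>1/2\<close> only.\<close>

lemma crossing_step_contracting:
  assumes t: "1 \<le> t" "t \<le> 4" and J: "0 < x \<and> x < 1 \<or> 2 \<le> t \<and> 5 < x \<and> x < 6"
    and step: "crossing_step t x \<mu> x' \<mu>'"
  shows "\<mu>' = \<mu> / 2 \<and> (0 < x' \<and> x' < 1 \<or> 2 \<le> t \<and> 5 < x' \<and> x' < 6)"
proof -
  obtain lo hi a b and k :: int where e: "(lo, hi, a, b) \<in> edges"
    "lo < x + t - 6 * real_of_int k" "x + t - 6 * real_of_int k < hi"
    "x' = a * (x + t - 6 * real_of_int k) + b" "\<mu>' = a * \<mu>"
    using step unfolding crossing_step_def by blast
  have b: "0 \<le> lo" "hi \<le> 6"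
    using edges_bounds[OF e(1)] by auto
  define X where "X = x + t - 6 * real_of_int k"
  note e = e[folded X_def]
  \<comment> \<open>The top point is confined to \<open>(1, 5)\<close>, away from the sides of slope
    2. From \<open>(5, 6)\<close> one turn is subtracted, and \<open>t \<ge> 2\<close> keeps the
    point above 1. Reaching \<open>(5, 6)\<close> takes \<open>X > 3\<close>, which from
    \<open>(0, 1)\<close> already implies \<open>t > 2\<close>.\<close>
  have X: "1 < X \<and> X < 5 \<and> (0 < x \<and> x < 1 \<and> X = x + t \<or> 2 \<le> t \<and> X < 4)"
    using J
  proof
    assume x: "0 < x \<and> x < 1"
    have "real_of_int k < 1" "real_of_int k > -1"
      using e(2,3) b x t by (auto simp: X_def)
    then have "k = 0" by linarith
    then show ?thesis
      using x t by (simp add: X_def)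
  next
    assume x: "2 \<le> t \<and> 5 < x \<and> x < 6"
    have "real_of_int k < 2" "real_of_int k > 0"
      using e(2,3) b x t by (auto simp: X_def)
    then have "k = 1" by linarith
    then show ?thesis
      using x t by (simp add: X_def)
  qed
  show ?thesis
    using e(1)
  proof (cases rule: edges_cases)
    case 1
    then show ?thesis using e(3) X by simp
  next
    case 2
    have "x' = (X - 1) / 2" "\<mu>' = \<mu> / 2" "X < 3"
      using e(3,4,5) unfolding 2 by simp_all
    then show ?thesis using X by simp
  next
    case 3
    have "x' = X / 2 + 7 / 2" "\<mu>' = \<mu> / 2" "3 < X"
      using e(2,4,5) unfolding 3 by simp_all
    moreover have "2 \<le> t"
      using X \<open>3 < X\<close> by linarith
    ultimately show ?thesis using X by simp
  next
    case 4
    then show ?thesis using e(2) X by simp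
  qed
qed

lemma crossing_orbit_contracting:
  assumes t: "1 \<le> t" "t \<le> 4" and x0: "0 < x 0" "x 0 < 1"
    and step: "\<And>n. crossing_step t (x n) (\<mu> n) (x (Suc n)) (\<mu> (Suc n))"
  shows "\<mu> n = \<mu> 0 / 2 ^ n \<and> (0 < x n \<and> x n < 1 \<or> 2 \<le> t \<and> 5 < x n \<and> x n < 6)"
proof (induction n)
  case (Suc n)
  then show ?case
    using crossing_step_contracting[OF t _ step[of n]] by (simp add: mult.commute)
qed (use x0 in simp)

section \<open>Slopes of images of horizontal lines\<close>

lemma convex_component:
  assumes "convex I"
  shows "convex {z :: real ^ 2. z $ i \<in> I}"
proof -
  have "linear (\<lambda>z :: real ^ 2. z $ i)"
    by (rule bounded_linear.linear[OF bounded_linear_vec_nth])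
  from convex_linear_vimage[OF this assms] show ?thesis
    by (simp add: vimage_def)
qed

lemma affine_with_cyl:
  assumes f: "affine_with M f" and z: "0 < z $ 2" "z $ 2 < 1"
  shows "aff_at ((*v) M) (\<lambda>w. f (cyl w)) z"
proof -
  obtain c d where c: "c \<in> patches" "d \<in> pdom c" "cyl z = psi c d"
    using patches_cover aff_at_image[OF aff_at_cyl[OF z]] by blast
  have "aff_at ((*v) M) (\<lambda>w. f (psi c w)) d"
    using f c by (simp add: affine_with_def)
  then show ?thesis
    using aff_at_compose[OF aff_at_cyl[OF z] bounded_linear_ident c _ bounded_linear_matrix] by blast
qed

lemma inner_cyl:
  assumes "z \<in> pdom inner_patch"
  shows "cyl z = psi inner_patch z" "0 < z $ 2" "z $ 2 < 1" "z \<in> disco_rect"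
  using assms cyl_rect[of z] by (auto simp: inner_patch_simps mem_box_pt psi_def mem_disco_rect)

lemma rect_open_meets_inner:
  assumes "openin (top_of_set disco_rect) W" "W \<noteq> {}"
  obtains z where "z \<in> W" "z \<in> pdom inner_patch"
proof -
  obtain T where T: "open T" "W = disco_rect \<inter> T"
    using assms(1) by (auto simp: openin_open)
  have ne: "box (pt 0 0) (pt 6 1) \<noteq> {}"
    by (auto simp: mem_box_pt intro!: exI[of _ "pt 1 (1/2)"] simp flip: ex_in_conv)
  have "T \<inter> closure (box (pt 0 0) (pt 6 1)) \<noteq> {}"
    unfolding closure_box[OF ne] using assms(2) T(2) by (auto simp: disco_rect_def)
  then obtain z where "z \<in> T" "z \<in> box (pt 0 0) (pt 6 1)"
    using open_Int_closure_eq_empty[OF T(1)] by blast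
  then show thesis
    using that T(2) by (auto simp: inner_patch_simps mem_box_pt mem_disco_rect)
qed

text \<open>\<open>f\<close> is surjective and continuous, and the open cylinder is dense. Hence an
  image leaf can be found through any prescribed open set.\<close>

lemma affine_with_image_meets:
  assumes f: "affine_with M f" and U: "openin disco U" "U \<noteq> {}"
  obtains q where "q \<in> pdom inner_patch" "f (cyl q) \<in> U"
proof -
  have hom: "homeomorphic_map disco disco f"
    using f by (simp add: affine_with_def)
  have "openin disco {p \<in> topspace disco. f p \<in> U}"
    using homeomorphic_imp_continuous_map[OF hom] U(1) by (simp add: continuous_map_def)
  then have op: "openin (top_of_set disco_rect) {z \<in> disco_rect. disco_proj z \<in> {p \<in> topspace disco. f p \<in> U}}"
    by (simp only: openin_disco)
  obtain u where u: "u \<in> U" "u \<in> topspace disco"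
    using U(2) openin_subset[OF U(1)] by blast
  moreover have "f ` topspace disco = topspace disco"
    by (rule homeomorphic_imp_surjective_map[OF hom])
  ultimately have "u \<in> f ` topspace disco"
    by simp
  then obtain p where p: "p \<in> topspace disco" "f p = u"
    by blast
  then obtain w where "w \<in> disco_rect" "p = disco_proj w"
    unfolding topspace_disco_eq by blast
  then have "w \<in> {z \<in> disco_rect. disco_proj z \<in> {p \<in> topspace disco. f p \<in> U}}"
    using u(1) p by simp
  then obtain z where "z \<in> pdom inner_patch" "f (disco_proj z) \<in> U"
    using rect_open_meets_inner[OF op] by blast
  then show thesis
    using that[of z] inner_cyl(4)[of z] cyl_rect[of z] by simp
qed

lemma affine_with_image_meets_inner:
  assumes f: "affine_with M f" and V: "open V" "V \<subseteq> pdom inner_patch" "V \<noteq> {}"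
  obtains q z where "q \<in> pdom inner_patch" "z \<in> V" "f (cyl q) = cyl z"
proof -
  have "openin disco (psi inner_patch ` V)"
    using open_psi_image[OF inner_patch_in V(2,1)] .
  then obtain q where q: "q \<in> pdom inner_patch" "f (cyl q) \<in> psi inner_patch ` V"
    using affine_with_image_meets[OF f] V(3) by blast
  then obtain z where "z \<in> V" "f (cyl q) = psi inner_patch z" by blast
  then show thesis
    using that[OF q(1)] inner_cyl(1)[of z] V(2) by auto
qed

text \<open>Dividing the time by \<open>v $ 2\<close> normalises the direction to
  \<open>(t, 1)\<close>, also when \<open>v\<close> points downwards. A time
  \<open>6 * \<bar>v $ 2\<bar>\<close> is then one turn of the horizontal leaf, in one sense or the
  other.\<close>

lemma image_geodesic:
  assumes f: "affine_with M f" and v: "v = M *v pt 1 0" "v $ 2 \<noteq> 0" and q: "0 < q $ 2" "q $ 2 < 1"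
  obtains \<gamma> \<tau> where "\<tau> > 0" "geod (pt (v $ 1 / v $ 2) 1) \<gamma>" "\<And>s. \<gamma> (s + \<tau>) = \<gamma> s" "\<gamma> 0 = f (cyl q)"
proof -
  define \<gamma> where "\<gamma> = (\<lambda>s. f (cyl ((s / v $ 2) *\<^sub>R pt 1 0 + q)))"
  have lin: "bounded_linear (\<lambda>s. (s / v $ 2) *\<^sub>R pt 1 0)"
    using bounded_linear_compose[OF bounded_linear_scaleR_left bounded_linear_divide] .
  have dir: "M *v ((s / v $ 2) *\<^sub>R pt 1 0) = s *\<^sub>R pt (v $ 1 / v $ 2) 1" for s
  proof -
    have "M *v ((s / v $ 2) *\<^sub>R pt 1 0) = (s / v $ 2) *\<^sub>R v"
      by (simp add: v(1) matrix_vector_mult_scaleR)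
    then show ?thesis
      using v(2) by (simp add: eq_2_iff)
  qed
  have "geod (pt (v $ 1 / v $ 2) 1) \<gamma>"
    unfolding geod_def
  proof
    fix s
    have "aff_at ((*v) M) (\<lambda>w. f (cyl w)) ((s / v $ 2) *\<^sub>R pt 1 0 + q)"
      using q by (intro affine_with_cyl[OF f]) simp_all
    from aff_at_affine[OF this lin bounded_linear_matrix]
    show "aff_at (\<lambda>s. s *\<^sub>R pt (v $ 1 / v $ 2) 1) \<gamma> s"
      unfolding dir \<gamma>_def .
  qed
  moreover have "\<gamma> (s + 6 * \<bar>v $ 2\<bar>) = \<gamma> s" for s
  proof -
    obtain k :: int where k: "\<bar>v $ 2\<bar> / v $ 2 = real_of_int k"
    proof (cases "v $ 2 > 0")
      case True
      then show thesis by (intro that[of 1]) simp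
    next
      case False
      then show thesis using v(2) by (intro that[of "-1"]) simp
    qed
    have "((s + 6 * \<bar>v $ 2\<bar>) / v $ 2) *\<^sub>R pt 1 0 + q = pt ((s / v $ 2 + q $ 1) + 6 * real_of_int k) (q $ 2)"
      by (simp add: eq_2_iff add_divide_distrib flip: k)
    moreover have "(s / v $ 2) *\<^sub>R pt 1 0 + q = pt (s / v $ 2 + q $ 1) (q $ 2)"
      by (simp add: eq_2_iff)
    ultimately show ?thesis
      by (simp only: \<gamma>_def cyl_periodic)
  qed
  ultimately show thesis
    using that[of "6 * \<bar>v $ 2\<bar>" \<gamma>] v(2) by (simp add: \<gamma>_def)
qed

text \<open>The output combines a free choice of the starting region \<open>V\<close> with the
  return of position and speed; both restrictions on the slope follow from it.\<close>

lemma image_orbit: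
  assumes f: "affine_with M f" and v: "v = M *v pt 1 0" "v $ 2 \<noteq> 0" and t: "t = v $ 1 / v $ 2"
    and V: "open V" "V \<subseteq> pdom inner_patch" "V \<noteq> {}"
  obtains z x \<mu> n and k :: int where "z \<in> V" "x 0 = z $ 1 - z $ 2 * t" "\<mu> 0 > 0"
    "\<And>n. crossing_step t (x n) (\<mu> n) (x (Suc n)) (\<mu> (Suc n))"
    "n \<ge> 1" "x n = x 0 + 6 * real_of_int k" "\<mu> n = \<mu> 0"
proof -
  obtain q z where q: "q \<in> pdom inner_patch" "z \<in> V" "f (cyl q) = cyl z"
    using affine_with_image_meets_inner[OF f V] by blast
  obtain \<gamma> \<tau> where \<gamma>: "\<tau> > 0" "geod (pt t 1) \<gamma>" "\<And>s. \<gamma> (s + \<tau>) = \<gamma> s" "\<gamma> 0 = cyl z"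
    using image_geodesic[OF f v inner_cyl(2,3)[OF q(1)]] q(3) t by metis
  have z: "0 < z $ 2" "z $ 2 < 1"
    using inner_cyl(2,3) q(2) V(2) by auto
  obtain \<sigma>0 \<mu>0 where r: "rising \<gamma> t \<sigma>0 (z $ 1 - z $ 2 * t) \<mu>0"
    using rising_start[OF \<gamma>(2,4) z] by blast
  obtain \<sigma> x \<mu> where o: "x (0::nat) = z $ 1 - z $ 2 * t" "\<mu> 0 = \<mu>0"
    "\<And>n. rising \<gamma> t (\<sigma> n) (x n) (\<mu> n)" "\<And>n. \<sigma> (Suc n) = \<sigma> n + 1 / \<mu> n"
    "\<And>n. crossing_step t (x n) (\<mu> n) (x (Suc n)) (\<mu> (Suc n))"
    using rising_orbit[OF \<gamma>(2) r] by metis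
  obtain n and k :: int where n: "n \<ge> 1" "x n = x 0 + 6 * real_of_int k" "\<mu> n = \<mu> 0"
    using rising_periodic_return[of t \<gamma> \<tau> \<sigma> x \<mu>] \<gamma> o(3,4) by metis
  have "\<mu> 0 > 0"
    using o(3)[of 0] by (simp add: rising_def)
  then show thesis
    using that[OF q(2) o(1) _ o(5) n] by simp
qed

lemma image_slope_rational:
  assumes f: "affine_with M f" and v: "v = M *v pt 1 0" "v $ 2 \<noteq> 0"
  shows "v $ 1 / v $ 2 \<in> \<rat>"
proof -
  let ?t = "v $ 1 / v $ 2"
  have ne: "pdom inner_patch \<noteq> {}"
  proof -
    have "pt 1 (1/2) \<in> pdom inner_patch"
      by (simp add: inner_patch_simps mem_box_pt)
    then show ?thesis by blast
  qed
  obtain x \<mu> n and k :: int where o: "\<mu> (0::nat) > 0" "\<And>n. crossing_step ?t (x n) (\<mu> n) (x (Suc n)) (\<mu> (Suc n))"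
    "n \<ge> 1" "x n = x 0 + 6 * real_of_int k" "\<mu> n = \<mu> 0"
    using image_orbit[OF f v refl open_pdom[OF inner_patch_in] order_refl ne] by metis
  obtain c c1 c0 where c: "c \<in> \<rat>" "c1 \<in> \<rat>" "c0 \<in> \<rat>" "\<mu> n = c * \<mu> 0" "x n = c * x 0 + c1 * ?t + c0" "0 < c1"
    using crossing_step_affine[of ?t x \<mu>, OF o(2), of n] o(3) by blast
  \<comment> \<open>Equal speeds make the accumulated slope 1. The unknown \<open>x 0\<close> then
    cancels from the return equation, leaving a rational linear equation for the slope.\<close>
  have "c = 1"
    using c(4) o(1,5) by simp
  then have "c1 * ?t = 6 * real_of_int k - c0"
    using c(5) o(4) by simp
  then have "?t = (6 * real_of_int k - c0) / c1"
    using c(6) by (simp add: nonzero_eq_divide_eq mult.commute)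
  also have "\<dots> \<in> \<rat>"
    using c(2,3) by (auto intro!: Rats_divide Rats_diff Rats_mult)
  finally show ?thesis .
qed

lemma image_slope_excluded:
  assumes f: "affine_with M f" and v: "v = M *v pt 1 0" "v $ 2 \<noteq> 0"
  shows "\<not> (1 \<le> v $ 1 / v $ 2 \<and> v $ 1 / v $ 2 \<le> 4)"
proof
  let ?t = "v $ 1 / v $ 2"
  assume t: "1 \<le> ?t \<and> ?t \<le> 4"
  \<comment> \<open>Points of \<open>V\<close> are those whose line, followed backwards, leaves the
    bottom in \<open>(0, 1)\<close>, where the contraction starts.\<close>
  define V where "V = pdom inner_patch \<inter> {z. 0 < z $ 1 - z $ 2 * ?t \<and> z $ 1 - z $ 2 * ?t < 1}"
  have "open {z :: real ^ 2. 0 < z $ 1 - z $ 2 * ?t \<and> z $ 1 - z $ 2 * ?t < 1}"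
    by (intro open_Collect_conj open_Collect_less continuous_intros)
  then have V1: "open V"
    unfolding V_def by (intro open_Int open_pdom[OF inner_patch_in])
  have V2: "V \<subseteq> pdom inner_patch"
    by (simp add: V_def)
  \<comment> \<open>This is the point at height 1/100 on the line that starts from abscissa
    1/2.\<close>
  have "pt (1 / 2 + ?t / 100) (1 / 100) \<in> V"
    using t by (simp add: V_def inner_patch_simps mem_box_pt)
  then have V3: "V \<noteq> {}"
    by blast
  obtain z x \<mu> n where o: "z \<in> V" "x (0::nat) = z $ 1 - z $ 2 * ?t" "\<mu> (0::nat) > 0"
    "\<And>n. crossing_step ?t (x n) (\<mu> n) (x (Suc n)) (\<mu> (Suc n))" "n \<ge> 1" "\<mu> n = \<mu> 0"
    using image_orbit[OF f v refl V1 V2 V3] by metis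
  have "0 < x 0" "x 0 < 1"
    using o(1,2) by (auto simp: V_def)
  then have "\<mu> n = \<mu> 0 / 2 ^ n"
    using crossing_orbit_contracting[of ?t x \<mu> n] t o(4) by blast
  then have "\<mu> 0 * 2 ^ n = \<mu> 0 * 1"
    using o(6) by (simp add: nonzero_eq_divide_eq)
  then have "(2::real) ^ n = 1"
    unfolding mult_cancel_left using o(3) by simp
  moreover have "(2::real) ^ n > 1"
    using o(5) by (intro one_less_power) auto
  ultimately show False by simp
qed

text \<open>Away from the vertices one gluing connects a fibre, so invariance of \<open>Q\<close>
  under gluings makes the set saturated. It is used for the two open vertical cylinders.\<close>

lemma openin_disco_Collect:
  assumes Q: "open Q" and inv: "\<And>z w. disco_glue z w \<Longrightarrow> (z $ 1 \<in> Q \<longleftrightarrow> w $ 1 \<in> Q)"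
    and nv: "Q \<inter> {0, 1, 3, 5, 6} = {}"
  shows "openin disco (disco_proj ` {z \<in> disco_rect. z $ 1 \<in> Q})"
    and "\<And>z. z \<in> disco_rect \<Longrightarrow> disco_proj z \<in> disco_proj ` {z \<in> disco_rect. z $ 1 \<in> Q} \<longleftrightarrow> z $ 1 \<in> Q"
proof -
  show mem: "disco_proj z \<in> disco_proj ` {z \<in> disco_rect. z $ 1 \<in> Q} \<longleftrightarrow> z $ 1 \<in> Q" if z: "z \<in> disco_rect" for z
  proof
    assume "disco_proj z \<in> disco_proj ` {z \<in> disco_rect. z $ 1 \<in> Q}"
    then obtain w where w: "w \<in> disco_rect" "w $ 1 \<in> Q" "disco_proj z = disco_proj w" by blast
    then have "rep z = rep w"
      using disco_proj_eq_iff z by blast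
    moreover have "\<not> vertex w"
      using w(2) nv by (auto simp: vertex_def)
    ultimately show "z $ 1 \<in> Q"
      using rep_eq_cases[OF z w(1)] inv w(2) by blast
  qed (use z in blast)
  have "{z \<in> disco_rect. disco_proj z \<in> disco_proj ` {z \<in> disco_rect. z $ 1 \<in> Q}} = disco_rect \<inter> {z. z $ 1 \<in> Q}"
    using mem by blast
  moreover have "open {z :: real ^ 2. z $ 1 \<in> Q}"
    using open_vimage[OF Q, of "\<lambda>z :: real ^ 2. z $ 1"] by (simp add: vimage_def continuous_intros)
  ultimately show "openin disco (disco_proj ` {z \<in> disco_rect. z $ 1 \<in> Q})"
    unfolding openin_disco topspace_disco[symmetric] topspace_disco_eq by (auto intro: openin_open_Int)
qed

text \<open>A vertical image would put the dense, connected image of the open horizontal cylinder inside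
  the union of the two open vertical cylinders.\<close>

lemma image_not_vertical:
  assumes f: "affine_with M f" and v: "v = M *v pt 1 0" "v $ 2 \<noteq> 0"
  shows "v $ 1 \<noteq> 0"
proof
  assume v1: "v $ 1 = 0"
  let ?Q1 = "{0<..<1} \<union> {1<..<3} :: real set" and ?Q2 = "{3<..<5} \<union> {5<..<6} :: real set"
  let ?C = "\<lambda>Q. disco_proj ` {z \<in> disco_rect. z $ 1 \<in> Q}"
  let ?S = "{q :: real ^ 2. 0 < q $ 2 \<and> q $ 2 < 1}"
  have inv: "(z $ 1 \<in> ?Q1 \<longleftrightarrow> w $ 1 \<in> ?Q1) \<and> (z $ 1 \<in> ?Q2 \<longleftrightarrow> w $ 1 \<in> ?Q2)" if "disco_glue z w" for z w
    using that unfolding disco_glue_iff by (elim disjE conjE) auto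
  have C1: "openin disco (?C ?Q1)" "\<And>z. z \<in> disco_rect \<Longrightarrow> disco_proj z \<in> ?C ?Q1 \<longleftrightarrow> z $ 1 \<in> ?Q1"
    by (rule openin_disco_Collect; use inv in auto)+
  have C2: "openin disco (?C ?Q2)" "\<And>z. z \<in> disco_rect \<Longrightarrow> disco_proj z \<in> ?C ?Q2 \<longleftrightarrow> z $ 1 \<in> ?Q2"
    by (rule openin_disco_Collect; use inv in auto)+
  have opS: "open ?S"
    by (intro open_Collect_conj open_Collect_less continuous_intros)
  have cont: "continuous_map (top_of_set ?S) disco (\<lambda>q. f (cyl q))"
    by (rule continuous_map_aff_at[OF opS bounded_linear_matrix]) (use affine_with_cyl[OF f] in auto)
  have pre: "open {q \<in> ?S. f (cyl q) \<in> U}" if "openin disco U" for U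
    using cont that opS unfolding continuous_map_def by (auto simp: openin_open_eq)
  have cover: "f (cyl q) \<in> ?C ?Q1 \<or> f (cyl q) \<in> ?C ?Q2" if q: "q \<in> ?S" for q
  proof -
    have "f (cyl q) \<in> topspace disco" and ns: "f (cyl q) \<notin> disco_sing"
      using aff_at_image[OF affine_with_cyl[OF f]] q by auto
    then obtain z where z: "z \<in> disco_rect" "f (cyl q) = disco_proj z"
      by (auto simp: topspace_disco_eq)
    \<comment> \<open>A vertical line over one of these abscissae reaches a vertex at height 1,
      whereas image lines avoid the singular points.\<close>
    have "z $ 1 \<notin> {0, 1, 3, 5, 6}"
    proof
      assume bad: "z $ 1 \<in> {0, 1, 3, 5, 6}"
      have "\<not> vertex z"
        using ns z disco_proj_in_sing_iff by metis
      then have z2: "0 < z $ 2" "z $ 2 < 1"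
        using bad z(1) by (auto simp: vertex_def mem_disco_rect le_less)
      obtain \<gamma> \<tau> where \<gamma>: "geod (pt 0 1) \<gamma>" "\<gamma> 0 = cyl z"
        using image_geodesic[OF f v] q v1 z cyl_rect by force
      obtain \<sigma> \<mu> where r: "rising \<gamma> 0 \<sigma> (z $ 1) \<mu>"
        using rising_start[OF \<gamma> z2] by auto
      then have "\<mu> > 0" by (simp add: rising_def)
      then have "\<gamma> (\<sigma> + 1 / \<mu>) = cyl (pt (z $ 1) 1)"
        using risingD[OF r, of "\<sigma> + 1 / \<mu>"] by simp
      moreover have "cyl (pt (z $ 1) 1) \<in> disco_sing"
        unfolding cyl_rect[OF vertex_imp_rect[of "pt (z $ 1) 1"]] using bad
        by (subst cyl_rect) (auto simp: mem_disco_rect disco_proj_in_sing_iff vertex_def)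
      moreover have "\<gamma> (\<sigma> + 1 / \<mu>) \<notin> disco_sing"
        using \<gamma>(1) aff_at_image(2) unfolding geod_def by blast
      ultimately show False by simp
    qed
    then have "z $ 1 \<in> ?Q1 \<or> z $ 1 \<in> ?Q2"
      using z(1) by (auto simp: mem_disco_rect)
    then show ?thesis
      using C1(2)[OF z(1)] C2(2)[OF z(1)] z(2) by simp
  qed
  let ?A = "\<lambda>Q. {q \<in> ?S. f (cyl q) \<in> ?C Q}"
  have disj: "?A ?Q1 \<inter> ?A ?Q2 \<inter> ?S = {}"
  proof (rule equals0I)
    fix q assume "q \<in> ?A ?Q1 \<inter> ?A ?Q2 \<inter> ?S"
    then obtain z where "z \<in> disco_rect" "z $ 1 \<in> ?Q1" "disco_proj z \<in> ?C ?Q2"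
      by auto
    then show False
      using C2(2)[of z] by auto
  qed
  have ne: "?A Q \<inter> ?S \<noteq> {}" if op: "openin disco (?C Q)" and x: "x \<in> Q" "0 \<le> x" "x \<le> 6" for Q x
  proof -
    have "pt x 0 \<in> {z \<in> disco_rect. z $ 1 \<in> Q}"
      using x by (simp add: mem_disco_rect)
    then obtain q where "q \<in> pdom inner_patch" "f (cyl q) \<in> ?C Q"
      using affine_with_image_meets[OF f op] by blast
    then show ?thesis
      using inner_cyl(2,3) by blast
  qed
  have "convex ?S"
    using convex_component[of "{0<..<1}" 2] by simp
  then have "connected ?S"
    by (rule convex_connected)
  then show False
    using connectedD[of ?S "?A ?Q1" "?A ?Q2", OF _ pre[OF C1(1)] pre[OF C2(1)] disj] cover
      ne[OF C1(1), of 2] ne[OF C2(1), of 4] by auto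
qed

section \<open>Images of the horizontal direction\<close>

lemma linear_at_right_closure:
  fixes A :: "(real ^ 2) set"
  assumes "\<And>\<epsilon>. 0 < \<epsilon> \<Longrightarrow> \<epsilon> < 1 \<Longrightarrow> w + \<epsilon> *\<^sub>R (q - w) \<in> A"
  shows "w \<in> closure A"
proof -
  have "((\<lambda>\<epsilon>. w + \<epsilon> *\<^sub>R (q - w)) \<longlongrightarrow> w + 0 *\<^sub>R (q - w)) (at_right 0)"
    by (intro tendsto_intros)
  then have lim: "((\<lambda>\<epsilon>. w + \<epsilon> *\<^sub>R (q - w)) \<longlongrightarrow> w) (at_right 0)"
    by simp
  have "\<forall>\<^sub>F \<epsilon> in at_right 0. w + \<epsilon> *\<^sub>R (q - w) \<in> closure A"
    by (rule eventually_at_rightI[of 0 1]) (use assms closure_subset in auto)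
  from Lim_in_closed_set[OF closed_closure this _ lim] show ?thesis
    by simp
qed

lemma between_strict:
  fixes w q \<epsilon> :: real
  assumes "0 \<le> w" "w \<le> 1" "0 < q" "q < 1" "0 < \<epsilon>" "\<epsilon> < 1"
  shows "0 < w + \<epsilon> * (q - w) \<and> w + \<epsilon> * (q - w) < 1"
proof -
  have "w + \<epsilon> * (q - w) = (1 - \<epsilon>) * w + \<epsilon> * q" "1 - ((1 - \<epsilon>) * w + \<epsilon> * q) = (1 - \<epsilon>) * (1 - w) + \<epsilon> * (1 - q)"
    by (simp_all add: algebra_simps)
  moreover have "0 < (1 - \<epsilon>) * w + \<epsilon> * q" "0 < (1 - \<epsilon>) * (1 - w) + \<epsilon> * (1 - q)"
    using assms by (auto intro!: add_nonneg_pos mult_nonneg_nonneg mult_pos_pos)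
  ultimately show ?thesis by linarith
qed

text \<open>If the developed image left the horizontal cylinder, some nonsingular point of the open
  cylinder would be sent to a singular one.\<close>

lemma horizontal_development:
  assumes f: "affine_with M f" and M: "M = vector [vector [a, b], vector [0, d]]" and d: "d > 0"
  obtains \<mu> x0 where "\<mu> > 0" "\<mu> * d = 1"
    "\<And>x y. 0 \<le> y \<Longrightarrow> y \<le> 1 \<Longrightarrow> f (cyl (pt x y)) = cyl (pt (\<mu> * a * x + \<mu> * b * y + x0) y)"
proof -
  have nS: "f (cyl w) \<notin> disco_sing" if "0 < w $ 2" "w $ 2 < 1" for w
    using aff_at_image(2)[OF affine_with_cyl[OF f that]] .
  have det: "a * d = 1"
    using f by (simp add: affine_with_def M det_mat2)
  then have a: "a \<noteq> 0" by auto
  have "pdom inner_patch \<noteq> {}"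
    using patch_meets_inner[OF inner_patch_in] by blast
  then obtain q z where q: "q \<in> pdom inner_patch" "z \<in> pdom inner_patch" "f (cyl q) = cyl z"
    using affine_with_image_meets_inner[OF f open_pdom[OF inner_patch_in] order_refl] by blast
  note q2 = inner_cyl(2,3)[OF q(1)] and z2 = inner_cyl(2,3)[OF q(2)]
  obtain N \<mu> where N: "open N" "q \<in> N" "\<mu> > 0" "\<And>w. w \<in> N \<Longrightarrow> f (cyl w) = cyl (z + \<mu> *\<^sub>R (M *v (w - q)))"
    using aff_at_match[OF affine_with_cyl[OF f q2] bounded_linear_matrix aff_at_cyl[OF z2]] q(3) by metis
  define w0 where "w0 = z - \<mu> *\<^sub>R (M *v q)"
  \<comment> \<open>Heights are developed by \<open>y\<close> to \<open>e + \<mu> * d * y\<close>,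
    so \<open>e\<close> is the height assigned to the bottom. The aim is \<open>e = 0\<close> and
    \<open>\<mu> * d = 1\<close>.\<close>
  define e where "e = w0 $ 2"
  define H where "H = (\<lambda>w. cyl (w0 + \<mu> *\<^sub>R (M *v w)))"
  have Hpt: "w0 + \<mu> *\<^sub>R (M *v w) = pt (\<mu> * a * w $ 1 + \<mu> * b * w $ 2 + w0 $ 1) (e + \<mu> * d * w $ 2)" for w
    by (simp add: M mat2_mult eq_2_iff e_def algebra_simps)
  have \<mu>d: "\<mu> * d > 0"
    using N(3) d by simp
  have eq: "e + \<mu> * d * q $ 2 = z $ 2"
    by (simp add: e_def w0_def M mat2_mult)
  then have eq': "q $ 2 * (\<mu> * d) = z $ 2 - e"
    by (simp add: mult.commute algebra_simps)
  define S where "S = {w :: real ^ 2. w $ 2 \<in> {y. 0 < y \<and> y < 1 \<and> 0 < e + \<mu> * d * y \<and> e + \<mu> * d * y < 1}}"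
  have S_iff: "w \<in> S \<longleftrightarrow> 0 < w $ 2 \<and> w $ 2 < 1 \<and> 0 < e + \<mu> * d * w $ 2 \<and> e + \<mu> * d * w $ 2 < 1" for w
    by (simp add: S_def)
  have "convex {y. 0 < y \<and> y < 1 \<and> 0 < e + \<mu> * d * y \<and> e + \<mu> * d * y < 1}"
  proof (rule is_interval_convex_1[THEN iffD1], unfold is_interval_1, intro ballI allI impI)
    fix y1 y2 y assume y: "y1 \<in> {y. 0 < y \<and> y < 1 \<and> 0 < e + \<mu> * d * y \<and> e + \<mu> * d * y < 1}"
      "y2 \<in> {y. 0 < y \<and> y < 1 \<and> 0 < e + \<mu> * d * y \<and> e + \<mu> * d * y < 1}" "y1 \<le> y \<and> y \<le> y2"
    then have "\<mu> * d * y1 \<le> \<mu> * d * y" "\<mu> * d * y \<le> \<mu> * d * y2"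
      using \<mu>d by (auto intro!: mult_left_mono)
    then show "y \<in> {y. 0 < y \<and> y < 1 \<and> 0 < e + \<mu> * d * y \<and> e + \<mu> * d * y < 1}"
      using y by auto
  qed
  then have conn: "connected S"
    unfolding S_def by (intro convex_connected convex_component)
  have opS: "open S"
    unfolding S_def mem_Collect_eq by (intro open_Collect_conj open_Collect_less continuous_intros)
  have fS: "f (cyl w) = H w" if "w \<in> S" for w
  proof (rule aff_at_identity[OF opS conn bounded_linear_matrix[of M] _ _ N(1,2) _ _ that])
    show "aff_at ((*v) M) (\<lambda>w. f (cyl w)) w" if "w \<in> S" for w
      using affine_with_cyl[OF f] that by (simp add: S_iff)
    show "aff_at ((*v) M) H w" if "w \<in> S" for w
      unfolding H_def by (rule aff_at_cyl_affine[OF N(3) bounded_linear_matrix]) (use that in \<open>simp_all add: Hpt S_iff\<close>)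
    show "q \<in> S"
      unfolding S_iff eq using q2 z2 by simp
    fix w assume "w \<in> N"
    then have "f (cyl w) = cyl (z + \<mu> *\<^sub>R (M *v (w - q)))"
      by (rule N(4))
    also have "z + \<mu> *\<^sub>R (M *v (w - q)) = w0 + \<mu> *\<^sub>R (M *v w)"
      by (simp add: w0_def matrix_vector_mult_diff_distrib scaleR_diff_right)
    finally show "f (cyl w) = H w"
      by (simp add: H_def)
  qed
  define T where "T = {w :: real ^ 2. 0 \<le> w $ 2 \<and> w $ 2 \<le> 1 \<and> 0 \<le> e + \<mu> * d * w $ 2 \<and> e + \<mu> * d * w $ 2 \<le> 1}"
  have fT: "f (cyl w) = H w" if w: "w \<in> T" for w
  proof (rule closed_agreement[of T "\<lambda>w. f (cyl w)" H S])
    have "T \<subseteq> {z. 0 \<le> z $ 2 \<and> z $ 2 \<le> 1}"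
      by (auto simp: T_def)
    then have "continuous_map (top_of_set T) disco cyl"
      by (rule continuous_map_from_subtopology_mono[OF continuous_map_cyl])
    moreover have "continuous_map disco disco f"
      using f homeomorphic_imp_continuous_map by (auto simp: affine_with_def)
    ultimately show "continuous_map (top_of_set T) disco (\<lambda>w. f (cyl w))"
      using continuous_map_compose by (fastforce simp: o_def)
    have "continuous_map (top_of_set T) (top_of_set {z :: real ^ 2. 0 \<le> z $ 2 \<and> z $ 2 \<le> 1}) (\<lambda>w. w0 + \<mu> *\<^sub>R (M *v w))"
    proof -
      have "continuous_on T (\<lambda>w. w0 + \<mu> *\<^sub>R (M *v w))"
        by (intro continuous_intros bounded_linear.continuous_on[OF bounded_linear_matrix])
      moreover have "(\<lambda>w. w0 + \<mu> *\<^sub>R (M *v w)) ` T \<subseteq> {z :: real ^ 2. 0 \<le> z $ 2 \<and> z $ 2 \<le> 1}"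
        unfolding Hpt by (auto simp: T_def)
      ultimately show ?thesis by auto
    qed
    from continuous_map_compose[OF this continuous_map_cyl]
    show "continuous_map (top_of_set T) disco H"
      by (simp add: o_def H_def)
    show "w \<in> closure S"
    proof (rule linear_at_right_closure[of w q])
      fix \<epsilon> :: real assume \<epsilon>: "0 < \<epsilon>" "\<epsilon> < 1"
      have "e + \<mu> * d * (w $ 2 + \<epsilon> * (q $ 2 - w $ 2)) =
          (e + \<mu> * d * w $ 2) + \<epsilon> * ((e + \<mu> * d * q $ 2) - (e + \<mu> * d * w $ 2))"
        by (simp add: algebra_simps)
      then show "w + \<epsilon> *\<^sub>R (q - w) \<in> S"
        using between_strict[of "w $ 2" "q $ 2" \<epsilon>] between_strict[of "e + \<mu> * d * w $ 2" "e + \<mu> * d * q $ 2" \<epsilon>]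
          w q2 z2 \<epsilon> eq by (simp add: S_iff T_def)
    qed
  qed (use fS w in \<open>auto simp: S_iff T_def\<close>)
  have no: False if y: "0 < y" "y < 1" "e + \<mu> * d * y = 0 \<or> e + \<mu> * d * y = 1" for y
  proof -
    \<comment> \<open>This \<open>x\<close> makes the developed abscissa 0, over which both boundary
      levels carry a vertex.\<close>
    define x where "x = - (\<mu> * b * y + w0 $ 1) / (\<mu> * a)"
    have "\<mu> * a * x + \<mu> * b * y + w0 $ 1 = 0"
      using N(3) a by (simp add: x_def)
    then have "f (cyl (pt x y)) = cyl (pt 0 (e + \<mu> * d * y))"
      using fT[of "pt x y"] y Hpt[of "pt x y"] by (auto simp: T_def H_def)
    moreover have "cyl (pt 0 (e + \<mu> * d * y)) \<in> disco_sing"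
      using y(3) cyl_in_sing_iff[of "pt 0 (e + \<mu> * d * y)"] by (auto intro!: exI[of _ 0])
    ultimately show False
      using nS[of "pt x y"] y by simp
  qed
  have "0 \<le> e"
  proof (rule ccontr)
    assume neg: "\<not> 0 \<le> e"
    have "e + m * (- e / m) = 0" if "m > 0" for m :: real
      using that by simp
    from this[OF \<mu>d] have "e + \<mu> * d * (- e / (\<mu> * d)) = 0" .
    moreover have "0 < - e / (\<mu> * d)"
      using neg \<mu>d by (simp add: divide_neg_pos)
    moreover have "- e / (\<mu> * d) < q $ 2"
      unfolding pos_divide_less_eq[OF \<mu>d] eq' using z2 by simp
    ultimately show False
      using no[of "- e / (\<mu> * d)"] q2 by simp
  qed
  moreover have "e + \<mu> * d \<le> 1"
  proof (rule ccontr)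
    assume big: "\<not> e + \<mu> * d \<le> 1"
    have "e + m * ((1 - e) / m) = 1" if "m > 0" for m :: real
      using that by simp
    from this[OF \<mu>d] have "e + \<mu> * d * ((1 - e) / (\<mu> * d)) = 1" .
    moreover have "(1 - e) / (\<mu> * d) < 1"
      using big \<mu>d by (simp add: pos_divide_less_eq)
    moreover have "q $ 2 < (1 - e) / (\<mu> * d)"
      unfolding pos_less_divide_eq[OF \<mu>d] eq' using z2 by simp
    ultimately show False
      using no[of "(1 - e) / (\<mu> * d)"] q2 by simp
  qed
  ultimately have T_iff: "w \<in> T" if "0 \<le> w $ 2" "w $ 2 \<le> 1" for w
  proof -
    have "0 \<le> \<mu> * d * w $ 2" "\<mu> * d * w $ 2 \<le> \<mu> * d * 1"
      using mult_left_mono[OF that(2), of "\<mu> * d"] mult_nonneg_nonneg[OF less_imp_le[OF \<mu>d] that(1)] \<mu>d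
      by (simp_all add: less_imp_le)
    then show ?thesis
      using \<open>0 \<le> e\<close> \<open>e + \<mu> * d \<le> 1\<close> that by (simp add: T_def)
  qed
  have dev: "f (cyl (pt x y)) = cyl (pt (\<mu> * a * x + \<mu> * b * y + w0 $ 1) (e + \<mu> * d * y))" if "0 \<le> y" "y \<le> 1" for x y
    using fT[OF T_iff, of "pt x y"] that Hpt[of "pt x y"] by (simp add: H_def)
  \<comment> \<open>Boundary vertices go to singular points, which occur at heights 0 and 1 only.
    Since \<open>\<mu> * d > 0\<close>, the bottom must go to 0 and the top to 1.\<close>
  have corner: "e + \<mu> * d * y = 0 \<or> e + \<mu> * d * y = 1" if y: "y = 0 \<or> y = 1" for y
  proof -
    have "cyl (pt 0 y) \<in> disco_sing"
      using y cyl_in_sing_iff[of "pt 0 y"] by (auto intro!: exI[of _ 0])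
    then have "f (cyl (pt 0 y)) \<in> disco_sing"
      using f by (auto simp: affine_with_def)
    moreover have "0 \<le> y" "y \<le> 1" "0 \<le> e + \<mu> * d * y" "e + \<mu> * d * y \<le> 1"
      using y \<open>0 \<le> e\<close> \<open>e + \<mu> * d \<le> 1\<close> \<mu>d by auto
    ultimately show ?thesis
      using dev[of y 0] cyl_in_sing_iff[of "pt (\<mu> * a * 0 + \<mu> * b * y + w0 $ 1) (e + \<mu> * d * y)"] by simp
  qed
  have "e = 0 \<and> \<mu> * d = 1"
    using corner[of 0] corner[of 1] \<mu>d \<open>e + \<mu> * d \<le> 1\<close> by auto
  then show thesis
    using that[OF N(3), of "w0 $ 1"] dev by simp
qed

lemma horizontal_shear:
  assumes f: "affine_with M f" and M: "M = vector [vector [a, b], vector [0, d]]" and d: "d > 0"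
  obtains k :: int where "M = shear_h k"
proof -
  obtain \<mu> x0 where \<mu>: "\<mu> > 0" "\<mu> * d = 1" and dev: "\<And>x y. 0 \<le> y \<Longrightarrow> y \<le> 1 \<Longrightarrow>
      f (cyl (pt x y)) = cyl (pt (\<mu> * a * x + \<mu> * b * y + x0) y)"
    using horizontal_development[OF f M d] by metis
  have bij: "bij_betw f (topspace disco) (topspace disco)" and fS: "f ` disco_sing = disco_sing"
    using f by (simp_all add: affine_with_def Bij_def)
  have top: "cyl (pt x y) \<in> topspace disco" if "0 \<le> y" "y \<le> 1" for x y
    using continuous_map_image_subset_topspace[OF continuous_map_cyl] that by auto
  have det: "a * d = 1"
    using f by (simp add: affine_with_def M det_mat2)
  have "a > 0"
    using det d by (metis zero_less_mult_pos2 zero_less_one)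
  \<comment> \<open>Invariance under a full turn makes \<open>\<mu> * a\<close> an integer, and
    injectivity of \<open>f\<close> makes its inverse one. Being positive, it equals 1; with
    \<open>\<mu> * d = 1\<close> and \<open>a * d = 1\<close> the diagonal is trivial.\<close>
  have "f (cyl (pt 6 (1/2))) = f (cyl (pt 0 (1/2)))"
    using cyl_periodic[of 0 1 "1/2"] by simp
  then have "\<exists>k::int. \<mu> * a * 6 = 6 * real_of_int k"
    using cyl_eq_iff[of "pt (\<mu> * a * 0 + \<mu> * b * (1/2) + x0) (1/2)" "pt (\<mu> * a * 6 + \<mu> * b * (1/2) + x0) (1/2)"]
      dev[of "1/2" 6] dev[of "1/2" 0] by auto
  then obtain k :: int where k: "\<mu> * a = real_of_int k"
    by auto
  have pos: "\<mu> * a > 0"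
    using \<mu> \<open>a > 0\<close> by simp
  have "f (cyl (pt (6 / (\<mu> * a)) (1/2))) = cyl (pt ((\<mu> * b * (1/2) + x0) + 6 * real_of_int 1) (1/2))"
    using dev[of "1/2" "6 / (\<mu> * a)"] \<mu> \<open>a > 0\<close> by (simp add: algebra_simps)
  also have "\<dots> = f (cyl (pt 0 (1/2)))"
    using dev[of "1/2" 0] unfolding cyl_periodic by simp
  finally have "cyl (pt (6 / (\<mu> * a)) (1/2)) = cyl (pt 0 (1/2))"
    by (rule inj_onD[OF bij_betw_imp_inj_on[OF bij]]) (simp_all add: top)
  then have "\<exists>l::int. 6 / (\<mu> * a) = 6 * real_of_int l"
    using cyl_eq_iff[of "pt 0 (1/2)" "pt (6 / (\<mu> * a)) (1/2)"] by simp
  then obtain l :: int where "6 / (\<mu> * a) = 6 * real_of_int l" by blast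
  then have "real_of_int (k * l) = 1"
    using pos k by (simp add: field_simps)
  then have "k * l = 1"
    using of_int_eq_1_iff by blast
  moreover have "k > 0"
    using pos k by simp
  ultimately have "k = 1"
    using zmult_eq_1_iff by auto
  then have "\<mu> * a = 1"
    using k by simp
  have "a = d"
    using \<open>\<mu> * a = 1\<close> \<mu> by (metis mult_left_cancel less_irrefl)
  then have "a * a = 1"
    using det by simp
  then have "a = 1"
    using \<open>a > 0\<close> by (metis abs_of_pos abs_mult_self_eq real_sqrt_abs2 real_sqrt_one)
  then have "\<mu> = 1" "d = 1"
    using \<open>\<mu> * a = 1\<close> \<open>a = d\<close> by auto
  \<comment> \<open>The vertices on a boundary circle are \<open>{0, 1, 3, 5}\<close> modulo 6, with
    cyclic gaps 1, 2, 2, 1. The image of 0 leaves these four residues for the rotation, that of 1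
    excludes 1 and 3, and that of 3 excludes 5.\<close>
  have ex6: "\<exists>k::int. x0' = 6 * real_of_int k"
    if Z: "\<And>x. x \<in> {0, 1, 3} \<Longrightarrow> cyl (pt (x + x0') y) \<in> disco_sing" and y: "y = 0 \<or> y = 1" for x0' y
  proof -
    have Z': "\<exists>k::int. x + x0' - 6 * real_of_int k \<in> {0, 1, 3, 5}" if "x \<in> {0, 1, 3}" for x
      using Z[OF that] cyl_in_sing_iff[of "pt (x + x0') y"] y by auto
    obtain m where m: "x0' - 6 * real_of_int m \<in> {0, 1, 3, 5}"
      using Z'[of 0] by auto
    then obtain r :: int where r: "x0' = 6 * real_of_int m + real_of_int r" "r \<in> {0, 1, 3, 5}"
    proof -
      consider "x0' = 6 * real_of_int m" | "x0' = 6 * real_of_int m + 1" | "x0' = 6 * real_of_int m + 3"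
        | "x0' = 6 * real_of_int m + 5"
        using m by (auto simp: algebra_simps)
      then show thesis
        using that[of 0] that[of 1] that[of 3] that[of 5] by cases simp_all
    qed
    have shift: "\<exists>k::int. i + r + 6 * (m - k) \<in> {0, 1, 3, 5}" if i: "real_of_int i \<in> {0, 1, 3}" for i :: int
    proof -
      obtain k :: int where "real_of_int i + x0' - 6 * real_of_int k \<in> {0, 1, 3, 5}"
        using Z'[OF i] by blast
      then have "real_of_int (i + r + 6 * (m - k)) \<in> {real_of_int 0, real_of_int 1, real_of_int 3, real_of_int 5}"
        using r(1) by (auto simp: algebra_simps)
      then have "i + r + 6 * (m - k) \<in> {0, 1, 3, 5}"
        unfolding insert_iff of_int_eq_iff empty_iff .
      then show ?thesis by blast
    qed
    obtain k1 where k1: "1 + r + 6 * (m - k1) \<in> {0, 1, 3, 5}"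
      using shift[of 1] by auto
    obtain k3 where k3: "3 + r + 6 * (m - k3) \<in> {0, 1, 3, 5}"
      using shift[of 3] by auto
    have "r = 0"
      using r(2) k1 k3 unfolding insert_iff empty_iff by presburger
    then show ?thesis
      using r(1) by (intro exI[of _ m]) simp
  qed
  have sing: "cyl (pt (x + (b * y + x0)) y) \<in> disco_sing" if "x \<in> {0, 1, 3}" and y: "y = 0 \<or> y = 1" for x y
  proof -
    have "cyl (pt x y) \<in> disco_sing"
      using that cyl_in_sing_iff[of "pt x y"] by (auto intro!: exI[of _ 0])
    then have "f (cyl (pt x y)) \<in> disco_sing"
      using fS by blast
    then show ?thesis
      using dev[of y x] y \<open>\<mu> = 1\<close> \<open>a = 1\<close> by (auto simp: algebra_simps)
  qed
  \<comment> \<open>The bottom circle is rotated by \<open>x0\<close> and the top circle by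
    \<open>b + x0\<close>. Both are multiples of 6, hence so is their difference
    \<open>b\<close>.\<close>
  obtain k0 :: int where k0: "b * 0 + x0 = 6 * real_of_int k0"
    using ex6[OF sing, of 0] by auto
  obtain k1 :: int where k1: "b * 1 + x0 = 6 * real_of_int k1"
    using ex6[OF sing, of 1] by auto
  have "b = 6 * real_of_int (k1 - k0)"
    using k0 k1 by simp
  then have "M = shear_h (k1 - k0)"
    using M \<open>a = 1\<close> \<open>d = 1\<close> by simp
  then show thesis by (rule that)
qed

section \<open>Reduction of rational directions\<close>

lemma generators_SL2R: "{shear_h 1, shear_v 1, neg_id} \<subseteq> carrier SL2R"
  by (simp add: SL2R_simps det_mat2)

lemma subgroup_disco_Gamma: "subgroup disco_Gamma SL2R"
  unfolding disco_Gamma_eq by (rule group.generate_is_subgroup[OF group_SL2R generators_SL2R])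

lemma disco_Gamma_mult: "A \<in> disco_Gamma \<Longrightarrow> B \<in> disco_Gamma \<Longrightarrow> A ** B \<in> disco_Gamma"
  using subgroup.m_closed[OF subgroup_disco_Gamma] by (simp add: SL2R_simps)

lemma disco_Gamma_cancel:
  assumes "g \<in> disco_Gamma" "g ** M \<in> disco_Gamma"
  shows "M \<in> disco_Gamma"
proof -
  have g: "g \<in> carrier SL2R"
    using subgroup.subset[OF subgroup_disco_Gamma] assms(1) by blast
  have "(inv\<^bsub>SL2R\<^esub> g) \<in> disco_Gamma"
    using subgroup.m_inv_closed[OF subgroup_disco_Gamma assms(1)] .
  moreover have "(inv\<^bsub>SL2R\<^esub> g) ** (g ** M) = M"
    using group.l_inv[OF group_SL2R g] by (simp add: SL2R_simps matrix_mul_assoc)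
  ultimately show ?thesis
    using disco_Gamma_mult[OF _ assms(2)] by metis
qed

lemma disco_Gamma_elements: "mat 1 \<in> disco_Gamma" "neg_id \<in> disco_Gamma"
    "shear_h 1 \<in> disco_Gamma" "shear_h (-1) \<in> disco_Gamma" "shear_v 1 \<in> disco_Gamma" "shear_v (-1) \<in> disco_Gamma"
proof -
  show 1: "mat 1 \<in> disco_Gamma"
    using subgroup.one_closed[OF subgroup_disco_Gamma] by (simp add: SL2R_simps)
  show "neg_id \<in> disco_Gamma" and h: "shear_h 1 \<in> disco_Gamma" and v: "shear_v 1 \<in> disco_Gamma"
    unfolding disco_Gamma_eq by (auto intro: generate.incl)
  have "shear_h 1 ** shear_h (-1) = mat 1" "shear_v 1 ** shear_v (-1) = mat 1"
    by (simp_all add: mat2_times mat2_one)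
  then show "shear_h (-1) \<in> disco_Gamma" "shear_v (-1) \<in> disco_Gamma"
    using disco_Gamma_cancel[OF h, of "shear_h (-1)"] disco_Gamma_cancel[OF v, of "shear_v (-1)"] 1 by simp_all
qed

lemma shear_h_in_disco_Gamma: "shear_h k \<in> disco_Gamma"
proof (induction k rule: int_induct[of _ 0])
  case base
  then show ?case
    using disco_Gamma_elements(1) by (simp add: mat2_one)
next
  case (step1 i)
  have "shear_h 1 ** shear_h i = shear_h (i + 1)"
    by (simp add: mat2_times algebra_simps)
  then show ?case
    using disco_Gamma_mult[OF disco_Gamma_elements(3) step1(2)] by simp
next
  case (step2 i)
  have "shear_h (-1) ** shear_h i = shear_h (i - 1)"
    by (simp add: mat2_times algebra_simps)
  then show ?case
    using disco_Gamma_mult[OF disco_Gamma_elements(4) step2(2)] by simp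
qed

definition special_direction :: "real ^ 2 \<Rightarrow> bool" where
  "special_direction w \<longleftrightarrow> w $ 2 = 0 \<or> w $ 1 = 0 \<or> w $ 2 \<noteq> 0 \<and> 1 \<le> w $ 1 / w $ 2 \<and> w $ 1 / w $ 2 \<le> 4"

text \<open>Euclid's algorithm: on vectors \<open>(2p, q)\<close> the two parabolic generators act by \<open>p \<mapsto> p + 3q\<close>
  and \<open>q \<mapsto> q + 3p\<close>.\<close>

lemma disco_Gamma_reduction:
  fixes p q :: int
  shows "\<exists>g\<in>disco_Gamma. special_direction (g *v (c *\<^sub>R pt (2 * real_of_int p) (real_of_int q)))"
proof (induction "nat (\<bar>p\<bar> + \<bar>q\<bar>)" arbitrary: p q c rule: less_induct)
  case less
  let ?v = "\<lambda>c p q. c *\<^sub>R pt (2 * real_of_int p) (real_of_int q)"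
  have h: "shear_h s *v ?v c p q = ?v c (p + 3 * s * q) q" for s c and p q :: int
    by (simp add: mat2_mult eq_2_iff algebra_simps)
  have v: "shear_v s *v ?v c p q = ?v c p (q + 3 * s * p)" for s c and p q :: int
    by (simp add: mat2_mult eq_2_iff algebra_simps)
  have via: "\<exists>g\<in>disco_Gamma. special_direction (g *v ?v c p q)"
    if A: "A \<in> disco_Gamma" "A *v ?v c p q = ?v c p' q'" and ex: "\<exists>g\<in>disco_Gamma. special_direction (g *v ?v c p' q')"
    for A c and p q p' q' :: int
  proof -
    obtain g where "g \<in> disco_Gamma" "special_direction (g *v ?v c p' q')"
      using ex by blast
    then show ?thesis
      using disco_Gamma_mult[OF _ A(1)] A(2) by (intro bexI[of _ "g ** A"]) (simp_all flip: matrix_vector_mul_assoc)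
  qed
  have stop: "\<exists>g\<in>disco_Gamma. special_direction (g *v w)" if "special_direction w" for w
    using that disco_Gamma_elements(1) by (intro bexI[of _ "mat 1"]) simp_all
  have main: "\<exists>g\<in>disco_Gamma. special_direction (g *v ?v c p q)"
    if m: "\<bar>p\<bar> + \<bar>q\<bar> = \<bar>p0\<bar> + \<bar>q0\<bar>" and q: "q > 0" and p0: "p0 = p \<or> p0 = - p" and IH: "\<And>p' q' c. \<bar>p'\<bar> + \<bar>q'\<bar> < \<bar>p\<bar> + \<bar>q\<bar> \<Longrightarrow>
      \<exists>g\<in>disco_Gamma. special_direction (g *v ?v c p' q')" for c and p q p0 q0 :: int
  proof -
    have in_range: "special_direction (?v c p q)" if "q \<le> 2 * p" "p \<le> 2 * q" "q > 0" for c and p q :: int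
    proof (cases "c = 0")
      case False
      have "real_of_int q \<le> real_of_int (2 * p)" "real_of_int p \<le> real_of_int (2 * q)" "0 < real_of_int q"
        using that by (simp_all only: of_int_le_iff of_int_0_less_iff)
      then have "real_of_int q \<le> 2 * real_of_int p" "real_of_int p \<le> 2 * real_of_int q" "0 < real_of_int q"
        by simp_all
      then show ?thesis
        using False by (simp add: special_direction_def field_simps)
    qed (simp add: special_direction_def)
    \<comment> \<open>A shear by 3 decreases the measure when \<open>\<bar>p\<bar>\<close> exceeds
      \<open>3/2 q\<close> or \<open>q\<close> exceeds \<open>3/2 \<bar>p\<bar>\<close>. For
      positive \<open>p\<close> the rest lies within \<open>1/2 \<le> p/q \<le> 2\<close>, where the
      reduction stops. For negative \<open>p\<close> there remains
      \<open>-3/2 \<le> p/q \<le> -2/3\<close>, which one shear sends into that range.\<close>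
    consider "p = 0" | "p > 2 * q" | "p > 0" "q > 2 * p" | "p > 0" "q \<le> 2 * p" "p \<le> 2 * q"
      | "p < 0" "- 2 * p > 3 * q" | "p < 0" "2 * q > - 3 * p" | "p < 0" "- 2 * p \<le> 3 * q" "2 * q \<le> - 3 * p" "q \<le> - p"
      | "p < 0" "- 2 * p \<le> 3 * q" "2 * q \<le> - 3 * p" "- p < q"
      using q by linarith
    then show ?thesis
    proof cases
      case 1
      then show ?thesis by (intro stop) (simp add: special_direction_def)
    next
      case 2
      show ?thesis
        by (rule via[OF disco_Gamma_elements(4) h], rule IH) (use 2 q in linarith)
    next
      case 3
      show ?thesis
        by (rule via[OF disco_Gamma_elements(6) v], rule IH) (use 3 q in linarith)
    next
      case 4
      then show ?thesis by (intro stop in_range) (use q in auto)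
    next
      case 5
      show ?thesis
        by (rule via[OF disco_Gamma_elements(3) h], rule IH) (use 5 q in linarith)
    next
      case 6
      show ?thesis
        by (rule via[OF disco_Gamma_elements(5) v], rule IH) (use 6 q in linarith)
    next
      case 7
      show ?thesis
        by (rule via[OF disco_Gamma_elements(3) h], rule stop, rule in_range) (use 7 q in auto)
    next
      case 8
      \<comment> \<open>Here \<open>q + 3 p\<close> is negative, so both signs are changed to return
        to a positive second coordinate.\<close>
      have "?v c p (q + 3 * 1 * p) = ?v (- c) (- p) (- (q + 3 * 1 * p))"
        by (simp add: eq_2_iff algebra_simps)
      moreover have "special_direction (?v (- c) (- p) (- (q + 3 * 1 * p)))"
        using 8 q by (intro in_range) simp_all
      ultimately show ?thesis
        using via[OF disco_Gamma_elements(5) v stop] by metis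
    qed
  qed
  have IH: "\<exists>g\<in>disco_Gamma. special_direction (g *v ?v c p' q')" if "\<bar>p'\<bar> + \<bar>q'\<bar> < \<bar>p\<bar> + \<bar>q\<bar>" for p' q' c
    using less[of p' q' c] that by simp
  consider "q = 0" | "q > 0" | "q < 0" by linarith
  then show ?case
  proof cases
    case 1
    then show ?thesis by (intro stop) (simp add: special_direction_def)
  next
    case 2
    show ?thesis
      by (rule main[OF refl 2]) (use IH in auto)
  next
    case 3
    have "?v c p q = ?v (- c) (- p) (- q)"
      by (simp add: eq_2_iff)
    moreover have "\<exists>g\<in>disco_Gamma. special_direction (g *v ?v (- c) (- p) (- q))"
      by (rule main[of "- p" "- q" p q]) (use 3 IH in auto)
    ultimately show ?thesis by simp
  qed
qed

text \<open>The exclusions are applied to \<open>g ** M\<close> rather than to \<open>M\<close>: it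
  is again the linear part of an affine automorphism, because every element of
  \<open>disco_Gamma\<close> is one.\<close>

lemma Veech_reduction:
  assumes f: "affine_with M f"
  obtains g where "g \<in> disco_Gamma" "((g ** M) *v pt 1 0) $ 2 = 0"
proof -
  define v where "v = M *v pt 1 0"
  show thesis
  proof (cases "v $ 2 = 0")
    case True
    then show thesis
      using that[OF disco_Gamma_elements(1)] by (simp add: v_def)
  next
    case False
    then have "v $ 1 / v $ 2 \<in> \<rat>"
      using image_slope_rational[OF f v_def] by blast
    then obtain p q :: int where pq: "q \<noteq> 0" "v $ 1 / v $ 2 = real_of_int p / real_of_int q"
      by (metis Rats_cases' less_irrefl)
    \<comment> \<open>Doubling numerator and denominator writes the slope \<open>p / q\<close> as
      \<open>2 p / (2 q)\<close>, the form on which the reduction operates.\<close>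
    define c where "c = v $ 2 / (2 * real_of_int q)"
    have "v = c *\<^sub>R pt (2 * real_of_int p) (real_of_int (2 * q))"
      using pq False by (simp add: eq_2_iff c_def field_simps)
    then obtain g where g: "g \<in> disco_Gamma" "special_direction (g *v v)"
      using disco_Gamma_reduction[of c p "2 * q"] by auto
    obtain h where "affine_with g h"
      using disco_Gamma_subset_Veech g(1) by (auto simp: disco_Veech_eq)
    then have gf: "affine_with (g ** M) (compose (topspace disco) h f)"
      using affine_with_compose[OF f] by blast
    have w: "g *v v = (g ** M) *v pt 1 0"
      by (simp add: v_def matrix_vector_mul_assoc)
    have "(g *v v) $ 2 = 0"
      using image_slope_excluded[OF gf w] image_not_vertical[OF gf w] g(2) unfolding special_direction_def by blast
    then show thesis
      using that[OF g(1)] w by simp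
  qed
qed

text \<open>When the horizontal direction is reversed, composition with the half turn restores
  positive diagonal entries.\<close>

lemma horizontal_in_disco_Gamma:
  assumes f: "affine_with M f" and h: "(M *v pt 1 0) $ 2 = 0"
  shows "M \<in> disco_Gamma"
proof -
  define a b d where "a = M $ 1 $ 1" and "b = M $ 1 $ 2" and "d = M $ 2 $ 2"
  have "M $ 2 $ 1 = 0"
    using h by (simp add: matrix_vector_mult_def sum_2)
  then have M: "M = vector [vector [a, b], vector [0, d]]"
    by (simp add: vec_eq_iff forall_2 vector_2 a_def b_def d_def)
  have "a * d = 1"
    using f by (simp add: affine_with_def M det_mat2)
  then consider "d > 0" | "- d > 0"
    by (metis less_linear mult_zero_right neg_0_less_iff_less zero_neq_one)
  then show ?thesis
  proof cases
    case 1
    then show ?thesis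
      using horizontal_shear[OF f M] shear_h_in_disco_Gamma by metis
  next
    case 2
    have "neg_id ** M = vector [vector [- a, - b], vector [0, - d]]"
      by (simp add: M mat2_times)
    then have "neg_id ** M \<in> disco_Gamma"
      using horizontal_shear[OF affine_with_compose[OF f affine_with_rot] _ 2] shear_h_in_disco_Gamma by metis
    then show ?thesis
      using disco_Gamma_cancel[OF disco_Gamma_elements(2)] by blast
  qed
qed

theorem theorem5:
  shows "disco_Veech = disco_Gamma"
proof
  show "disco_Gamma \<subseteq> disco_Veech"
    by (rule disco_Gamma_subset_Veech)
  show "disco_Veech \<subseteq> disco_Gamma"
  proof
    fix M assume "M \<in> disco_Veech"
    then obtain f where f: "affine_with M f"
      by (auto simp: disco_Veech_eq)
    obtain g where g: "g \<in> disco_Gamma" "((g ** M) *v pt 1 0) $ 2 = 0"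
      using Veech_reduction[OF f] by blast
    obtain h where "affine_with g h"
      using disco_Gamma_subset_Veech g(1) by (auto simp: disco_Veech_eq)
    then have "g ** M \<in> disco_Gamma"
      using horizontal_in_disco_Gamma[OF affine_with_compose[OF f] g(2)] by blast
    then show "M \<in> disco_Gamma"
      by (rule disco_Gamma_cancel[OF g(1)])
  qed
qed

end
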